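(* Let $n\ge 1$, let $f:[0,1]^n\to\mathbb{R}$ be a computable Lipschitz function, and let $z\in[0,1]^n$ be computably random. Then $f$ is differentiable at $z$, i.e. there is a linear map $T:\mathbb{R}^n\to\mathbb{R}$ with $\lim_{h\to 0}\frac{f(z+h)-f(z)-T\cdot h}{\|h\|}=0$.
   Context: A function $f:[0,1]^n\to\mathbb{R}$ is computable if (1) $f(q)$ is computable uniformly in $q$ for $q$ with all coordinates dyadic rationals, and (2) there is a computable $h:\mathbb{N}\to\mathbb{N}$ such that $\|x-y\|\le 2^{-h(i)}$ implies $|f(x)-f(y)|\le 2^{-i}$ for all $x,y\in[0,1]^n$, $i\in\mathbb{N}$. A martingale is a function $B:2^{<\omega}\to\mathbb{Q}_{\ge0}$ with $2B(\sigma)=B(\sigma0)+B(\sigma1)$ for all finite binary strings $\sigma$; it succeeds on $Z\in 2^\omega$ if $\limsup_k B(Z\upharpoonright k)=\infty$. $Z\in2^\omega$ is computably random if no computable martingale succeeds on $Z$. A point $z=(0.Z_1,\dots,0.Z_n)\in[0,1]^n$ (where $0.A$ is the real with binary expansion $A\in2^\omega$) is computably random if the interleaved sequence $Z_1\oplus\dots\oplus Z_n$ is computably random. *)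

theory Defs
  imports "HOL-Analysis.Analysis" "HOL-Library.Nat_Bijection"
begin

text \<open>Computability: partial recursive functions on tuples of natural numbers (lists).\<close>

datatype recf =
    Zero
  | Succ
  | Proj nat
  | Comp recf "recf list"
  | PrimRec recf recf
  | Mu recf

text \<open>\<open>evaluates r xs y\<close>: the partial recursive function denoted by \<open>r\<close> is defined on the
  tuple \<open>xs\<close>, with value \<open>y\<close>. The recursion and search variables come first.\<close>

inductive evaluates :: "recf \<Rightarrow> nat list \<Rightarrow> nat \<Rightarrow> bool" where
  Zero: "evaluates Zero xs 0"
| Succ: "evaluates Succ [x] (Suc x)"
| Proj: "i < length xs \<Longrightarrow> evaluates (Proj i) xs (xs ! i)"
| Comp: "list_all2 (\<lambda>g y. evaluates g xs y) gs ys \<Longrightarrow> evaluates f ys z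
    \<Longrightarrow> evaluates (Comp f gs) xs z"
| PrimRec_0: "evaluates f xs y \<Longrightarrow> evaluates (PrimRec f g) (0 # xs) y"
| PrimRec_Suc: "evaluates (PrimRec f g) (m # xs) y \<Longrightarrow> evaluates g (m # y # xs) z
    \<Longrightarrow> evaluates (PrimRec f g) (Suc m # xs) z"
| Mu: "evaluates f (m # xs) 0 \<Longrightarrow> (\<forall>i<m. \<exists>y>0. evaluates f (i # xs) y)
    \<Longrightarrow> evaluates (Mu f) xs m"

definition computable_nat :: "nat \<Rightarrow> (nat list \<Rightarrow> nat) \<Rightarrow> bool" where
  "computable_nat k F \<longleftrightarrow> (\<exists>r. \<forall>xs. length xs = k \<longrightarrow> evaluates r xs (F xs))"

definition computable_rat :: "nat \<Rightarrow> (nat list \<Rightarrow> rat) \<Rightarrow> bool" where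
  "computable_rat k F \<longleftrightarrow> (\<exists>a b c. computable_nat k a \<and> computable_nat k b \<and> computable_nat k c \<and>
     (\<forall>xs. length xs = k \<longrightarrow>
        c xs > 0 \<and> F xs = (of_nat (a xs) - of_nat (b xs)) / of_nat (c xs)))"

text \<open>Martingales. The extension \<open>\<sigma>0\<close> of a string is \<open>\<sigma> @ [False]\<close>; strings are passed to
  recursive functions through the effective coding of lists from the library.\<close>

definition string_code :: "bool list \<Rightarrow> nat" where
  "string_code \<sigma> = list_encode (map of_bool \<sigma>)"

definition martingale :: "(bool list \<Rightarrow> rat) \<Rightarrow> bool" where
  "martingale B \<longleftrightarrow> (\<forall>\<sigma>. 0 \<le> B \<sigma> \<and> 2 * B \<sigma> = B (\<sigma> @ [False]) + B (\<sigma> @ [True]))"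

definition computable_martingale :: "(bool list \<Rightarrow> rat) \<Rightarrow> bool" where
  "computable_martingale B \<longleftrightarrow>
     martingale B \<and> (\<exists>F. computable_rat 1 F \<and> (\<forall>\<sigma>. B \<sigma> = F [string_code \<sigma>]))"

definition succeeds_on :: "(bool list \<Rightarrow> rat) \<Rightarrow> (nat \<Rightarrow> bool) \<Rightarrow> bool" where
  "succeeds_on B Z \<longleftrightarrow> limsup (\<lambda>k. ereal (of_rat (B (map Z [0..<k])))) = \<infinity>"

definition computably_random_seq :: "(nat \<Rightarrow> bool) \<Rightarrow> bool" where
  "computably_random_seq Z \<longleftrightarrow> \<not> (\<exists>B. computable_martingale B \<and> succeeds_on B Z)"

text \<open>The coordinates \<open>1, \<dots>, n\<close> are the elements of the index type in increasing order.\<close>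

definition coords :: "('n::{finite,linorder}) list" where
  "coords = sorted_list_of_set UNIV"

definition interleave :: "('n::{finite,linorder} \<Rightarrow> nat \<Rightarrow> bool) \<Rightarrow> nat \<Rightarrow> bool" where
  "interleave Z k = Z (coords ! (k mod CARD('n))) (k div CARD('n))"

definition binary_real :: "(nat \<Rightarrow> bool) \<Rightarrow> real" where
  "binary_real A = (\<Sum>k. of_bool (A k) / 2 ^ Suc k)"

text \<open>A point with a dyadic coordinate has more than one family of expansions, hence the
  existential quantifier. For such a point no family has a computably random interleaving.\<close>

definition computably_random :: "real ^ 'n::{finite,linorder} \<Rightarrow> bool" where
  "computably_random z \<longleftrightarrow>
     (\<exists>Z. (\<forall>i. z $ i = binary_real (Z i)) \<and> computably_random_seq (interleave Z))"

text \<open>The dyadic point with coordinates \<open>a i / 2 ^ m\<close> is given to the recursive function as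
  \<open>m\<close> followed by the numerators; the first argument \<open>p\<close> is the precision. Values of \<open>f\<close>
  outside the unit cube are irrelevant.\<close>

definition computable_on_cube :: "(real ^ 'n::{finite,linorder} \<Rightarrow> real) \<Rightarrow> bool" where
  "computable_on_cube f \<longleftrightarrow>
     (\<exists>F. computable_rat (CARD('n) + 2) F \<and>
        (\<forall>p m a. (\<forall>i. a i \<le> 2 ^ m) \<longrightarrow>
           \<bar>of_rat (F (p # m # map a coords)) - f (\<chi> i. real (a i) / 2 ^ m)\<bar> \<le> 1 / 2 ^ p)) \<and>
     (\<exists>h. computable_nat 1 (\<lambda>xs. h (hd xs)) \<and>
        (\<forall>i. \<forall>x\<in>cbox 0 1. \<forall>y\<in>cbox 0 1.
           norm (x - y) \<le> 1 / 2 ^ h i \<longrightarrow> \<bar>f x - f y\<bar> \<le> 1 / 2 ^ i))"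

end

theory Submission
  imports Defs
begin

text \<open>
Clamp \<open>f\<close> to a Lipschitz function \<open>g\<close> on the whole space. For integer vectors \<open>b\<close> and \<open>e\<close> let
\<open>W\<^sub>i(x)\<close> be the square of \<open>2 ^ i\<close> times the second difference of \<open>g\<close> at \<open>x + b / 2 ^ (i+1)\<close> with step
\<open>e / 2 ^ (i+1)\<close>, and let \<open>q\<^sub>N\<close> be the difference quotient of \<open>g\<close> with step \<open>e / 2 ^ N\<close>. By the
parallelogram identity the integral of \<open>(\<Sum>i<N. W\<^sub>i) - q\<^sub>N\<^sup>2\<close> over a dyadic box \<open>Q\<close> changes with \<open>N\<close>
only by boundary terms, so its averages form, up to summable errors, a computable martingale which is
bounded below. On a computably random \<open>z\<close> it stays bounded, hence \<open>\<Sum>i. W\<^sub>i(z) < \<infinity>\<close>: at small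
scales \<open>g\<close> is asymptotically affine around \<open>z\<close>, with slopes that may still depend on the scale.
The averages of \<open>q\<^sub>N\<close> over dyadic boxes form a bounded approximate martingale, which converges along
\<open>z\<close> because otherwise the upcrossing strategy would succeed. These averages approximate the slopes,
so the slopes converge, and together with the asymptotic affinity this is differentiability.
Integrals are replaced by averages over finite grids, which keeps all martingales rational-valued.
\<close>

section \<open>Closure properties of computable functions\<close>

text \<open>A quotient with step \<open>e / 2 ^ N\<close> is the mean of two quotients with half
  that step, based \<open>e / 2 ^ (N + 1)\<close> apart. Its square is the mean of their squares
  minus the square of half their difference, so the \<open>W\<^sub>i\<close> act like squared
  increments of a square-integrable martingale. The obstacle is that the second base point and the
  offset \<open>b\<close> may lead out of \<open>Q\<close>. Translation by \<open>w / 2 ^ N\<close>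
  disturbs the average over a box of side \<open>2 ^ -l\<close> by a multiple of
  \<open>2 ^ (l - N)\<close>; this is why the scale \<open>N\<close> has to run ahead of the length
  of the string. Martingales must be exactly fair, so they are built from half the differences of
  sibling averages, and the averages themselves only have to stay summably close to them. Finally, a
  derivative in the whole space of a function prescribed on the cube requires \<open>z\<close> to be
  an interior point; this follows from the differentiability result itself, applied to clamped
  coordinates, which have a kink on the faces.\<close>

lemma computable_nat_cong:
  assumes "\<And>xs. length xs = k \<Longrightarrow> F xs = G xs"
  shows "computable_nat k F \<longleftrightarrow> computable_nat k G"
  using assms unfolding computable_nat_def by metis

lemma computable_nat_const: "computable_nat k (\<lambda>_. c)"
proof (induction c)
  case 0
  show ?case unfolding computable_nat_def by (blast intro: evaluates.Zero)
next
  case (Suc c)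
  then obtain r where r: "\<And>xs. length xs = k \<Longrightarrow> evaluates r xs c"
    unfolding computable_nat_def by blast
  have "evaluates (Comp Succ [r]) xs (Suc c)" if "length xs = k" for xs
    by (rule evaluates.Comp[where ys = "[c]"]) (auto intro: r that evaluates.Succ)
  then show ?case unfolding computable_nat_def by blast
qed

lemma computable_nat_proj: "i < k \<Longrightarrow> computable_nat k (\<lambda>xs. xs ! i)"
  unfolding computable_nat_def by (blast intro: evaluates.Proj)

lemma computable_nat_comp:
  assumes F: "computable_nat (length Gs) F" and Gs: "\<And>G. G \<in> set Gs \<Longrightarrow> computable_nat k G"
  shows "computable_nat k (\<lambda>xs. F (map (\<lambda>G. G xs) Gs))"
proof -
  obtain r where r: "\<And>ys. length ys = length Gs \<Longrightarrow> evaluates r ys (F ys)"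
    using F unfolding computable_nat_def by blast
  obtain p where p: "\<And>G xs. G \<in> set Gs \<Longrightarrow> length xs = k \<Longrightarrow> evaluates (p G) xs (G xs)"
    using Gs unfolding computable_nat_def by metis
  have "evaluates (Comp r (map p Gs)) xs (F (map (\<lambda>G. G xs) Gs))" if "length xs = k" for xs
    by (rule evaluates.Comp[where ys = "map (\<lambda>G. G xs) Gs"])
       (auto simp: list_all2_conv_all_nth intro: r p that)
  then show ?thesis unfolding computable_nat_def by blast
qed

lemma computable_nat_primrec:
  assumes "computable_nat k b" "computable_nat (Suc (Suc k)) s"
  shows "computable_nat (Suc k)
    (\<lambda>xs. rec_nat (b (tl xs)) (\<lambda>m y. s (m # y # tl xs)) (hd xs))"
proof -
  obtain rb where rb: "\<And>xs. length xs = k \<Longrightarrow> evaluates rb xs (b xs)"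
    using assms(1) unfolding computable_nat_def by blast
  obtain rs where rs: "\<And>xs. length xs = Suc (Suc k) \<Longrightarrow> evaluates rs xs (s xs)"
    using assms(2) unfolding computable_nat_def by blast
  have *: "evaluates (PrimRec rb rs) (m # xs) (rec_nat (b xs) (\<lambda>m y. s (m # y # xs)) m)"
    if "length xs = k" for m xs
    by (induction m) (auto intro!: evaluates.PrimRec_0 evaluates.PrimRec_Suc rb rs that)
  have "evaluates (PrimRec rb rs) xs (rec_nat (b (tl xs)) (\<lambda>m y. s (m # y # tl xs)) (hd xs))"
    if "length xs = Suc k" for xs
    using that *[of "tl xs" "hd xs"] by (cases xs) auto
  then show ?thesis unfolding computable_nat_def by blast
qed

lemma computable_nat_comp1:
  assumes "computable_nat 1 (\<lambda>ys. f (ys ! 0))" "computable_nat k F"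
  shows "computable_nat k (\<lambda>xs. f (F xs))"
  using computable_nat_comp[of "[F]" "\<lambda>ys. f (ys ! 0)" k] assms by simp

lemma computable_nat_comp2:
  assumes "computable_nat 2 (\<lambda>ys. f (ys ! 0) (ys ! 1))" "computable_nat k F" "computable_nat k G"
  shows "computable_nat k (\<lambda>xs. f (F xs) (G xs))"
  using computable_nat_comp[of "[F, G]" "\<lambda>ys. f (ys ! 0) (ys ! 1)" k] assms
  by (auto simp: numeral_2_eq_2)

lemma computable_nat_Suc:
  assumes "computable_nat k F"
  shows "computable_nat k (\<lambda>xs. Suc (F xs))"
proof (rule computable_nat_comp1[OF _ assms])
  have "evaluates Succ xs (Suc (xs ! 0))" if "length xs = 1" for xs
    using that evaluates.Succ by (cases xs) auto
  then show "computable_nat 1 (\<lambda>ys. Suc (ys ! 0))"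
    unfolding computable_nat_def by blast
qed

text \<open>With \<open>j = 0\<close> a computed value is put in front of the arguments; with
  \<open>j = 2\<close> it replaces the first two, which in the step of a primitive recursion are the
  counter and the accumulator.\<close>

lemma computable_nat_Cons_drop:
  assumes F: "computable_nat (Suc k) F" and G: "computable_nat (k + j) G"
  shows "computable_nat (k + j) (\<lambda>ws. F (G ws # drop j ws))"
proof -
  have "computable_nat (k + j) (\<lambda>ws. F (map (\<lambda>G. G ws) (G # map (\<lambda>i ws. ws ! (j + i)) [0..<k])))"
    by (rule computable_nat_comp) (auto simp: F G intro: computable_nat_proj)
  also have "?this \<longleftrightarrow> ?thesis"
  proof (rule computable_nat_cong)
    fix ws :: "nat list" assume "length ws = k + j"
    then have "map ((\<lambda>G. G ws) \<circ> (\<lambda>i ws. ws ! (j + i))) [0..<k] = drop j ws"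
      by (intro nth_equalityI) auto
    then show "F (map (\<lambda>G. G ws) (G # map (\<lambda>i ws. ws ! (j + i)) [0..<k])) = F (G ws # drop j ws)"
      by simp
  qed
  finally show ?thesis .
qed

lemma computable_nat_Cons:
  assumes "computable_nat (Suc k) F" "computable_nat k G"
  shows "computable_nat k (\<lambda>ws. F (G ws # ws))"
  using computable_nat_Cons_drop[of k F 0 G] assms by simp

lemma computable_nat_rec:
  assumes "computable_nat k N" "computable_nat k b" "computable_nat (Suc (Suc k)) s"
  shows "computable_nat k (\<lambda>xs. rec_nat (b xs) (\<lambda>m y. s (m # y # xs)) (N xs))"
  using computable_nat_Cons[OF computable_nat_primrec[OF assms(2,3)] assms(1)] by simp

lemma computable_nat_add:
  assumes "computable_nat k F" "computable_nat k G"
  shows "computable_nat k (\<lambda>xs. F xs + G xs)"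
proof -
  have eq: "rec_nat b (\<lambda>m y. Suc y) n = n + b" for n b :: nat by (induction n) auto
  show ?thesis
    using computable_nat_rec[OF assms computable_nat_Suc[OF computable_nat_proj[of 1]]]
    by (simp add: eq)
qed

lemma computable_nat_skip:
  assumes "computable_nat (Suc k) F"
  shows "computable_nat (Suc (Suc k)) (\<lambda>ws. F (ws ! 0 # drop 2 ws))"
  using computable_nat_Cons_drop[of k F 2 "\<lambda>ws. ws ! 0"] assms
  by (simp add: computable_nat_proj)

lemma computable_nat_sum:
  assumes "computable_nat (Suc k) F" "computable_nat k N"
  shows "computable_nat k (\<lambda>xs. \<Sum>u<N xs. F (u # xs))"
proof -
  have eq: "rec_nat 0 (\<lambda>m y. y + F (m # xs)) n = (\<Sum>u<n. F (u # xs))" for n xs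
    by (induction n) auto
  have "computable_nat (Suc (Suc k)) (\<lambda>ws. ws ! 1 + F (ws ! 0 # drop 2 ws))"
    by (intro computable_nat_add computable_nat_skip assms computable_nat_proj) auto
  from computable_nat_rec[OF assms(2) computable_nat_const[of _ 0] this]
  show ?thesis by (simp add: eq)
qed

lemma computable_nat_mult:
  assumes "computable_nat k F" "computable_nat k G"
  shows "computable_nat k (\<lambda>xs. F xs * G xs)"
proof (rule computable_nat_comp2[OF _ assms])
  have "computable_nat 2 (\<lambda>xs. \<Sum>u<xs ! 0. (u # xs) ! 2)"
    by (rule computable_nat_sum) (auto intro: computable_nat_proj)
  then show "computable_nat 2 (\<lambda>ys. ys ! 0 * ys ! 1)" by (simp add: numeral_2_eq_2)
qed

lemma computable_nat_prod:
  assumes "computable_nat (Suc k) F" "computable_nat k N"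
  shows "computable_nat k (\<lambda>xs. \<Prod>u<N xs. F (u # xs))"
proof -
  have eq: "rec_nat (Suc 0) (\<lambda>m y. y * F (m # xs)) n = (\<Prod>u<n. F (u # xs))" for n xs
    by (induction n) auto
  have "computable_nat (Suc (Suc k)) (\<lambda>ws. ws ! 1 * F (ws ! 0 # drop 2 ws))"
    by (intro computable_nat_mult computable_nat_skip assms computable_nat_proj) auto
  from computable_nat_rec[OF assms(2) computable_nat_const[of _ "Suc 0"] this]
  show ?thesis by (simp add: eq)
qed

lemma computable_nat_power:
  assumes "computable_nat k F" "computable_nat k G"
  shows "computable_nat k (\<lambda>xs. F xs ^ G xs)"
proof (rule computable_nat_comp2[OF _ assms])
  have "computable_nat 2 (\<lambda>xs. \<Prod>u<xs ! 1. (u # xs) ! 1)"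
    by (rule computable_nat_prod) (auto intro: computable_nat_proj)
  then show "computable_nat 2 (\<lambda>ys. ys ! 0 ^ ys ! 1)" by (simp add: numeral_2_eq_2)
qed

lemma computable_nat_diff:
  assumes "computable_nat k F" "computable_nat k G"
  shows "computable_nat k (\<lambda>xs. F xs - G xs)"
proof -
  have eq: "rec_nat 0 (\<lambda>m y. m) n = n - 1" for n :: nat by (cases n) auto
  have "computable_nat 1 (\<lambda>xs. rec_nat 0 (\<lambda>m y. (m # y # xs) ! 0) (xs ! 0))"
    by (intro computable_nat_rec computable_nat_proj computable_nat_const) auto
  then have pred: "computable_nat 1 (\<lambda>xs. xs ! 0 - 1)" by (simp add: eq)
  have eq': "rec_nat a (\<lambda>m y. y - Suc 0) n = a - n" for a n :: nat by (induction n) auto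
  have "computable_nat k (\<lambda>xs. rec_nat (F xs) (\<lambda>m y. (m # y # xs) ! 1 - 1) (G xs))"
    by (intro computable_nat_rec assms computable_nat_comp1[OF pred] computable_nat_proj) auto
  then show ?thesis by (simp add: eq')
qed

section \<open>Decidable predicates, case distinction and division\<close>

definition computable_pred :: "nat \<Rightarrow> (nat list \<Rightarrow> bool) \<Rightarrow> bool" where
  "computable_pred k P \<longleftrightarrow> computable_nat k (\<lambda>xs. of_bool (P xs))"

lemma computable_pred_le:
  assumes "computable_nat k F" "computable_nat k G"
  shows "computable_pred k (\<lambda>xs. F xs \<le> G xs)"
proof -
  have "of_bool (a \<le> b) = 1 - (a - b)" for a b :: nat by auto
  then show ?thesis unfolding computable_pred_def
    by (simp only:) (intro computable_nat_diff computable_nat_const assms)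
qed

lemma computable_pred_not:
  assumes "computable_pred k P"
  shows "computable_pred k (\<lambda>xs. \<not> P xs)"
proof -
  have "of_bool (\<not> p) = (1 :: nat) - of_bool p" for p by auto
  then show ?thesis using assms unfolding computable_pred_def
    by (simp only:) (intro computable_nat_diff computable_nat_const)
qed

lemma computable_pred_conj:
  assumes "computable_pred k P" "computable_pred k Q"
  shows "computable_pred k (\<lambda>xs. P xs \<and> Q xs)"
  using assms unfolding computable_pred_def of_bool_conj by (rule computable_nat_mult)

lemma computable_pred_less:
  assumes "computable_nat k F" "computable_nat k G"
  shows "computable_pred k (\<lambda>xs. F xs < G xs)"
  using computable_pred_not[OF computable_pred_le[OF assms(2,1)]] by (simp add: not_le)

lemma computable_pred_eq:
  assumes "computable_nat k F" "computable_nat k G"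
  shows "computable_pred k (\<lambda>xs. F xs = G xs)"
  using computable_pred_conj[OF computable_pred_le[OF assms] computable_pred_le[OF assms(2,1)]]
  by (simp add: eq_iff)

lemma computable_nat_if:
  assumes "computable_pred k P" "computable_nat k F" "computable_nat k G"
  shows "computable_nat k (\<lambda>xs. if P xs then F xs else G xs)"
proof -
  have "(if p then a else b) = of_bool p * a + (1 - of_bool p) * b" for p and a b :: nat by auto
  then show ?thesis using assms unfolding computable_pred_def
    by (simp only:) (intro computable_nat_add computable_nat_mult computable_nat_diff computable_nat_const)
qed

lemma computable_nat_min:
  assumes "computable_nat k F" "computable_nat k G"
  shows "computable_nat k (\<lambda>xs. min (F xs) (G xs))"
  unfolding min_def by (intro computable_nat_if computable_pred_le assms)

lemma computable_nat_div:
  assumes "computable_nat k F" "computable_nat k G"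
  shows "computable_nat k (\<lambda>xs. F xs div G xs)"
proof (rule computable_nat_comp2[OF _ assms])
  \<comment> \<open>The quotient counts the positive multiples of \<open>d\<close> up to
    \<open>m\<close>; this bounded sum replaces a search. The case \<open>d = 0\<close> is split off
    because the count would then be \<open>m\<close>, not 0.\<close>
  have eq: "m div d = (if d = 0 then 0 else \<Sum>q<m. of_bool (Suc q * d \<le> m))" for m d :: nat
  proof (cases "d = 0")
    case False
    then have "(\<Sum>q<m. of_bool (Suc q * d \<le> m)) = card ({..<m} \<inter> {q. Suc q * d \<le> m})"
      by (simp add: sum.If_cases of_bool_def)
    also have "{..<m} \<inter> {q. Suc q * d \<le> m} = {..<m div d}"
    proof -
      have "q < m" if "Suc q * d \<le> m" for q
        using that False mult_le_mono2[of 1 d "Suc q"] by simp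
      moreover have "Suc q * d \<le> m \<longleftrightarrow> q < m div d" for q
        using False by (simp only: less_eq_div_iff_mult_less_eq Suc_le_eq[symmetric])
      ultimately show ?thesis by blast
    qed
    finally show ?thesis using False by simp
  qed auto
  have "computable_nat 2 (\<lambda>xs. if xs ! 1 = 0 then 0 else
     \<Sum>q<xs ! 0. of_bool (Suc ((q # xs) ! 0) * ((q # xs) ! 2) \<le> (q # xs) ! 1))"
    by (intro computable_nat_if computable_nat_sum computable_pred_eq computable_nat_proj computable_nat_const
        computable_pred_le[unfolded computable_pred_def] computable_nat_mult computable_nat_Suc) auto
  then show "computable_nat 2 (\<lambda>ys. ys ! 0 div ys ! 1)"
    by (subst eq) (simp add: numeral_2_eq_2 cong: if_cong)
qed

lemma computable_nat_mod:
  assumes "computable_nat k F" "computable_nat k G"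
  shows "computable_nat k (\<lambda>xs. F xs mod G xs)"
  unfolding modulo_nat_def by (intro computable_nat_diff computable_nat_mult computable_nat_div assms)

lemmas computable_nat_intros = computable_nat_const computable_nat_proj computable_nat_Suc
  computable_nat_add computable_nat_mult computable_nat_diff computable_nat_power computable_nat_div
  computable_nat_mod computable_nat_min

lemma computable_nat_prod_encode:
  assumes "computable_nat k F" "computable_nat k G"
  shows "computable_nat k (\<lambda>xs. prod_encode (F xs, G xs))"
  unfolding prod_encode_def prod.case triangle_def by (intro computable_nat_intros assms)

text \<open>Decoding by exhaustive search: both components are at most the code, and injectivity of
  \<open>prod_encode\<close> leaves only the summand of the decoded pair.\<close>

lemma prod_decode_eq_sum:
  "h (prod_decode n) = (\<Sum>a<Suc n. \<Sum>b<Suc n. of_bool (prod_encode (a, b) = n) * h (a, b))"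
  for h :: "nat \<times> nat \<Rightarrow> nat"
proof -
  obtain a b where ab: "prod_decode n = (a, b)" by fastforce
  then have n: "n = prod_encode (a, b)" by (metis prod_decode_inverse)
  have "(\<Sum>a'<Suc n. \<Sum>b'<Suc n. of_bool (prod_encode (a', b') = n) * h (a', b'))
     = (\<Sum>a'<Suc n. \<Sum>b'<Suc n. if b' = b then (if a' = a then h (a, b) else 0) else 0)"
    by (intro sum.cong) (auto simp: n inj_eq[OF inj_prod_encode])
  also have "\<dots> = h (a, b)"
    using le_prod_encode_1[of a b] le_prod_encode_2[of b a]
    by (simp add: n less_Suc_eq_le del: sum.lessThan_Suc)
  finally show ?thesis using ab by simp
qed

lemma computable_nat_prod_decode:
  assumes "computable_nat k F"
  shows "computable_nat k (\<lambda>xs. fst (prod_decode (F xs)))"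
    "computable_nat k (\<lambda>xs. snd (prod_decode (F xs)))"
proof -
  have "computable_nat 1 (\<lambda>xs. h (prod_decode (xs ! 0)))"
    if h: "computable_nat (Suc (Suc 1)) (\<lambda>xs. h (xs ! 1, xs ! 0))" for h :: "nat \<times> nat \<Rightarrow> nat"
  proof -
    have "computable_nat (Suc (Suc 1)) (\<lambda>zs. of_bool (prod_encode (zs ! 1, zs ! 0) = zs ! 2) * h (zs ! 1, zs ! 0))"
      by (intro computable_nat_intros computable_pred_eq[unfolded computable_pred_def]
          computable_nat_prod_encode h) auto
    then have "computable_nat (Suc 1) (\<lambda>ys. \<Sum>b<Suc (ys ! 1).
        (\<lambda>zs. of_bool (prod_encode (zs ! 1, zs ! 0) = zs ! 2) * h (zs ! 1, zs ! 0)) (b # ys))"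
      by (rule computable_nat_sum) (intro computable_nat_intros, simp)
    then have "computable_nat 1 (\<lambda>xs. \<Sum>a<Suc (xs ! 0). (\<lambda>ys. \<Sum>b<Suc (ys ! 1).
        (\<lambda>zs. of_bool (prod_encode (zs ! 1, zs ! 0) = zs ! 2) * h (zs ! 1, zs ! 0)) (b # ys)) (a # xs))"
      by (rule computable_nat_sum) (intro computable_nat_intros, simp)
    then show ?thesis by (subst prod_decode_eq_sum) (simp add: eval_nat_numeral)
  qed
  from this[of fst] this[of snd] have
    "computable_nat 1 (\<lambda>xs. fst (prod_decode (xs ! 0)))" "computable_nat 1 (\<lambda>xs. snd (prod_decode (xs ! 0)))"
    by (auto intro!: computable_nat_proj)
  then show "computable_nat k (\<lambda>xs. fst (prod_decode (F xs)))"
    "computable_nat k (\<lambda>xs. snd (prod_decode (F xs)))"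
    using assms by (auto intro: computable_nat_comp1[where f = "\<lambda>n. fst (prod_decode n)"]
      computable_nat_comp1[where f = "\<lambda>n. snd (prod_decode n)"])
qed

lemma computable_nat_shift:
  assumes "computable_nat k F"
  shows "computable_nat (Suc k) (\<lambda>ws. F (tl ws))"
proof -
  have "computable_nat (Suc k) (\<lambda>ws. F (map (\<lambda>G. G ws) (map (\<lambda>i ws. ws ! Suc i) [0..<k])))"
    by (rule computable_nat_comp) (auto intro: computable_nat_proj assms)
  also have "?this \<longleftrightarrow> ?thesis"
  proof (rule computable_nat_cong)
    fix ws :: "nat list" assume "length ws = Suc k"
    then have "map ((\<lambda>G. G ws) \<circ> (\<lambda>i ws. ws ! Suc i)) [0..<k] = tl ws"
      by (intro nth_equalityI) (auto simp: nth_tl)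
    then show "F (map (\<lambda>G. G ws) (map (\<lambda>i ws. ws ! Suc i) [0..<k])) = F (tl ws)"
      by simp
  qed
  finally show ?thesis .
qed

section \<open>Rational-valued computable functions\<close>

lemma computable_ratI:
  assumes "computable_nat k a" "computable_nat k b" "computable_nat k c"
    and "\<And>xs. length xs = k \<Longrightarrow> c xs > 0"
    and "\<And>xs. length xs = k \<Longrightarrow> F xs = (of_nat (a xs) - of_nat (b xs)) / of_nat (c xs)"
  shows "computable_rat k F"
  using assms unfolding computable_rat_def by blast

lemma computable_ratE:
  assumes "computable_rat k F"
  obtains a b c where "computable_nat k a" "computable_nat k b" "computable_nat k c"
    and "\<And>xs. length xs = k \<Longrightarrow> c xs > 0"
    and "\<And>xs. length xs = k \<Longrightarrow> F xs = (of_nat (a xs) - of_nat (b xs)) / of_nat (c xs)"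
  using assms unfolding computable_rat_def by blast

lemma computable_rat_of_nat:
  "computable_nat k F \<Longrightarrow> computable_rat k (\<lambda>xs. of_nat (F xs))"
  by (rule computable_ratI[where b = "\<lambda>_. 0" and c = "\<lambda>_. 1"]) (auto intro: computable_nat_const)

lemma computable_rat_const: "computable_rat k (\<lambda>_. q)"
proof -
  obtain i d where q: "quotient_of q = (i, d)" by fastforce
  have d: "d > 0" using quotient_of_denom_pos[OF q] .
  have "q = of_int i / of_int d" using quotient_of_div[OF q] .
  moreover have "(of_int i :: rat) = of_nat (nat i) - of_nat (nat (- i))" by (cases "i \<ge> 0") auto
  moreover have "(of_int d :: rat) = of_nat (nat d)" using d by simp
  ultimately have "q = (of_nat (nat i) - of_nat (nat (- i))) / of_nat (nat d)" by (simp only:)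
  with d show ?thesis
    by (intro computable_ratI[where a = "\<lambda>_. nat i" and b = "\<lambda>_. nat (- i)" and c = "\<lambda>_. nat d"])
       (auto intro: computable_nat_const)
qed

lemma computable_rat_add:
  assumes "computable_rat k F" "computable_rat k G"
  shows "computable_rat k (\<lambda>xs. F xs + G xs)"
proof -
  from assms(1) obtain a b c where 1: "computable_nat k a" "computable_nat k b" "computable_nat k c"
    "\<And>xs. length xs = k \<Longrightarrow> c xs > 0"
    "\<And>xs. length xs = k \<Longrightarrow> F xs = (of_nat (a xs) - of_nat (b xs)) / of_nat (c xs)"
    by (erule computable_ratE)
  from assms(2) obtain a' b' c' where 2: "computable_nat k a'" "computable_nat k b'" "computable_nat k c'"
    "\<And>xs. length xs = k \<Longrightarrow> c' xs > 0"
    "\<And>xs. length xs = k \<Longrightarrow> G xs = (of_nat (a' xs) - of_nat (b' xs)) / of_nat (c' xs)"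
    by (erule computable_ratE)
  show ?thesis
  proof (rule computable_ratI)
    show "computable_nat k (\<lambda>xs. a xs * c' xs + a' xs * c xs)"
      "computable_nat k (\<lambda>xs. b xs * c' xs + b' xs * c xs)" "computable_nat k (\<lambda>xs. c xs * c' xs)"
      by (intro computable_nat_intros 1 2)+
    fix xs :: "nat list" assume l: "length xs = k"
    have c: "c xs > 0" "c' xs > 0" using 1(4) 2(4) l by auto
    then show "c xs * c' xs > 0" by simp
    show "F xs + G xs = (of_nat (a xs * c' xs + a' xs * c xs) - of_nat (b xs * c' xs + b' xs * c xs)) / of_nat (c xs * c' xs)"
      using c by (simp add: 1(5)[OF l] 2(5)[OF l] field_simps)
  qed
qed

lemma computable_rat_mult:
  assumes "computable_rat k F" "computable_rat k G"
  shows "computable_rat k (\<lambda>xs. F xs * G xs)"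
proof -
  from assms(1) obtain a b c where 1: "computable_nat k a" "computable_nat k b" "computable_nat k c"
    "\<And>xs. length xs = k \<Longrightarrow> c xs > 0"
    "\<And>xs. length xs = k \<Longrightarrow> F xs = (of_nat (a xs) - of_nat (b xs)) / of_nat (c xs)"
    by (erule computable_ratE)
  from assms(2) obtain a' b' c' where 2: "computable_nat k a'" "computable_nat k b'" "computable_nat k c'"
    "\<And>xs. length xs = k \<Longrightarrow> c' xs > 0"
    "\<And>xs. length xs = k \<Longrightarrow> G xs = (of_nat (a' xs) - of_nat (b' xs)) / of_nat (c' xs)"
    by (erule computable_ratE)
  show ?thesis
  proof (rule computable_ratI)
    show "computable_nat k (\<lambda>xs. a xs * a' xs + b xs * b' xs)"
      "computable_nat k (\<lambda>xs. a xs * b' xs + b xs * a' xs)" "computable_nat k (\<lambda>xs. c xs * c' xs)"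
      by (intro computable_nat_intros 1 2)+
    fix xs :: "nat list" assume l: "length xs = k"
    have c: "c xs > 0" "c' xs > 0" using 1(4) 2(4) l by auto
    then show "c xs * c' xs > 0" by simp
    show "F xs * G xs = (of_nat (a xs * a' xs + b xs * b' xs) - of_nat (a xs * b' xs + b xs * a' xs)) / of_nat (c xs * c' xs)"
      using c by (simp add: 1(5)[OF l] 2(5)[OF l] field_simps)
  qed
qed

lemma computable_rat_uminus:
  "computable_rat k F \<Longrightarrow> computable_rat k (\<lambda>xs. - F xs)"
  using computable_rat_mult[OF computable_rat_const[of k "-1"], of F] by simp

lemma computable_rat_diff:
  "computable_rat k F \<Longrightarrow> computable_rat k G \<Longrightarrow> computable_rat k (\<lambda>xs. F xs - G xs)"
  using computable_rat_add[of k F "\<lambda>xs. - G xs"] computable_rat_uminus[of k G] by simp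

lemma computable_rat_power2:
  "computable_rat k F \<Longrightarrow> computable_rat k (\<lambda>xs. (F xs)\<^sup>2)"
  unfolding power2_eq_square by (rule computable_rat_mult)

lemma computable_rat_inverse_of_nat:
  assumes "computable_nat k F" "\<And>xs. length xs = k \<Longrightarrow> F xs > 0"
  shows "computable_rat k (\<lambda>xs. inverse (of_nat (F xs)))"
  using assms by (intro computable_ratI[where a = "\<lambda>_. 1" and b = "\<lambda>_. 0" and c = F])
    (auto simp: field_simps intro: computable_nat_const)

lemma computable_rat_two_power:
  assumes "computable_nat k F"
  shows "computable_rat k (\<lambda>xs. 2 ^ F xs)" "computable_rat k (\<lambda>xs. inverse (2 ^ F xs))"
  using computable_rat_of_nat[of k "\<lambda>xs. 2 ^ F xs"] computable_rat_inverse_of_nat[of k "\<lambda>xs. 2 ^ F xs"]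
    computable_nat_power[OF computable_nat_const[of k 2] assms] by simp_all

lemma computable_rat_comp:
  assumes "computable_rat (length Gs) F" "\<And>G. G \<in> set Gs \<Longrightarrow> computable_nat k G"
  shows "computable_rat k (\<lambda>xs. F (map (\<lambda>G. G xs) Gs))"
proof -
  from assms(1) obtain a b c where 1: "computable_nat (length Gs) a" "computable_nat (length Gs) b"
    "computable_nat (length Gs) c" "\<And>xs. length xs = length Gs \<Longrightarrow> c xs > 0"
    "\<And>xs. length xs = length Gs \<Longrightarrow> F xs = (of_nat (a xs) - of_nat (b xs)) / of_nat (c xs)"
    by (erule computable_ratE)
  show ?thesis
    by (rule computable_ratI[OF computable_nat_comp computable_nat_comp computable_nat_comp])
       (simp_all add: 1(1-3) 1(4)[of "map _ _"] 1(5)[of "map _ _"] assms(2))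
qed

lemma computable_rat_comp2:
  assumes "computable_rat 2 (\<lambda>ys. f (ys ! 0) (ys ! 1))" "computable_nat k F" "computable_nat k G"
  shows "computable_rat k (\<lambda>xs. f (F xs) (G xs))"
  using computable_rat_comp[of "[F, G]" "\<lambda>ys. f (ys ! 0) (ys ! 1)" k] assms
  by (auto simp: numeral_2_eq_2)

text \<open>The product \<open>C\<close> of all denominators is a common denominator. Each
  \<open>c (u # xs)\<close> divides it, so the natural-number division in the numerators is
  exact.\<close>

lemma computable_rat_sum:
  assumes F: "computable_rat (Suc k) F" and N: "computable_nat k N"
  shows "computable_rat k (\<lambda>xs. \<Sum>u<N xs. F (u # xs))"
proof -
  from F obtain a b c where 1: "computable_nat (Suc k) a" "computable_nat (Suc k) b"
    "computable_nat (Suc k) c" "\<And>xs. length xs = Suc k \<Longrightarrow> c xs > 0"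
    "\<And>xs. length xs = Suc k \<Longrightarrow> F xs = (of_nat (a xs) - of_nat (b xs)) / of_nat (c xs)"
    by (erule computable_ratE)
  define C where "C xs = (\<Prod>u<N xs. c (u # xs))" for xs
  have C: "computable_nat k C" unfolding C_def by (intro computable_nat_prod 1 N)
  have tl: "computable_nat (Suc k) (\<lambda>ws. C (tl ws))" by (rule computable_nat_shift[OF C])
  have sum: "computable_nat k (\<lambda>xs. \<Sum>u<N xs. h (u # xs) * (C xs div c (u # xs)))"
    if "computable_nat (Suc k) h" for h
  proof -
    have "computable_nat (Suc k) (\<lambda>ws. h ws * (C (tl ws) div c ws))"
      by (intro computable_nat_mult computable_nat_div that tl 1)
    from computable_nat_sum[OF this N] show ?thesis by simp
  qed
  show ?thesis
  proof (rule computable_ratI[OF sum[OF 1(1)] sum[OF 1(2)] C])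
    fix xs :: "nat list" assume l: "length xs = k"
    have c: "c (u # xs) > 0" for u using 1(4)[of "u # xs"] l by simp
    then show pos: "C xs > 0" unfolding C_def by (simp add: prod_pos)
    have "F (u # xs) = (of_nat (a (u # xs) * (C xs div c (u # xs))) - of_nat (b (u # xs) * (C xs div c (u # xs)))) / of_nat (C xs)"
      if "u < N xs" for u
    proof -
      have "c (u # xs) dvd C xs" unfolding C_def using that by (intro dvd_prodI) auto
      then obtain d where d: "C xs = c (u # xs) * d" by blast
      with c[of u] have "C xs div c (u # xs) = d" "d > 0" using pos by auto
      then show ?thesis using l 1(5)[of "u # xs"] by (simp add: d left_diff_distrib[symmetric])
    qed
    then have "(\<Sum>u<N xs. F (u # xs)) = (\<Sum>u<N xs. (of_nat (a (u # xs) * (C xs div c (u # xs)))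
      - of_nat (b (u # xs) * (C xs div c (u # xs)))) / of_nat (C xs))"
      by (intro sum.cong) auto
    also have "\<dots> = (\<Sum>u<N xs. of_nat (a (u # xs) * (C xs div c (u # xs)))
      - of_nat (b (u # xs) * (C xs div c (u # xs)))) / of_nat (C xs)"
      by (rule sum_divide_distrib[symmetric])
    finally show "(\<Sum>u<N xs. F (u # xs)) = (of_nat (\<Sum>u<N xs. a (u # xs) * (C xs div c (u # xs)))
      - of_nat (\<Sum>u<N xs. b (u # xs) * (C xs div c (u # xs)))) / of_nat (C xs)"
      by (simp only: of_nat_sum sum_subtractf)
  qed
qed

lemma computable_pred_rat_le:
  assumes "computable_rat k F" "computable_rat k G"
  shows "computable_pred k (\<lambda>xs. F xs \<le> G xs)"
proof -
  from computable_rat_diff[OF assms] obtain a b c where 1: "computable_nat k a" "computable_nat k b" "computable_nat k c"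
    "\<And>xs. length xs = k \<Longrightarrow> c xs > 0"
    "\<And>xs. length xs = k \<Longrightarrow> F xs - G xs = (of_nat (a xs) - of_nat (b xs)) / of_nat (c xs)"
    by (erule computable_ratE)
  have "F xs \<le> G xs \<longleftrightarrow> a xs \<le> b xs" if l: "length xs = k" for xs
  proof -
    have "F xs \<le> G xs \<longleftrightarrow> (of_nat (a xs) - of_nat (b xs)) / of_nat (c xs) \<le> (0 :: rat)"
      using 1(5)[OF l] by linarith
    then show ?thesis using 1(4)[OF l] by (simp add: divide_le_0_iff)
  qed
  then show ?thesis using computable_pred_le[OF 1(1,2)] unfolding computable_pred_def
    using computable_nat_cong[of k "\<lambda>xs. of_bool (F xs \<le> G xs)"] by simp
qed

lemma computable_pred_rat_less:
  assumes "computable_rat k F" "computable_rat k G"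
  shows "computable_pred k (\<lambda>xs. F xs < G xs)"
  using computable_pred_not[OF computable_pred_rat_le[OF assms(2,1)]] by (simp add: not_le)

lemmas computable_rat_intros = computable_rat_of_nat computable_rat_const computable_rat_add
  computable_rat_mult computable_rat_diff computable_rat_power2 computable_rat_two_power

section \<open>Gains of betting strategies\<close>

text \<open>The code of a nonempty list is the successor of a pair code whose second component
  encodes the tail. On 0, the code of the empty list, truncated subtraction and
  \<open>prod_decode 0 = (0, 0)\<close> give 0 again, so dropping too much is harmless.\<close>

definition code_drop :: "nat \<Rightarrow> nat \<Rightarrow> nat" where
  "code_drop s i = rec_nat s (\<lambda>_ y. snd (prod_decode (y - 1))) i"

lemma code_drop_list_encode: "code_drop (list_encode xs) i = list_encode (drop i xs)"
proof (induction i)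
  case (Suc i)
  have tl: "snd (prod_decode (list_encode ys - 1)) = list_encode (tl ys)" for ys
  proof (cases ys)
    case Nil
    have "prod_decode 0 = (0, 0)"
      using prod_encode_inverse[of "(0, 0)"] by (simp add: prod_encode_def)
    with Nil show ?thesis by simp
  qed simp
  have "code_drop (list_encode xs) (Suc i) = snd (prod_decode (code_drop (list_encode xs) i - 1))"
    by (simp add: code_drop_def)
  also have "\<dots> = list_encode (drop (Suc i) xs)"
    by (simp only: Suc tl drop_Suc tl_drop)
  finally show ?case .
qed (simp add: code_drop_def)

text \<open>The length is the number of nonempty tails; a list is no longer than its code, so
  \<open>i < s\<close> covers all of them.\<close>

definition code_length :: "nat \<Rightarrow> nat" where
  "code_length s = (\<Sum>i<s. of_bool (code_drop s i > 0))"

definition code_nth :: "nat \<Rightarrow> nat \<Rightarrow> nat" where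
  "code_nth s i = fst (prod_decode (code_drop s i - 1))"

lemma length_le_list_encode: "length xs \<le> list_encode xs"
proof (induction xs)
  case (Cons x xs)
  then show ?case using le_prod_encode_2[of "list_encode xs" x] by simp
qed simp

lemma code_length_list_encode: "code_length (list_encode xs) = length xs"
proof -
  have pos: "list_encode ys > 0 \<longleftrightarrow> ys \<noteq> []" for ys by (cases ys) auto
  have "code_length (list_encode xs) = card ({..<list_encode xs} \<inter> {i. i < length xs})"
    unfolding code_length_def code_drop_list_encode pos by (simp add: of_bool_def sum.If_cases not_le)
  also have "{..<list_encode xs} \<inter> {i. i < length xs} = {..<length xs}"
    using length_le_list_encode[of xs] by auto
  finally show ?thesis by simp
qed

lemma code_nth_list_encode: "i < length xs \<Longrightarrow> code_nth (list_encode xs) i = xs ! i"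
  unfolding code_nth_def code_drop_list_encode by (simp add: Cons_nth_drop_Suc[symmetric])

text \<open>A string of length \<open>k\<close> is represented by \<open>k\<close> and a number
  below \<open>2 ^ k\<close>, first bit least significant. Its two extensions are then
  \<open>v\<close> and \<open>v + 2 ^ k\<close>, and its prefixes are residues modulo powers of
  2.\<close>

definition prefix_val :: "(nat \<Rightarrow> bool) \<Rightarrow> nat \<Rightarrow> nat" where
  "prefix_val Z k = (\<Sum>j<k. of_bool (Z j) * 2 ^ j)"

lemma prefix_val_Suc: "prefix_val Z (Suc k) = prefix_val Z k + of_bool (Z k) * 2 ^ k"
  by (simp add: prefix_val_def)

lemma prefix_val_less: "prefix_val Z k < 2 ^ k"
  by (induction k) (auto simp: prefix_val_Suc prefix_val_def)

lemma prefix_val_mod: "j \<le> k \<Longrightarrow> prefix_val Z k mod 2 ^ j = prefix_val Z j"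
proof (induction k)
  case (Suc k)
  show ?case
  proof (cases "j = Suc k")
    case False
    then have "(2 :: nat) ^ j dvd of_bool (Z k) * 2 ^ k" using Suc.prems
      by (intro dvd_mult le_imp_power_dvd) auto
    then show ?thesis using Suc False by (simp add: prefix_val_Suc mod_add_right_eq[symmetric] dvd_eq_mod_eq_0[symmetric] del: mod_add_right_eq)
  qed (use prefix_val_less[of Z "Suc k"] in simp)
qed (simp add: prefix_val_def)

lemma prefix_val_cong: "(\<And>j. j < k \<Longrightarrow> Z j = Z' j) \<Longrightarrow> prefix_val Z k = prefix_val Z' k"
  unfolding prefix_val_def by (intro sum.cong) auto

definition code_val :: "nat \<Rightarrow> nat" where
  "code_val s = (\<Sum>j<code_length s. code_nth s j * 2 ^ j)"

lemma code_length_string_code: "code_length (string_code \<sigma>) = length \<sigma>"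
  by (simp add: string_code_def code_length_list_encode)

lemma code_nth_string_code: "j < length \<sigma> \<Longrightarrow> code_nth (string_code \<sigma>) j = of_bool (\<sigma> ! j)"
  by (simp add: string_code_def code_nth_list_encode)

lemma code_val_string_code: "code_val (string_code \<sigma>) = prefix_val ((!) \<sigma>) (length \<sigma>)"
  unfolding code_val_def prefix_val_def code_length_string_code
  by (intro sum.cong) (auto simp: code_nth_string_code)

lemma computable_nat_code_drop:
  assumes "computable_nat k F" "computable_nat k G"
  shows "computable_nat k (\<lambda>xs. code_drop (F xs) (G xs))"
proof -
  have "computable_nat k (\<lambda>xs. rec_nat (F xs) (\<lambda>m y. snd (prod_decode ((m # y # xs) ! 1 - 1))) (G xs))"
    by (intro computable_nat_rec assms computable_nat_prod_decode computable_nat_intros) auto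
  then show ?thesis by (simp add: code_drop_def)
qed

lemma computable_nat_code:
  assumes "computable_nat k F"
  shows "computable_nat k (\<lambda>xs. code_length (F xs))" "computable_nat k (\<lambda>xs. code_val (F xs))"
    "computable_nat k G \<Longrightarrow> computable_nat k (\<lambda>xs. code_nth (F xs) (G xs))"
proof -
  have nth: "computable_nat k (\<lambda>xs. code_nth (F xs) (G xs))" if "computable_nat k F" "computable_nat k G" for k F G
    unfolding code_nth_def by (intro computable_nat_prod_decode computable_nat_code_drop computable_nat_intros that)
  have "computable_nat 1 (\<lambda>xs. \<Sum>i<xs ! 0. of_bool (code_drop ((i # xs) ! 1) ((i # xs) ! 0) > 0))"
    by (intro computable_nat_sum computable_pred_less[unfolded computable_pred_def]
        computable_nat_code_drop computable_nat_intros) auto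
  then have len: "computable_nat 1 (\<lambda>xs. code_length (xs ! 0))"
    by (simp add: code_length_def)
  then show "computable_nat k (\<lambda>xs. code_length (F xs))"
    using assms by (rule computable_nat_comp1)
  have "computable_nat 1 (\<lambda>xs. \<Sum>j<code_length (xs ! 0). code_nth ((j # xs) ! 1) ((j # xs) ! 0) * 2 ^ ((j # xs) ! 0))"
    by (intro computable_nat_sum nth len computable_nat_intros) auto
  then have "computable_nat 1 (\<lambda>xs. code_val (xs ! 0))"
    by (simp add: code_val_def)
  then show "computable_nat k (\<lambda>xs. code_val (F xs))"
    using assms by (rule computable_nat_comp1)
  show "computable_nat k (\<lambda>xs. code_nth (F xs) (G xs))" if "computable_nat k G"
    using assms that by (rule nth)
qed

section \<open>Martingale transforms\<close>

text \<open>Half the difference of the two sibling values, with the sign of the next bit. It is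
  exactly fair for every \<open>g\<close> and is the increment of \<open>g\<close> itself when
  \<open>g\<close> is a martingale.\<close>

definition increment :: "(nat \<Rightarrow> nat \<Rightarrow> rat) \<Rightarrow> (nat \<Rightarrow> bool) \<Rightarrow> nat \<Rightarrow> rat" where
  "increment g Z j = (if Z j then 1 else -1) *
     (g (Suc j) (prefix_val Z j + 2 ^ j) - g (Suc j) (prefix_val Z j)) / 2"

definition gain :: "(nat \<Rightarrow> nat \<Rightarrow> nat) \<Rightarrow> (nat \<Rightarrow> nat \<Rightarrow> rat) \<Rightarrow> (nat \<Rightarrow> bool) \<Rightarrow> nat \<Rightarrow> rat" where
  "gain \<theta> g Z k = (\<Sum>j<k. of_nat (\<theta> j (prefix_val Z j)) * increment g Z j)"

lemma gain_cong: "(\<And>j. j < k \<Longrightarrow> Z j = Z' j) \<Longrightarrow> gain \<theta> g Z k = gain \<theta> g Z' k"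
  unfolding gain_def increment_def
  by (intro sum.cong refl) (auto simp: prefix_val_cong[of _ Z Z'])

text \<open>The code of the whole string determines the prefix of length \<open>j\<close> as
  \<open>code_val\<close> modulo \<open>2 ^ j\<close>, so all stakes and increments can be computed
  from that one code. The sign of a bit becomes \<open>2 * bit - 1\<close>.\<close>

lemma computable_gain:
  assumes \<theta>: "computable_nat 2 (\<lambda>xs. \<theta> (xs ! 0) (xs ! 1))"
    and g: "computable_rat 2 (\<lambda>xs. g (xs ! 0) (xs ! 1))"
  obtains F where "computable_rat 1 F" "\<And>\<sigma>. gain \<theta> g ((!) \<sigma>) (length \<sigma>) = F [string_code \<sigma>]"
proof -
  let ?m = "\<lambda>j s. code_val s mod 2 ^ j"
  define H where "H j s = of_nat (\<theta> j (?m j s)) * ((2 * of_nat (code_nth s j) - 1) *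
     (g (Suc j) (?m j s + 2 ^ j) - g (Suc j) (?m j s)) * (1 / 2))" for j s
  have H: "computable_rat (Suc 1) (\<lambda>ws. H (ws ! 0) (ws ! 1))"
    unfolding H_def
    by (intro computable_rat_intros computable_nat_comp2[OF \<theta>] computable_rat_comp2[OF g]
        computable_nat_code computable_nat_intros) auto
  have "computable_rat 1 (\<lambda>xs. \<Sum>j<code_length (xs ! 0). H ((j # xs) ! 0) ((j # xs) ! 1))"
    by (rule computable_rat_sum[OF H]) (intro computable_nat_code computable_nat_intros, simp)
  moreover have "gain \<theta> g ((!) \<sigma>) (length \<sigma>) =
     (\<lambda>xs. \<Sum>j<code_length (xs ! 0). H ((j # xs) ! 0) ((j # xs) ! 1)) [string_code \<sigma>]" for \<sigma>
    unfolding gain_def increment_def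
    by (auto simp: code_length_string_code H_def code_val_string_code prefix_val_mod code_nth_string_code intro!: sum.cong)
  ultimately show ?thesis by (rule that)
qed

text \<open>Randomness is exploited through this lemma alone. A lower bound valid on all sequences
  makes \<open>E + gain\<close> a nonnegative computable martingale; it does not succeed on
  \<open>Z\<close>, so the gains along \<open>Z\<close> are bounded above. \<open>E\<close> is
  rational because martingale values have to be.\<close>

lemma gain_bounded_of_random:
  assumes \<theta>: "computable_nat 2 (\<lambda>xs. \<theta> (xs ! 0) (xs ! 1))"
    and g: "computable_rat 2 (\<lambda>xs. g (xs ! 0) (xs ! 1))"
    and nonneg: "\<And>Z k. - E \<le> gain \<theta> g Z k"
    and rand: "computably_random_seq Z"
  shows "\<exists>C. \<forall>k. gain \<theta> g Z k \<le> C"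
proof -
  define B where "B \<sigma> = E + gain \<theta> g ((!) \<sigma>) (length \<sigma>)" for \<sigma> :: "bool list"
  have snoc: "B (\<sigma> @ [b]) = B \<sigma> + of_nat (\<theta> (length \<sigma>) (prefix_val ((!) \<sigma>) (length \<sigma>))) *
     ((if b then 1 else -1) * (g (Suc (length \<sigma>)) (prefix_val ((!) \<sigma>) (length \<sigma>) + 2 ^ length \<sigma>)
        - g (Suc (length \<sigma>)) (prefix_val ((!) \<sigma>) (length \<sigma>))) / 2)" for \<sigma> b
  proof -
    have "gain \<theta> g ((!) (\<sigma> @ [b])) (length \<sigma>) = gain \<theta> g ((!) \<sigma>) (length \<sigma>)"
      by (rule gain_cong) (simp add: nth_append)
    moreover have "prefix_val ((!) (\<sigma> @ [b])) (length \<sigma>) = prefix_val ((!) \<sigma>) (length \<sigma>)"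
      by (rule prefix_val_cong) (simp add: nth_append)
    ultimately show ?thesis unfolding B_def by (simp add: gain_def increment_def)
  qed
  have "0 \<le> B \<sigma>" for \<sigma> using nonneg[of "(!) \<sigma>" "length \<sigma>"] by (simp add: B_def)
  moreover have "2 * B \<sigma> = B (\<sigma> @ [False]) + B (\<sigma> @ [True])" for \<sigma>
    by (simp add: snoc diff_divide_distrib right_diff_distrib)
  ultimately have "martingale B" unfolding martingale_def by auto
  moreover obtain F where F: "computable_rat 1 F" "\<And>\<sigma>. gain \<theta> g ((!) \<sigma>) (length \<sigma>) = F [string_code \<sigma>]"
    using computable_gain[OF \<theta> g] by blast
  have "\<exists>F. computable_rat 1 F \<and> (\<forall>\<sigma>. B \<sigma> = F [string_code \<sigma>])"
    by (rule exI[of _ "\<lambda>xs. E + F xs"], intro conjI computable_rat_intros F) (auto simp: B_def F(2))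
  ultimately have "computable_martingale B" unfolding computable_martingale_def by blast
  with rand have lim: "limsup (\<lambda>k. ereal (of_rat (B (map Z [0..<k])))) \<noteq> \<infinity>"
    unfolding computably_random_seq_def succeeds_on_def by blast
  then obtain c :: real where c: "limsup (\<lambda>k. ereal (of_rat (B (map Z [0..<k])))) < ereal c"
    using less_PInf_Ex_of_nat by blast
  from Limsup_lessD[OF c] obtain m where m: "\<And>k. k \<ge> m \<Longrightarrow> real_of_rat (B (map Z [0..<k])) < c"
    unfolding eventually_sequentially by auto
  have Bk: "B (map Z [0..<k]) = E + gain \<theta> g Z k" for k
    unfolding B_def by (auto intro: gain_cong)
  obtain q :: rat where q: "c < of_rat q" using of_rat_dense[of c "c + 1"] by auto
  \<comment> \<open>The limit superior controls only the gains from \<open>m\<close> on; the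
    finitely many earlier ones enter the maximum.\<close>
  let ?C = "Max (insert (q - E) (gain \<theta> g Z ` {..<m}))"
  have "gain \<theta> g Z k \<le> ?C" for k
  proof (cases "k < m")
    case False
    then have "real_of_rat (B (map Z [0..<k])) < of_rat q" using m[of k] q by simp
    then have "gain \<theta> g Z k \<le> q - E" by (simp add: of_rat_less Bk)
    then show ?thesis by (simp add: Max_ge_iff)
  qed simp
  then show ?thesis by blast
qed

section \<open>Averages over dyadic grids\<close>

definition coord_index :: "'n::{finite,linorder} \<Rightarrow> nat" where
  "coord_index c = (THE i. i < CARD('n) \<and> coords ! i = c)"

lemma distinct_coords: "distinct (coords :: 'n::{finite,linorder} list)"
  and set_coords: "set (coords :: 'n list) = UNIV"
  and length_coords: "length (coords :: 'n list) = CARD('n)"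
  by (simp_all add: coords_def)

lemma coord_index: "coord_index (c :: 'n::{finite,linorder}) < CARD('n)" "coords ! coord_index c = c"
proof -
  have "\<exists>!i. i < CARD('n) \<and> coords ! i = c"
    using distinct_coords set_coords length_coords
    by (metis UNIV_I distinct_Ex1)
  then have "coord_index c < CARD('n) \<and> coords ! coord_index c = c"
    unfolding coord_index_def by (rule theI')
  then show "coord_index c < CARD('n)" "coords ! coord_index c = c" by auto
qed

lemma coord_index_nth: "i < CARD('n) \<Longrightarrow> coord_index (coords ! i :: 'n::{finite,linorder}) = i"
  using coord_index[of "coords ! i :: 'n"] distinct_coords length_coords
  by (metis nth_eq_iff_index_eq)

definition nbit :: "nat \<Rightarrow> nat \<Rightarrow> nat" where
  "nbit v q = v div 2 ^ q mod 2"

lemma nbit_add_high: "q < i \<Longrightarrow> nbit (v + 2 ^ i * u) q = nbit v q"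
proof -
  assume "q < i"
  then obtain d where d: "i = q + Suc d" using less_imp_Suc_add by auto
  have eq: "v + 2 ^ i * u = v + 2 ^ q * (2 * (2 ^ d * u))" by (simp add: d power_add)
  have "(v + 2 ^ i * u) div 2 ^ q = v div 2 ^ q + 2 * (2 ^ d * u)" unfolding eq by simp
  then show ?thesis by (simp add: nbit_def)
qed

lemma nbit_low: "v < 2 ^ i \<Longrightarrow> nbit v i = 0" "v < 2 ^ i \<Longrightarrow> nbit (v + 2 ^ i) i = 1"
  by (simp_all add: nbit_def div_add_self2)

text \<open>The numerator of coordinate \<open>c\<close> of the point with denominator \<open>2 ^ K\<close> whose interleaved
  binary expansion consists of the binary digits of \<open>v\<close>, least significant digit first.\<close>

primrec grid_num :: "nat \<Rightarrow> nat \<Rightarrow> 'n::{finite,linorder} \<Rightarrow> nat" where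
  "grid_num 0 v c = 0"
| "grid_num (Suc K) v c = 2 * grid_num K v c + nbit v (K * CARD('n) + coord_index c)"

definition grid_pt :: "nat \<Rightarrow> nat \<Rightarrow> real ^ 'n::{finite,linorder}" where
  "grid_pt K v = (\<chi> c. real (grid_num K v c) / 2 ^ K)"

lemma grid_num_cong:
  fixes c :: "'n::{finite,linorder}"
  assumes "\<And>q. q < K \<Longrightarrow> nbit v (q * CARD('n) + coord_index c) = nbit w (q * CARD('n) + coord_index c)"
  shows "grid_num K v c = grid_num K w c"
  using assms by (induction K) auto

lemma index_bound:
  fixes c :: "'n::{finite,linorder}"
  assumes "q < K"
  shows "q * CARD('n) + coord_index c < CARD('n) * K"
proof -
  have "q * CARD('n) + coord_index c < Suc q * CARD('n)" using coord_index(1)[of c] by simp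
  also have "\<dots> \<le> K * CARD('n)" using assms by (intro mult_le_mono1) auto
  finally show ?thesis by (simp add: mult.commute)
qed

lemma grid_num_add_high:
  "CARD('n) * K \<le> i \<Longrightarrow> grid_num K (v + 2 ^ i * u) (c :: 'n::{finite,linorder}) = grid_num K v c"
  by (rule grid_num_cong, rule nbit_add_high) (meson index_bound less_le_trans)

lemma grid_num_refine:
  assumes "K \<le> K'"
  shows "grid_num K v c * 2 ^ (K' - K) \<le> grid_num K' v c"
    "grid_num K' v c < (grid_num K v c + 1) * 2 ^ (K' - K)"
proof -
  have "grid_num K v c * 2 ^ d \<le> grid_num (K + d) v c \<and>
    grid_num (K + d) v c < (grid_num K v c + 1) * 2 ^ d" for d
  proof (induction d)
    case (Suc d)
    have "nbit v ((K + d) * CARD('a) + coord_index c) \<le> 1" by (simp add: nbit_def)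
    with Suc show ?case by simp
  qed simp
  from this[of "K' - K"] assms show "grid_num K v c * 2 ^ (K' - K) \<le> grid_num K' v c"
    "grid_num K' v c < (grid_num K v c + 1) * 2 ^ (K' - K)" by auto
qed

lemma grid_pt_refine:
  assumes "K \<le> K'"
  shows "\<bar>grid_pt K' v $ c - grid_pt K v $ c\<bar> \<le> 1 / 2 ^ K"
proof -
  define P Q :: real where "P = 2 ^ K" and "Q = 2 ^ (K' - K)"
  have pos: "P > 0" "Q > 0" by (simp_all add: P_def Q_def)
  have PQ: "(2::real) ^ K' = P * Q" using assms by (simp add: P_def Q_def flip: power_add)
  have 1: "real (grid_num K v c) * Q \<le> real (grid_num K' v c)"
    using of_nat_le_iff[where 'a = real, THEN iffD2, OF grid_num_refine(1)[OF assms, of v c]]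
    by (simp add: Q_def)
  have 2: "real (grid_num K' v c) < (real (grid_num K v c) + 1) * Q"
    using of_nat_less_iff[where 'a = real, THEN iffD2, OF grid_num_refine(2)[OF assms, of v c]]
    by (simp add: Q_def algebra_simps)
  have "real (grid_num K v c) / P \<le> real (grid_num K' v c) / (P * Q)"
    using 1 pos by (simp add: field_simps)
  moreover have "real (grid_num K' v c) / (P * Q) \<le> real (grid_num K v c) / P + 1 / P"
    using 2 pos by (simp add: field_simps)
  moreover have "0 \<le> 1 / P" using pos by simp
  ultimately show ?thesis
    unfolding grid_pt_def by (simp only: vec_lambda_beta PQ P_def[symmetric] abs_le_iff) linarith
qed

text \<open>The number of digits of coordinate \<open>c\<close> among the first \<open>i\<close> digits of an interleaved expansion.\<close>

definition digits :: "nat \<Rightarrow> 'n::{finite,linorder} \<Rightarrow> nat" where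
  "digits i c = i div CARD('n) + of_bool (coord_index c < i mod CARD('n))"

lemma digits_le:
  assumes "i \<le> CARD('n) * l"
  shows "digits i (c :: 'n::{finite,linorder}) \<le> l"
proof (cases "i = CARD('n) * l")
  case False
  then have "i div CARD('n) < l" using assms by (simp add: less_mult_imp_div_less mult.commute)
  then show ?thesis by (simp add: digits_def)
qed (simp add: digits_def)

lemma less_digits:
  assumes "q < digits i (c :: 'n::{finite,linorder})"
  shows "q * CARD('n) + coord_index c < i"
proof (cases "q < i div CARD('n)")
  case True
  from index_bound[OF this, of c] show ?thesis
    by (metis less_le_trans times_div_less_eq_dividend)
next
  case False
  with assms have "q = i div CARD('n)" "coord_index c < i mod CARD('n)"
    by (auto simp: digits_def of_bool_def split: if_splits)
  moreover from \<open>q = i div CARD('n)\<close> have "q * CARD('n) + i mod CARD('n) = i" by simp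
  ultimately show ?thesis by linarith
qed

lemma digits_Suc:
  "digits (Suc i) (c :: 'n::{finite,linorder}) = digits i c + of_bool (coord_index c = i mod CARD('n))"
  using coord_index(1)[of c] by (auto simp: digits_def div_Suc mod_Suc)

lemma digits_top: "digits (CARD('n) * K) (c :: 'n::{finite,linorder}) = K"
  by (simp add: digits_def)

section \<open>Dyadic boxes as sets of integer vectors\<close>

text \<open>The numerators over \<open>2 ^ K\<close> of the grid points in the dyadic box cut out by
  the first \<open>i\<close> digits of \<open>v\<close>. These fix \<open>digits i c\<close> leading
  digits of coordinate \<open>c\<close>, so the sides may differ by a factor of 2.\<close>

definition grid_box :: "nat \<Rightarrow> nat \<Rightarrow> nat \<Rightarrow> ('n::{finite,linorder} \<Rightarrow> int) set" where
  "grid_box K i v = (\<Pi>\<^sub>E c\<in>UNIV. {int (grid_num (digits i c) v c) * 2 ^ (K - digits i c) ..<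
     (int (grid_num (digits i c) v c) + 1) * 2 ^ (K - digits i c)})"

lemma interval_halves:
  fixes g s :: int
  assumes "0 \<le> s"
  shows "{g * (2 * s)..<(g + 1) * (2 * s)} = {2 * g * s..<(2 * g + 1) * s} \<union> {(2 * g + 1) * s..<(2 * g + 1 + 1) * s}"
    and "{2 * g * s..<(2 * g + 1) * s} \<inter> {(2 * g + 1) * s..<(2 * g + 1 + 1) * s} = {}"
proof -
  have "2 * g * s \<le> (2 * g + 1) * s" "(2 * g + 1) * s \<le> (2 * g + 1 + 1) * s"
    using assms by (simp_all add: algebra_simps)
  then show "{g * (2 * s)..<(g + 1) * (2 * s)} = {2 * g * s..<(2 * g + 1) * s} \<union> {(2 * g + 1) * s..<(2 * g + 1 + 1) * s}"
    by (simp add: ivl_disj_un_two(3)) (simp add: algebra_simps)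
qed auto

text \<open>Digit number \<open>i\<close> belongs to the single coordinate \<open>c0\<close>: only
  that side is halved, and the digit selects its lower or upper half.\<close>

lemma grid_box_split:
  fixes K i v
  assumes "i < CARD('n) * K" "v < 2 ^ i"
  shows "grid_box K i v = (grid_box K (Suc i) v \<union> grid_box K (Suc i) (v + 2 ^ i) :: ('n::{finite,linorder} \<Rightarrow> int) set)"
    and "grid_box K (Suc i) v \<inter> grid_box K (Suc i) (v + 2 ^ i) = ({} :: ('n \<Rightarrow> int) set)"
proof -
  define c0 :: 'n where "c0 = coords ! (i mod CARD('n))"
  have ci: "coord_index c0 = i mod CARD('n)" unfolding c0_def by (rule coord_index_nth) simp
  have uniq: "coord_index c = i mod CARD('n) \<longleftrightarrow> c = c0" for c :: 'n
    using ci coord_index(2) by metis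
  let ?I = "\<lambda>i v c. {int (grid_num (digits i c) v c) * 2 ^ (K - digits i c) ..<
     (int (grid_num (digits i c) v c) + 1) * 2 ^ (K - digits i c)}"
  have dc: "digits i c0 = i div CARD('n)" by (simp add: digits_def ci)
  have lt: "digits i c0 < K" using assms(1) by (simp add: dc less_mult_imp_div_less mult.commute)
  have i: "digits i c0 * CARD('n) + coord_index c0 = i" by (simp add: dc ci)
  have low: "grid_num (digits i c) (v + 2 ^ i) c = grid_num (digits i c) v c" for c :: 'n
    using less_digits[of _ i c] nbit_add_high[of _ i v 1] by (intro grid_num_cong) auto
  have other: "?I (Suc i) v c = ?I i v c" "?I (Suc i) (v + 2 ^ i) c = ?I i v c" if "c \<noteq> c0" for c
    using that by (simp_all add: digits_Suc uniq low)
  have g: "grid_num (digits (Suc i) c0) v c0 = 2 * grid_num (digits i c0) v c0"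
    "grid_num (digits (Suc i) c0) (v + 2 ^ i) c0 = 2 * grid_num (digits i c0) v c0 + 1"
    using nbit_low[OF assms(2)] by (simp_all add: digits_Suc uniq low i)
  have p: "(2::int) ^ (K - digits i c0) = 2 * 2 ^ (K - digits (Suc i) c0)"
  proof -
    have "K - digits i c0 = Suc (K - digits (Suc i) c0)"
      using lt by (simp add: digits_Suc uniq Suc_diff_Suc)
    then show ?thesis by simp
  qed
  define G S where "G = int (grid_num (digits i c0) v c0)" and "S = (2::int) ^ (K - digits (Suc i) c0)"
  have J: "?I i v c0 = {G * (2 * S)..<(G + 1) * (2 * S)}"
    "?I (Suc i) v c0 = {2 * G * S..<(2 * G + 1) * S}"
    "?I (Suc i) (v + 2 ^ i) c0 = {(2 * G + 1) * S..<(2 * G + 1 + 1) * S}"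
    unfolding p g G_def S_def of_nat_add of_nat_mult of_nat_numeral of_nat_1 by (rule refl)+
  have S: "0 \<le> S" by (simp add: S_def)
  have I0: "?I i v c0 = ?I (Suc i) v c0 \<union> ?I (Suc i) (v + 2 ^ i) c0"
    unfolding J by (rule interval_halves(1)[OF S])
  have D0: "?I (Suc i) v c0 \<inter> ?I (Suc i) (v + 2 ^ i) c0 = {}"
    unfolding J by (rule interval_halves(2)[OF S])
  define A A1 A2 :: "'n \<Rightarrow> int set" where "A = ?I i v" and "A1 = ?I (Suc i) v" and "A2 = ?I (Suc i) (v + 2 ^ i)"
  have A: "A1 c = A c" "A2 c = A c" if "c \<noteq> c0" for c
    using other[OF that] by (simp_all only: A_def A1_def A2_def)
  have A0: "A c0 = A1 c0 \<union> A2 c0" "A1 c0 \<inter> A2 c0 = {}"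
    using I0 D0 by (simp_all only: A_def A1_def A2_def)
  have box: "a \<in> grid_box K i v \<longleftrightarrow> (\<forall>c. a c \<in> A c)" "a \<in> grid_box K (Suc i) v \<longleftrightarrow> (\<forall>c. a c \<in> A1 c)"
    "a \<in> grid_box K (Suc i) (v + 2 ^ i) \<longleftrightarrow> (\<forall>c. a c \<in> A2 c)" for a
    by (simp_all only: grid_box_def PiE_UNIV_domain Pi_iff A_def A1_def A2_def ball_UNIV)
  have all: "(\<forall>c. a c \<in> A c) \<longleftrightarrow> (\<forall>c. a c \<in> A1 c) \<or> (\<forall>c. a c \<in> A2 c)" for a
  proof -
    have "(\<forall>c. a c \<in> A1 c) \<longleftrightarrow> a c0 \<in> A1 c0 \<and> (\<forall>c. c \<noteq> c0 \<longrightarrow> a c \<in> A c)"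
      using A(1) by metis
    moreover have "(\<forall>c. a c \<in> A2 c) \<longleftrightarrow> a c0 \<in> A2 c0 \<and> (\<forall>c. c \<noteq> c0 \<longrightarrow> a c \<in> A c)"
      using A(2) by metis
    moreover have "(\<forall>c. a c \<in> A c) \<longleftrightarrow> (a c0 \<in> A1 c0 \<or> a c0 \<in> A2 c0) \<and> (\<forall>c. c \<noteq> c0 \<longrightarrow> a c \<in> A c)"
      using A0(1) by (metis Un_iff)
    ultimately show ?thesis by argo
  qed
  show "grid_box K i v = (grid_box K (Suc i) v \<union> grid_box K (Suc i) (v + 2 ^ i) :: ('n \<Rightarrow> int) set)"
    by (simp only: set_eq_iff Un_iff box all simp_thms)
  show "grid_box K (Suc i) v \<inter> grid_box K (Suc i) (v + 2 ^ i) = ({} :: ('n \<Rightarrow> int) set)"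
    using A0(2) box(2,3) by blast
qed

lemma finite_grid_box: "finite (grid_box K i v)"
  unfolding grid_box_def by (intro finite_PiE) auto

lemma sum_split_even_odd:
  fixes h :: "nat \<Rightarrow> 'a::comm_monoid_add"
  shows "(\<Sum>u<2 * m. h u) = (\<Sum>u<m. h (2 * u)) + (\<Sum>u<m. h (2 * u + 1))"
  by (induction m) (auto simp: algebra_simps)

lemma sum_grid_split:
  fixes h :: "nat \<Rightarrow> 'a::comm_monoid_add"
  assumes "i < m"
  shows "(\<Sum>u<2 ^ (m - i). h (v + 2 ^ i * u)) = (\<Sum>u<2 ^ (m - Suc i). h (v + 2 ^ Suc i * u)) +
    (\<Sum>u<2 ^ (m - Suc i). h (v + 2 ^ i + 2 ^ Suc i * u))"
proof -
  have "m - i = Suc (m - Suc i)" using assms by simp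
  then have "(\<Sum>u<2 ^ (m - i). h (v + 2 ^ i * u)) = (\<Sum>u<2 * 2 ^ (m - Suc i). h (v + 2 ^ i * u))"
    by (simp only: power_Suc)
  then show ?thesis unfolding sum_split_even_odd by (simp add: algebra_simps)
qed

text \<open>The numbers \<open>u\<close> enumerate the extensions of a string in an order unrelated
  to the geometry of the cube; as a sum over integer vectors the same sum can be translated. The
  induction runs over the digits still free, the next digit splitting both sides in two.\<close>

lemma sum_grid_box:
  assumes "i \<le> CARD('n) * K" "v < 2 ^ i"
  shows "(\<Sum>u<2 ^ (CARD('n) * K - i). \<psi> (\<lambda>c. int (grid_num K (v + 2 ^ i * u) c))) =
    (\<Sum>a\<in>grid_box K i v. \<psi> (a :: 'n::{finite,linorder} \<Rightarrow> int) :: real)"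
  using assms
proof (induction "CARD('n) * K - i" arbitrary: i v)
  case 0
  then have i: "i = CARD('n) * K" by simp
  have "grid_box K i v = {\<lambda>c::'n. int (grid_num K v c)}"
  proof -
    have "{x..<x + 1} = {x}" for x :: int by auto
    then show ?thesis
      unfolding grid_box_def i digits_top PiE_UNIV_domain by (auto simp: fun_eq_iff Pi_iff)
  qed
  then show ?case by (simp add: i)
next
  case (Suc d)
  then have i: "i < CARD('n) * K" by simp
  have IH: "(\<Sum>u<2 ^ (CARD('n) * K - Suc i). \<psi> (\<lambda>c. int (grid_num K (w + 2 ^ Suc i * u) c))) =
    (\<Sum>a\<in>grid_box K (Suc i) w. \<psi> a)" if "w < 2 ^ Suc i" for w
    using Suc.hyps(2) i that by (intro Suc.hyps(1)) auto
  have "(\<Sum>a\<in>grid_box K i v. \<psi> a) = (\<Sum>a\<in>grid_box K (Suc i) v. \<psi> a) + (\<Sum>a\<in>grid_box K (Suc i) (v + 2 ^ i). \<psi> a)"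
    unfolding grid_box_split(1)[OF i Suc.prems(2)]
    by (rule sum.union_disjoint) (auto simp: finite_grid_box grid_box_split(2)[OF i Suc.prems(2)])
  then show ?case
    using Suc.prems(2) sum_grid_split[OF i, of "\<lambda>z. \<psi> (\<lambda>c. int (grid_num K z c))" v] IH[of v] IH[of "v + 2 ^ i"]
    by simp
qed

lemma card_grid_box:
  assumes "i \<le> CARD('n) * K" "v < 2 ^ i"
  shows "real (card (grid_box K i v :: ('n::{finite,linorder} \<Rightarrow> int) set)) = 2 ^ (CARD('n) * K - i)"
  using sum_grid_box[OF assms, where \<psi> = "\<lambda>_. 1"] by simp

lemma card_interval_shift:
  fixes l s h :: int
  shows "real (card ({l..<l + s} - {l + h..<l + s + h})) \<le> \<bar>of_int h\<bar>"
proof -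
  have "{l..<l + s} - {l + h..<l + s + h} \<subseteq> {l..<l + h} \<union> {l + s + h..<l + s}" by auto
  then have "card ({l..<l + s} - {l + h..<l + s + h}) \<le> card ({l..<l + h} \<union> {l + s + h..<l + s})"
    by (intro card_mono) auto
  also have "\<dots> \<le> card {l..<l + h} + card {l + s + h..<l + s}" by (rule card_Un_le)
  also have "\<dots> = nat h + nat (- h)" by simp
  finally show ?thesis by linarith
qed

text \<open>The overlap of \<open>B\<close> and its translate cancels. The two leftover sets have
  equal size, since translation is injective, and a point of \<open>B\<close> missed by the
  translate is missed in some coordinate \<open>c\<close>, which concerns at most the fraction
  \<open>\<bar>h c\<bar> / s c\<close> of \<open>B\<close>.\<close>

lemma sum_box_shift:
  fixes l s h :: "'n::finite \<Rightarrow> int" and \<psi> :: "('n \<Rightarrow> int) \<Rightarrow> real"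
  defines "B \<equiv> (\<Pi>\<^sub>E c\<in>UNIV. {l c..<l c + s c})"
  assumes s: "\<And>c. s c > 0" and \<psi>: "\<And>a. \<bar>\<psi> a\<bar> \<le> C"
  shows "\<bar>(\<Sum>a\<in>B. \<psi> (\<lambda>c. a c + h c)) - (\<Sum>a\<in>B. \<psi> a)\<bar> \<le>
    2 * C * (\<Sum>c\<in>UNIV. \<bar>of_int (h c)\<bar> / of_int (s c)) * card B"
proof -
  define T where "T a c = a c + h c" for a c
  define J where "J c = {l c..<l c + s c} - {l c + h c..<l c + s c + h c}" for c
  have C: "C \<ge> 0" using \<psi>[of undefined] by linarith
  have fin: "finite B" unfolding B_def by (intro finite_PiE) auto
  have inj: "inj_on T B" by (auto simp: inj_on_def T_def fun_eq_iff)
  have cardB: "card B = (\<Prod>c\<in>UNIV. card {l c..<l c + s c})"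
    unfolding B_def by (rule card_PiE) simp
  have piece: "real (card (B \<inter> {a. a c \<in> J c})) \<le> \<bar>of_int (h c)\<bar> / of_int (s c) * card B" for c
  proof -
    define R where "R = (\<Prod>c'\<in>UNIV - {c}. card {l c'..<l c' + s c'})"
    have "B \<inter> {a. a c \<in> J c} = (\<Pi>\<^sub>E c'\<in>UNIV. if c' = c then J c else {l c'..<l c' + s c'})"
      unfolding B_def PiE_UNIV_domain J_def by (auto simp: Pi_iff split: if_splits)
    then have "card (B \<inter> {a. a c \<in> J c}) = (\<Prod>c'\<in>UNIV. card (if c' = c then J c else {l c'..<l c' + s c'}))"
      by (simp add: card_PiE)
    also have "\<dots> = card (J c) * (\<Prod>c'\<in>UNIV - {c}. card (if c' = c then J c else {l c'..<l c' + s c'}))"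
      by (subst prod.remove[of _ c]) auto
    also have "\<dots> = card (J c) * R" unfolding R_def by (intro arg_cong2[where f = "(*)"] prod.cong) auto
    finally have 1: "card (B \<inter> {a. a c \<in> J c}) = card (J c) * R" .
    have 2: "card B = nat (s c) * R"
      unfolding cardB R_def by (subst prod.remove[of _ c]) auto
    have "real (card (J c)) \<le> \<bar>real_of_int (h c)\<bar>" unfolding J_def by (rule card_interval_shift)
    then have "real (card (J c)) * real R \<le> \<bar>real_of_int (h c)\<bar> * real R" by (rule mult_right_mono) simp
    also have "\<dots> = \<bar>of_int (h c)\<bar> / of_int (s c) * card B" using s[of c] by (simp add: 2)
    finally show ?thesis by (simp add: 1)
  qed
  have "B - T ` B \<subseteq> (\<Union>c. B \<inter> {a. a c \<in> J c})"
  proof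
    fix a assume a: "a \<in> B - T ` B"
    have "\<exists>c. a c \<in> J c"
    proof (rule ccontr)
      assume "\<not> ?thesis"
      then have "l c + h c \<le> a c \<and> a c < l c + s c + h c" for c
        using a unfolding B_def J_def PiE_UNIV_domain Pi_iff by fastforce
      then have "(\<lambda>c. a c - h c) \<in> B"
        unfolding B_def PiE_UNIV_domain Pi_iff by (auto simp: le_diff_eq diff_less_eq)
      moreover have "a = T (\<lambda>c. a c - h c)" by (simp add: T_def fun_eq_iff)
      ultimately show False using a by blast
    qed
    then show "a \<in> (\<Union>c. B \<inter> {a. a c \<in> J c})" using a by blast
  qed
  then have "card (B - T ` B) \<le> card (\<Union>c. B \<inter> {a. a c \<in> J c})"
    by (intro card_mono finite_UN_I) (auto simp: fin)
  also have "\<dots> \<le> (\<Sum>c\<in>UNIV. card (B \<inter> {a. a c \<in> J c}))" by (rule card_UN_le) simp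
  finally have "real (card (B - T ` B)) \<le> (\<Sum>c\<in>UNIV. real (card (B \<inter> {a. a c \<in> J c})))"
    by (simp flip: of_nat_sum)
  also have "\<dots> \<le> (\<Sum>c\<in>UNIV. \<bar>of_int (h c)\<bar> / of_int (s c) * card B)"
    by (intro sum_mono piece)
  finally have card1: "real (card (B - T ` B)) \<le> (\<Sum>c\<in>UNIV. \<bar>of_int (h c)\<bar> / of_int (s c)) * card B"
    by (simp add: sum_distrib_right)
  have card2: "card (T ` B - B) = card (B - T ` B)"
    using card_image[OF inj] fin
    by (metis card_Diff_subset_Int finite_Int finite_imageI inf_commute)
  have bound: "\<bar>sum \<psi> A\<bar> \<le> C * card A" for A
  proof -
    have "\<bar>sum \<psi> A\<bar> \<le> (\<Sum>a\<in>A. C)" by (rule order_trans[OF sum_abs sum_mono[OF \<psi>]])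
    then show ?thesis by (simp add: mult.commute)
  qed
  have "(\<Sum>a\<in>B. \<psi> (\<lambda>c. a c + h c)) = sum \<psi> (T ` B)"
    unfolding sum.reindex[OF inj] by (simp only: comp_def T_def[abs_def])
  also have "\<dots> = sum \<psi> (T ` B \<inter> B) + sum \<psi> (T ` B - B)"
    using fin by (intro sum.Int_Diff) auto
  also have "sum \<psi> (T ` B \<inter> B) = sum \<psi> B - sum \<psi> (B - T ` B)"
    using sum.Int_Diff[OF fin, of \<psi> "T ` B"] by (simp add: Int_commute)
  finally have "\<bar>(\<Sum>a\<in>B. \<psi> (\<lambda>c. a c + h c)) - sum \<psi> B\<bar> \<le> C * card (B - T ` B) + C * card (T ` B - B)"
    using bound[of "B - T ` B"] bound[of "T ` B - B"] by linarith
  also have "\<dots> = 2 * C * card (B - T ` B)" by (simp add: card2)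
  also have "\<dots> \<le> 2 * C * ((\<Sum>c\<in>UNIV. \<bar>of_int (h c)\<bar> / of_int (s c)) * card B)"
    using C by (intro mult_left_mono card1) auto
  finally show ?thesis by (simp add: mult.assoc)
qed

section \<open>Grid averages\<close>

text \<open>The substitute for the mean value of \<open>\<phi>\<close> over a dyadic box:
  \<open>u\<close> runs through all choices of the remaining \<open>CARD('n) * K - i\<close>
  digits.\<close>

definition grid_avg :: "nat \<Rightarrow> nat \<Rightarrow> nat \<Rightarrow> (real ^ 'n::{finite,linorder} \<Rightarrow> real) \<Rightarrow> real" where
  "grid_avg K i v \<phi> = (\<Sum>u<2 ^ (CARD('n) * K - i). \<phi> (grid_pt K (v + 2 ^ i * u))) / 2 ^ (CARD('n) * K - i)"

lemma grid_avg_add: "grid_avg K i v (\<lambda>x. \<phi> x + \<psi> x) = grid_avg K i v \<phi> + grid_avg K i v \<psi>"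
  by (simp add: grid_avg_def sum.distrib add_divide_distrib)

lemma grid_avg_diff: "grid_avg K i v (\<lambda>x. \<phi> x - \<psi> x) = grid_avg K i v \<phi> - grid_avg K i v \<psi>"
  by (simp add: grid_avg_def sum_subtractf diff_divide_distrib)

lemma grid_avg_cmult: "grid_avg K i v (\<lambda>x. c * \<phi> x) = c * grid_avg K i v \<phi>"
  by (simp add: grid_avg_def sum_distrib_left)

lemma grid_avg_mono:
  fixes \<phi> \<psi> :: "real ^ 'n::{finite,linorder} \<Rightarrow> real"
  assumes "\<And>u. \<phi> (grid_pt K (v + 2 ^ i * u)) \<le> \<psi> (grid_pt K (v + 2 ^ i * u))"
  shows "grid_avg K i v \<phi> \<le> grid_avg K i v \<psi>"
  unfolding grid_avg_def by (intro divide_right_mono sum_mono assms) auto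

lemma grid_avg_const: "grid_avg K i v (\<lambda>_. c) = c"
  by (simp add: grid_avg_def)

lemma grid_avg_abs_le:
  assumes "\<And>u. \<bar>\<phi> (grid_pt K (v + 2 ^ i * u))\<bar> \<le> C"
  shows "\<bar>grid_avg K i v \<phi>\<bar> \<le> C"
  using grid_avg_mono[of \<phi> K v i "\<lambda>_. C"] grid_avg_mono[of "\<lambda>_. - C" K v i \<phi>] assms
  unfolding grid_avg_const by (simp add: abs_le_iff minus_le_iff)

lemma grid_avg_split:
  fixes \<phi> :: "real ^ 'n::{finite,linorder} \<Rightarrow> real"
  assumes "i < CARD('n) * K"
  shows "grid_avg K i v \<phi> = (grid_avg K (Suc i) v \<phi> + grid_avg K (Suc i) (v + 2 ^ i) \<phi>) / 2"
proof -
  have "CARD('n) * K - i = Suc (CARD('n) * K - Suc i)" using assms by simp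
  then have "(2::real) ^ (CARD('n) * K - i) = 2 * 2 ^ (CARD('n) * K - Suc i)" by (metis power_Suc)
  then show ?thesis
    unfolding grid_avg_def sum_grid_split[OF assms, of "\<lambda>z. \<phi> (grid_pt K z)" v]
    by (simp add: add_divide_distrib mult.commute)
qed

text \<open>For \<open>N \<le> K\<close> the translation acts on numerators as the integer shift
  \<open>2 ^ (K - N) * w\<close>. As \<open>digits i c \<le> l\<close>, every side of the box has at
  least \<open>2 ^ (K - l)\<close> grid points, so the boundary layer is a fraction of order
  \<open>2 ^ l / 2 ^ N\<close>, whatever \<open>K\<close> is.\<close>

lemma grid_avg_shift:
  fixes \<phi> :: "real ^ 'n::{finite,linorder} \<Rightarrow> real" and w :: "'n \<Rightarrow> int"
  assumes "N \<le> K" "i \<le> CARD('n) * l" "l \<le> K" "v < 2 ^ i" and \<phi>: "\<And>x. \<bar>\<phi> x\<bar> \<le> C"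
  shows "\<bar>grid_avg K i v (\<lambda>x. \<phi> (x + (\<chi> c. of_int (w c) / 2 ^ N))) - grid_avg K i v \<phi>\<bar>
    \<le> 2 * C * (\<Sum>c\<in>UNIV. \<bar>of_int (w c)\<bar>) * 2 ^ l / 2 ^ N"
proof -
  have "CARD('n) * l \<le> CARD('n) * K" using assms(3) by simp
  with assms(2) have iK: "i \<le> CARD('n) * K" by linarith
  have C: "C \<ge> 0" using \<phi>[of undefined] by linarith
  define s where "s c = (2::int) ^ (K - digits i c)" for c :: 'n
  define m where "m c = int (grid_num (digits i c) v c) * s c" for c :: 'n
  define h where "h c = 2 ^ (K - N) * w c" for c
  define \<psi> where "\<psi> a = \<phi> (\<chi> c. of_int (a c) / 2 ^ K)" for a :: "'n \<Rightarrow> int"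
  have box: "grid_box K i v = (\<Pi>\<^sub>E c\<in>UNIV. {m c..<m c + s c})"
    unfolding grid_box_def m_def s_def by (simp add: algebra_simps)
  have pt: "grid_pt K z + (\<chi> c. of_int (w c) / 2 ^ N) =
     (\<chi> c. of_int (int (grid_num K z c) + h c) / 2 ^ K)" for z
  proof -
    have "(2::real) ^ K = 2 ^ (K - N) * 2 ^ N" using assms(1) by (simp flip: power_add)
    then show ?thesis by (simp add: vec_eq_iff grid_pt_def h_def add_divide_distrib)
  qed
  have pt0: "grid_pt K z = (\<chi> c. of_int (int (grid_num K z c)) / 2 ^ K)" for z
    by (simp add: grid_pt_def)
  have "grid_avg K i v (\<lambda>x. \<phi> (x + (\<chi> c. of_int (w c) / 2 ^ N)))
     = (\<Sum>a\<in>grid_box K i v. \<psi> (\<lambda>c. a c + h c)) / 2 ^ (CARD('n) * K - i)"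
    unfolding grid_avg_def pt sum_grid_box[OF iK assms(4), symmetric] \<psi>_def ..
  moreover have "grid_avg K i v \<phi> = (\<Sum>a\<in>grid_box K i v. \<psi> a) / 2 ^ (CARD('n) * K - i)"
    unfolding grid_avg_def pt0 sum_grid_box[OF iK assms(4), symmetric] \<psi>_def ..
  ultimately have "\<bar>grid_avg K i v (\<lambda>x. \<phi> (x + (\<chi> c. of_int (w c) / 2 ^ N))) - grid_avg K i v \<phi>\<bar>
    = \<bar>(\<Sum>a\<in>grid_box K i v. \<psi> (\<lambda>c. a c + h c)) - (\<Sum>a\<in>grid_box K i v. \<psi> a)\<bar> / 2 ^ (CARD('n) * K - i)"
    by (simp add: diff_divide_distrib[symmetric])
  also have "\<dots> \<le> (2 * C * (\<Sum>c\<in>UNIV. \<bar>of_int (h c)\<bar> / of_int (s c)) * card (grid_box K i v :: ('n \<Rightarrow> int) set)) / 2 ^ (CARD('n) * K - i)"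
    unfolding box by (intro divide_right_mono sum_box_shift) (auto simp: s_def \<psi>_def \<phi>)
  also have "\<dots> = 2 * C * (\<Sum>c\<in>UNIV. \<bar>of_int (h c)\<bar> / of_int (s c))"
    unfolding card_grid_box[OF iK assms(4)] by simp
  also have "\<dots> \<le> 2 * C * (\<Sum>c\<in>UNIV. \<bar>of_int (w c)\<bar> * (2 ^ l / 2 ^ N))"
  proof (intro mult_left_mono sum_mono)
    fix c :: 'n
    have d: "digits i c \<le> l" by (rule digits_le[OF assms(2)])
    have "(2::real) ^ K = 2 ^ (K - N) * 2 ^ N" using assms(1) by (simp flip: power_add)
    moreover have "(2::real) ^ K = 2 ^ (K - digits i c) * 2 ^ digits i c"
      using assms(3) d by (simp flip: power_add)
    ultimately have "(2::real) ^ (K - N) / 2 ^ (K - digits i c) = 2 ^ digits i c / 2 ^ N"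
      by (simp add: frac_eq_eq mult.commute)
    also have "\<dots> \<le> 2 ^ l / 2 ^ N" using d by (intro divide_right_mono power_increasing) auto
    finally have "\<bar>real_of_int (w c)\<bar> * (2 ^ (K - N) / 2 ^ (K - digits i c)) \<le> \<bar>of_int (w c)\<bar> * (2 ^ l / 2 ^ N)"
      by (intro mult_left_mono) auto
    then show "\<bar>real_of_int (h c)\<bar> / of_int (s c) \<le> \<bar>of_int (w c)\<bar> * (2 ^ l / 2 ^ N)"
      by (simp add: h_def s_def abs_mult mult.commute)
  qed (use C in simp)
  also have "(\<Sum>c\<in>UNIV. \<bar>real_of_int (w c)\<bar> * (2 ^ l / 2 ^ N)) = (\<Sum>c\<in>UNIV. \<bar>of_int (w c)\<bar>) * (2 ^ l / 2 ^ N)"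
    by (rule sum_distrib_right[symmetric])
  finally show ?thesis by (simp add: mult.assoc)
qed

lemma sum_periodic:
  fixes h :: "nat \<Rightarrow> real"
  assumes "\<And>u m. h (u + m * k) = h u"
  shows "(\<Sum>u<m * k. h u) = real m * (\<Sum>u<k. h u)"
proof (induction m)
  case (Suc m)
  have "(\<Sum>u<Suc m * k. h u) = (\<Sum>u<m * k. h u) + (\<Sum>u=m * k..<m * k + k. h u)"
    by (simp add: lessThan_atLeast0 sum.atLeastLessThan_concat add.commute)
  also have "(\<Sum>u=m * k..<m * k + k. h u) = (\<Sum>u<k. h (u + m * k))"
    using sum.shift_bounds_nat_ivl[of h 0 "m * k" k] by (simp add: lessThan_atLeast0 add.commute)
  also have "(\<Sum>u<k. h (u + m * k)) = (\<Sum>u<k. h u)" by (simp only: assms)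
  finally show ?case by (simp only: Suc) (simp add: algebra_simps)
qed simp

text \<open>\<open>grid_pt K\<close> ignores the digits beyond \<open>CARD('n) * K\<close>, so the
  longer sum repeats the shorter one periodically. Averages on two grids can thus be compared over
  one index set.\<close>

lemma grid_avg_coarse:
  fixes \<phi> :: "real ^ 'n::{finite,linorder} \<Rightarrow> real"
  assumes "K \<le> K'" "i \<le> CARD('n) * K"
  shows "(\<Sum>u<2 ^ (CARD('n) * K' - i). \<phi> (grid_pt K (v + 2 ^ i * u))) / 2 ^ (CARD('n) * K' - i) = grid_avg K i v \<phi>"
proof -
  have le: "CARD('n) * K \<le> CARD('n) * K'" using assms(1) by simp
  have e: "CARD('n) * K' - i = (CARD('n) * K' - CARD('n) * K) + (CARD('n) * K - i)"
    using assms(2) le by simp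
  have "v + 2 ^ i * (u + m * 2 ^ (CARD('n) * K - i)) = v + 2 ^ i * u + 2 ^ (CARD('n) * K) * m" for u m :: nat
  proof -
    have "(2::nat) ^ (CARD('n) * K) = 2 ^ i * 2 ^ (CARD('n) * K - i)"
      using assms(2) by (simp flip: power_add)
    then show ?thesis by (simp add: algebra_simps)
  qed
  then have "\<phi> (grid_pt K (v + 2 ^ i * (u + m * 2 ^ (CARD('n) * K - i)))) = \<phi> (grid_pt K (v + 2 ^ i * u))" for u m
    by (simp only: grid_pt_def grid_num_add_high[OF order_refl])
  from sum_periodic[of "\<lambda>u. \<phi> (grid_pt K (v + 2 ^ i * u))", OF this]
  show ?thesis unfolding grid_avg_def e power_add by simp
qed

lemma grid_avg_refine:
  fixes \<phi> :: "real ^ 'n::{finite,linorder} \<Rightarrow> real"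
  assumes "K \<le> K'" "i \<le> CARD('n) * K"
    and \<phi>: "\<And>x y. \<bar>\<phi> x - \<phi> y\<bar> \<le> \<Lambda> * norm (x - y)" and "\<Lambda> \<ge> 0"
  shows "\<bar>grid_avg K' i v \<phi> - grid_avg K i v \<phi>\<bar> \<le> \<Lambda> * CARD('n) / 2 ^ K"
proof -
  have pt: "\<bar>\<phi> (grid_pt K' z) - \<phi> (grid_pt K z)\<bar> \<le> \<Lambda> * CARD('n) / 2 ^ K" for z
  proof -
    define d :: "real ^ 'n::{finite,linorder}" where "d = grid_pt K' z - grid_pt K z"
    have "norm d \<le> (\<Sum>c\<in>UNIV. \<bar>d $ c\<bar>)" by (rule norm_le_l1_cart)
    also have "\<dots> \<le> (\<Sum>c\<in>(UNIV :: 'n::{finite,linorder} set). 1 / 2 ^ K)"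
      unfolding d_def by (intro sum_mono) (simp add: grid_pt_refine[OF assms(1)])
    finally have "norm (grid_pt K' z - grid_pt K z :: real ^ 'n::{finite,linorder}) \<le> CARD('n) / 2 ^ K"
      by (simp add: d_def)
    from order_trans[OF \<phi> mult_left_mono[OF this assms(4)]] show ?thesis by simp
  qed
  have "\<bar>grid_avg K' i v \<phi> - grid_avg K i v \<phi>\<bar> =
    \<bar>\<Sum>u<2 ^ (CARD('n) * K' - i). \<phi> (grid_pt K' (v + 2 ^ i * u)) - \<phi> (grid_pt K (v + 2 ^ i * u))\<bar> / 2 ^ (CARD('n) * K' - i)"
    unfolding grid_avg_coarse[OF assms(1,2), of \<phi> v, symmetric] grid_avg_def[of K']
    by (simp add: diff_divide_distrib[symmetric] sum_subtractf)
  also have "\<dots> \<le> (\<Sum>u<(2::nat) ^ (CARD('n) * K' - i). \<Lambda> * CARD('n) / 2 ^ K) / 2 ^ (CARD('n) * K' - i)"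
    by (intro divide_right_mono order_trans[OF sum_abs sum_mono[OF pt]]) simp
  also have "\<dots> = \<Lambda> * CARD('n) / 2 ^ K" by simp
  finally show ?thesis .
qed

section \<open>Approximate martingales\<close>

text \<open>The errors \<open>\<delta> / 2 ^ i\<close> add up to at most \<open>2 * \<delta>\<close>
  along every path, so bounds on \<open>A\<close> carry over to the exact martingale uniformly in
  the path.\<close>

definition approx_martingale :: "real \<Rightarrow> (nat \<Rightarrow> nat \<Rightarrow> rat) \<Rightarrow> bool" where
  "approx_martingale \<delta> A \<longleftrightarrow> (\<forall>i v. v < 2 ^ i \<longrightarrow>
     \<bar>real_of_rat ((A (Suc i) v + A (Suc i) (v + 2 ^ i)) / 2) - real_of_rat (A i v)\<bar> \<le> \<delta> / 2 ^ i)"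

lemma increment_approx:
  assumes "approx_martingale \<delta> A"
  shows "\<bar>real_of_rat (increment A Z j) -
     (real_of_rat (A (Suc j) (prefix_val Z (Suc j))) - real_of_rat (A j (prefix_val Z j)))\<bar> \<le> \<delta> / 2 ^ j"
proof -
  let ?v = "prefix_val Z j"
  have "\<bar>real_of_rat ((A (Suc j) ?v + A (Suc j) (?v + 2 ^ j)) / 2) - real_of_rat (A j ?v)\<bar> \<le> \<delta> / 2 ^ j"
    using assms prefix_val_less[of Z j] unfolding approx_martingale_def by blast
  then show ?thesis
    unfolding increment_def prefix_val_Suc
    by (cases "Z j") (simp_all add: of_rat_add of_rat_diff of_rat_divide of_rat_minus of_rat_mult abs_le_iff field_simps)
qed

lemma gain_approx:
  assumes "approx_martingale \<delta> A" and \<theta>: "\<And>j v. \<theta> j v \<le> 1"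
  shows "\<bar>real_of_rat (gain \<theta> A Z k) - (\<Sum>j<k. real (\<theta> j (prefix_val Z j)) *
     (real_of_rat (A (Suc j) (prefix_val Z (Suc j))) - real_of_rat (A j (prefix_val Z j))))\<bar> \<le> 2 * \<delta>"
proof -
  let ?d = "\<lambda>j. real_of_rat (A (Suc j) (prefix_val Z (Suc j))) - real_of_rat (A j (prefix_val Z j))"
  have \<delta>: "0 \<le> \<delta>" using increment_approx[OF assms(1), of Z 0] by simp
  have "real_of_rat (gain \<theta> A Z k) - (\<Sum>j<k. real (\<theta> j (prefix_val Z j)) * ?d j) =
    (\<Sum>j<k. real (\<theta> j (prefix_val Z j)) * (real_of_rat (increment A Z j) - ?d j))"
    by (simp add: gain_def of_rat_sum of_rat_mult sum_subtractf[symmetric] right_diff_distrib)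
  also have "\<bar>\<dots>\<bar> \<le> (\<Sum>j<k. \<delta> * (1 / 2) ^ j)"
  proof (rule order_trans[OF sum_abs sum_mono])
    fix j
    have "\<bar>real (\<theta> j (prefix_val Z j)) * (real_of_rat (increment A Z j) - ?d j)\<bar> \<le> 1 * (\<delta> / 2 ^ j)"
      unfolding abs_mult using \<theta>[of j "prefix_val Z j"] \<delta>
      by (intro mult_mono increment_approx[OF assms(1)]) auto
    then show "\<bar>real (\<theta> j (prefix_val Z j)) * (real_of_rat (increment A Z j) - ?d j)\<bar> \<le> \<delta> * (1 / 2) ^ j"
      by (simp add: power_one_over)
  qed
  also have "\<dots> = \<delta> * (\<Sum>j<k. (1 / 2) ^ j)" by (rule sum_distrib_left[symmetric])
  also have "\<dots> \<le> \<delta> * 2"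
  proof (rule mult_left_mono[OF _ \<delta>])
    show "(\<Sum>j<k. (1 / 2 :: real) ^ j) \<le> 2" by (simp add: geometric_sum)
  qed
  finally show ?thesis by simp
qed

lemma approx_martingale_bounded:
  assumes A: "computable_rat 2 (\<lambda>xs. A (xs ! 0) (xs ! 1))" and am: "approx_martingale \<delta> A"
    and lower: "\<And>i v. v < 2 ^ i \<Longrightarrow> - c \<le> real_of_rat (A i v)"
    and rand: "computably_random_seq Z"
  shows "\<exists>C. \<forall>k. real_of_rat (A k (prefix_val Z k)) \<le> C"
proof -
  let ?\<theta> = "\<lambda>_ _. 1 :: nat"
  have tel: "(\<Sum>j<k. real (?\<theta> j (prefix_val Z j)) *
     (real_of_rat (A (Suc j) (prefix_val Z (Suc j))) - real_of_rat (A j (prefix_val Z j)))) =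
     real_of_rat (A k (prefix_val Z k)) - real_of_rat (A 0 0)" for Z k
    by (simp add: sum_lessThan_telescope[of "\<lambda>j. real_of_rat (A j (prefix_val Z j))"]) (simp add: prefix_val_def)
  have app: "\<bar>real_of_rat (gain ?\<theta> A Z k) - (real_of_rat (A k (prefix_val Z k)) - real_of_rat (A 0 0))\<bar> \<le> 2 * \<delta>" for Z k
    using gain_approx[OF am, where \<theta> = ?\<theta> and Z = Z and k = k] unfolding tel by simp
  obtain E :: rat where E: "c + \<bar>real_of_rat (A 0 0)\<bar> + 2 * \<delta> < real_of_rat E"
    using of_rat_dense[of "c + \<bar>real_of_rat (A 0 0)\<bar> + 2 * \<delta>" "c + \<bar>real_of_rat (A 0 0)\<bar> + 2 * \<delta> + 1"] by auto
  have "- E \<le> gain ?\<theta> A Z k" for Z k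
  proof -
    have "real_of_rat (- E) \<le> real_of_rat (gain ?\<theta> A Z k)"
      using app[of Z k] lower[OF prefix_val_less[of Z k]] E unfolding of_rat_minus by linarith
    then show ?thesis by (simp add: of_rat_less_eq)
  qed
  from gain_bounded_of_random[OF computable_nat_const A this rand]
  obtain C where C: "\<And>k. gain ?\<theta> A Z k \<le> C" by auto
  have "real_of_rat (A k (prefix_val Z k)) \<le> real_of_rat C + \<bar>real_of_rat (A 0 0)\<bar> + 2 * \<delta>" for k
    using app[of Z k] C[of k] of_rat_less_eq[of "gain ?\<theta> A Z k" C, where 'a = real] by linarith
  then show ?thesis by blast
qed

section \<open>Convergence by upcrossings\<close>

text \<open>The stake of the upcrossing strategy: buy below \<open>\<alpha>\<close> and sell above \<open>\<beta>\<close>.\<close>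

primrec hold :: "rat \<Rightarrow> rat \<Rightarrow> (nat \<Rightarrow> nat \<Rightarrow> rat) \<Rightarrow> nat \<Rightarrow> nat \<Rightarrow> nat" where
  "hold \<alpha> \<beta> A 0 v = 0"
| "hold \<alpha> \<beta> A (Suc j) v = (if A (Suc j) (v mod 2 ^ Suc j) < \<alpha> then 1
     else if \<beta> < A (Suc j) (v mod 2 ^ Suc j) then 0 else hold \<alpha> \<beta> A j v)"

lemma hold_le_1: "hold \<alpha> \<beta> A j v \<le> 1"
  by (induction j) auto

lemma hold_prefix_val:
  assumes "j \<le> k"
  shows "hold \<alpha> \<beta> A j (prefix_val Z k) = hold \<alpha> \<beta> A j (prefix_val Z j)"
proof -
  have "hold \<alpha> \<beta> A j (prefix_val Z k) = hold \<alpha> \<beta> A j (prefix_val Z k')" if "j \<le> k" "j \<le> k'" for k k'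
    using that by (induction j) (auto simp: prefix_val_mod simp del: power_Suc)
  from this[OF assms] show ?thesis by simp
qed

lemma computable_nat_hold:
  assumes A: "computable_rat 2 (\<lambda>xs. A (xs ! 0) (xs ! 1))"
  shows "computable_nat 2 (\<lambda>xs. hold \<alpha> \<beta> A (xs ! 0) (xs ! 1))"
proof -
  define s where "s ws = (if A (Suc (ws ! 0)) (ws ! 3 mod 2 ^ Suc (ws ! 0)) < \<alpha> then 1
     else if \<beta> < A (Suc (ws ! 0)) (ws ! 3 mod 2 ^ Suc (ws ! 0)) then 0 else ws ! 1)" for ws :: "nat list"
  have "computable_nat (Suc (Suc 2)) s"
    unfolding s_def
    by (intro computable_nat_if computable_pred_rat_less computable_rat_comp2[OF A] computable_rat_const
        computable_nat_intros) auto
  then have "computable_nat 2 (\<lambda>xs. rec_nat 0 (\<lambda>m y. s (m # y # xs)) (xs ! 0))"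
    by (intro computable_nat_rec computable_nat_intros) auto
  moreover have "rec_nat 0 (\<lambda>m y. s (m # y # xs)) j = hold \<alpha> \<beta> A j (xs ! 1)" for xs j
    by (induction j) (auto simp: s_def)
  ultimately show ?thesis by simp
qed

text \<open>If the lower limit were below the upper limit, two rationals would fit strictly between.
  The thresholds are rational because the betting strategy has to compare with them
  computably.\<close>

lemma real_convergent_of_no_oscillation:
  fixes X :: "nat \<Rightarrow> real"
  assumes bound: "\<And>k. \<bar>X k\<bar> \<le> c"
    and osc: "\<And>\<alpha> \<beta> :: rat. \<alpha> < \<beta> \<Longrightarrow>
      \<not> ((\<exists>\<^sub>F k in sequentially. X k < of_rat \<alpha>) \<and> (\<exists>\<^sub>F k in sequentially. of_rat \<beta> < X k))"
  shows "convergent X"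
proof -
  let ?u = "limsup (\<lambda>k. ereal (X k))" and ?l = "liminf (\<lambda>k. ereal (X k))"
  have "?u \<le> ?l"
  proof (rule ccontr)
    assume "\<not> ?u \<le> ?l"
    then have "?l < ?u" by simp
    then obtain x y where xy: "?l < ereal x" "ereal x < ereal y" "ereal y < ?u"
      by (metis ereal_dense2)
    then have "x < y" by simp
    then obtain \<alpha> where \<alpha>: "x < of_rat \<alpha>" "of_rat \<alpha> < y" using of_rat_dense by blast
    obtain \<beta> where \<beta>: "real_of_rat \<alpha> < of_rat \<beta>" "of_rat \<beta> < y" using of_rat_dense[OF \<alpha>(2)] by blast
    have "\<exists>\<^sub>F k in sequentially. X k < of_rat \<alpha>"
    proof (rule ccontr)
      assume "\<not> ?thesis"
      then have "\<forall>\<^sub>F k in sequentially. ereal x \<le> ereal (X k)"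
        unfolding not_frequently by eventually_elim (use \<alpha> in simp)
      from Liminf_bounded[OF this] xy(1) show False by simp
    qed
    moreover have "\<exists>\<^sub>F k in sequentially. of_rat \<beta> < X k"
    proof (rule ccontr)
      assume "\<not> ?thesis"
      then have "\<forall>\<^sub>F k in sequentially. ereal (X k) \<le> ereal y"
        unfolding not_frequently by eventually_elim (use \<beta> in simp)
      from Limsup_bounded[OF this] xy(3) show False by simp
    qed
    ultimately show False using osc[of \<alpha> \<beta>] \<beta>(1) by (simp add: of_rat_less)
  qed
  have "ereal (- c) \<le> ?l" using bound by (intro Liminf_bounded always_eventually) (auto simp: abs_le_iff minus_le_iff)
  moreover have "?u \<le> ereal c" using bound by (intro Limsup_bounded always_eventually) (auto simp: abs_le_iff)
  moreover have "?l \<le> ?u" by (rule Liminf_le_Limsup) simp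
  ultimately obtain r where r: "?u = ereal r" using \<open>?u \<le> ?l\<close>
    by (cases ?u) auto
  have "X \<longlonglongrightarrow> r" by (rule limsup_le_liminf_real) (use r \<open>?u \<le> ?l\<close> in auto)
  then show ?thesis by (rule convergentI)
qed

text \<open>Doob's upcrossing inequality on a single path. The term \<open>h k * (m k - a)\<close>
  is the open position, reckoned as if bought at \<open>a\<close>: the actual purchase happens below
  \<open>a\<close>, and each sale above \<open>b\<close> realizes at least
  \<open>b - a\<close>.\<close>

lemma upcrossing_gain:
  fixes m :: "nat \<Rightarrow> real" and h :: "nat \<Rightarrow> nat"
  assumes h: "h 0 = 0" "\<And>j. h (Suc j) = (if m (Suc j) < a then 1 else if b < m (Suc j) then 0 else h j)"
    and "a \<le> b"
  shows "(b - a) * (\<Sum>j<k. of_bool (h j = 1 \<and> h (Suc j) = 0)) + real (h k) * (m k - a) \<le>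
    (\<Sum>j<k. real (h j) * (m (Suc j) - m j))"
proof (induction k)
  case (Suc k)
  have "h k \<le> 1" by (induction k) (auto simp: h)
  then have "h k = 0 \<or> h k = 1" by auto
  then have "(b - a) * of_bool (h k = 1 \<and> h (Suc k) = 0) + real (h (Suc k)) * (m (Suc k) - a) \<le>
    real (h k) * (m k - a) + real (h k) * (m (Suc k) - m k)"
    using assms(3) by (auto simp: h(2))
  with Suc show ?case by (simp add: distrib_left)
qed (simp add: h)

lemma approx_martingale_convergent:
  assumes A: "computable_rat 2 (\<lambda>xs. A (xs ! 0) (xs ! 1))" and am: "approx_martingale \<delta> A"
    and bound: "\<And>i v. v < 2 ^ i \<Longrightarrow> \<bar>real_of_rat (A i v)\<bar> \<le> c"
    and rand: "computably_random_seq Z"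
  shows "convergent (\<lambda>k. real_of_rat (A k (prefix_val Z k)))"
proof (rule real_convergent_of_no_oscillation)
  show "\<bar>real_of_rat (A k (prefix_val Z k))\<bar> \<le> c" for k by (rule bound[OF prefix_val_less])
  fix \<alpha> \<beta> :: rat assume "\<alpha> < \<beta>"
  define a b where "a = real_of_rat \<alpha>" and "b = real_of_rat \<beta>"
  have ab: "a < b" using \<open>\<alpha> < \<beta>\<close> by (simp add: a_def b_def of_rat_less)
  define m where "m Z k = real_of_rat (A k (prefix_val Z k))" for Z k
  define h where "h Z k = hold \<alpha> \<beta> A k (prefix_val Z k)" for Z k
  define U where "U Z k = (\<Sum>j<k. of_bool (h Z j = 1 \<and> h Z (Suc j) = 0) :: real)" for Z k
  have h0: "h Z 0 = 0" for Z by (simp add: h_def)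
  have h: "h Z (Suc j) = (if m Z (Suc j) < a then 1 else if b < m Z (Suc j) then 0 else h Z j)" for Z j
    using prefix_val_less[of Z "Suc j"]
    by (simp add: h_def m_def a_def b_def of_rat_less hold_prefix_val[of j "Suc j"] del: power_Suc)
  have h1: "h Z k \<le> 1" for Z k unfolding h_def by (rule hold_le_1)
  have app: "\<bar>real_of_rat (gain (hold \<alpha> \<beta> A) A Z k) - (\<Sum>j<k. real (h Z j) * (m Z (Suc j) - m Z j))\<bar> \<le> 2 * \<delta>" for Z k
    using gain_approx[OF am, where \<theta> = "hold \<alpha> \<beta> A" and Z = Z and k = k] hold_le_1 by (simp add: h_def m_def)
  \<comment> \<open>An open position loses at most \<open>c + \<bar>a\<bar>\<close>, as all values
    are bounded by \<open>c\<close>. With \<open>U \<ge> 0\<close> this bounds the gain below on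
    every path; on \<open>Z\<close> itself the upper bound from randomness then limits the number
    \<open>U\<close> of sales.\<close>
  have low: "(b - a) * U Z k - (c + \<bar>a\<bar>) - 2 * \<delta> \<le> real_of_rat (gain (hold \<alpha> \<beta> A) A Z k)" for Z k
  proof -
    have "\<bar>m Z k\<bar> \<le> c" unfolding m_def by (rule bound[OF prefix_val_less])
    moreover from this have "- (c + \<bar>a\<bar>) \<le> real (h Z k) * (m Z k - a)"
      using h1[of Z k] by (cases "h Z k = 0") (auto simp: le_Suc_eq)
    ultimately show ?thesis
      using upcrossing_gain[of "h Z" "m Z" a b k, OF h0 h] ab app[of Z k] unfolding U_def by linarith
  qed
  have U0: "0 \<le> U Z k" for Z k unfolding U_def by (intro sum_nonneg) auto
  obtain E :: rat where E: "(c + \<bar>a\<bar>) + 2 * \<delta> < real_of_rat E"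
    using of_rat_dense[of "(c + \<bar>a\<bar>) + 2 * \<delta>" "(c + \<bar>a\<bar>) + 2 * \<delta> + 1"] by auto
  have "- E \<le> gain (hold \<alpha> \<beta> A) A Z k" for Z k
  proof -
    have "0 \<le> (b - a) * U Z k" using ab U0 by (intro mult_nonneg_nonneg) auto
    then have "real_of_rat (- E) \<le> real_of_rat (gain (hold \<alpha> \<beta> A) A Z k)"
      using low[of Z k] E unfolding of_rat_minus by linarith
    then show ?thesis by (simp add: of_rat_less_eq)
  qed
  from gain_bounded_of_random[OF computable_nat_hold[OF A] A this rand]
  obtain C where C: "\<And>k. gain (hold \<alpha> \<beta> A) A Z k \<le> C" by auto
  have "(b - a) * U Z k \<le> real_of_rat C + (c + \<bar>a\<bar>) + 2 * \<delta>" for k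
    using low[of Z k] C[of k] of_rat_less_eq[of "gain (hold \<alpha> \<beta> A) A Z k" C, where 'a = real] by linarith
  then have Ub: "U Z k \<le> (real_of_rat C + (c + \<bar>a\<bar>) + 2 * \<delta>) / (b - a)" for k
    using ab by (simp add: pos_le_divide_eq mult.commute)
  show "\<not> ((\<exists>\<^sub>F k in sequentially. real_of_rat (A k (prefix_val Z k)) < of_rat \<alpha>) \<and>
      (\<exists>\<^sub>F k in sequentially. of_rat \<beta> < real_of_rat (A k (prefix_val Z k))))"
  proof
    assume "(\<exists>\<^sub>F k in sequentially. real_of_rat (A k (prefix_val Z k)) < of_rat \<alpha>) \<and>
      (\<exists>\<^sub>F k in sequentially. of_rat \<beta> < real_of_rat (A k (prefix_val Z k)))"
    then have f1: "\<exists>k>N. m Z k < a" and f2: "\<exists>k>N. b < m Z k" for N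
      unfolding frequently_sequentially m_def a_def b_def by (meson Suc_le_eq)+
    have "\<exists>k. real N \<le> U Z k" for N
    proof (induction N)
      case 0
      show ?case using U0 by auto
    next
      case (Suc N)
      then obtain k where k: "real N \<le> U Z k" by blast
      obtain k1 where k1: "k1 > k" "m Z k1 < a" using f1 by blast
      obtain k2 where k2: "k2 > k1" "b < m Z k2" using f2 by blast
      have hk1: "h Z k1 = 1" using k1 h[of Z "k1 - 1"] by simp
      have hk2: "h Z k2 = 0" using k2 ab h[of Z "k2 - 1"] by simp
      have "\<exists>j\<ge>k1. j < k2 \<and> h Z j = 1 \<and> h Z (Suc j) = 0"
      proof (rule ccontr)
        assume no: "\<not> ?thesis"
        have "h Z (k1 + d) = 1" if "k1 + d \<le> k2" for d
          using that
        proof (induction d)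
          case (Suc d)
          then have "h Z (k1 + d) = 1" by simp
          then have "h Z (Suc (k1 + d)) \<noteq> 0" using no Suc.prems by auto
          then show ?case using h1[of Z "Suc (k1 + d)"] by simp
        qed (use hk1 in simp)
        from this[of "k2 - k1"] k2 hk2 show False by simp
      qed
      then obtain j where j: "k1 \<le> j" "j < k2" "h Z j = 1" "h Z (Suc j) = 0" by blast
      have mono: "U Z p \<le> U Z q" if "p \<le> q" for p q
        unfolding U_def using that by (intro sum_mono2) auto
      have "U Z (Suc j) = U Z j + 1" using j by (simp add: U_def)
      then show ?case using k mono[of k j] j(1) k1(1) by (intro exI[of _ "Suc j"]) auto
    qed
    moreover obtain N :: nat where "(real_of_rat C + (c + \<bar>a\<bar>) + 2 * \<delta>) / (b - a) < real N"
      using reals_Archimedean2 by blast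
    ultimately show False using Ub by (meson leD order_trans)
  qed
qed

section \<open>Difference quotients and second differences\<close>

definition lattice_vec :: "nat \<Rightarrow> ('n \<Rightarrow> int) \<Rightarrow> real ^ 'n::finite" where
  "lattice_vec N w = (\<chi> c. of_int (w c) / 2 ^ N)"

definition l1 :: "('n::finite \<Rightarrow> int) \<Rightarrow> real" where
  "l1 w = (\<Sum>c\<in>UNIV. \<bar>of_int (w c)\<bar>)"

lemma l1_nonneg: "0 \<le> l1 w"
  by (simp add: l1_def sum_nonneg)

lemma l1_add: "l1 (\<lambda>c. v c + w c) \<le> l1 v + l1 w"
  by (simp add: l1_def sum.distrib[symmetric] sum_mono abs_triangle_ineq)

lemma norm_lattice_vec_le: "norm (lattice_vec N w) \<le> l1 w / 2 ^ N"
proof -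
  have "norm (lattice_vec N w) \<le> (\<Sum>c\<in>UNIV. \<bar>lattice_vec N w $ c\<bar>)" by (rule norm_le_l1_cart)
  also have "\<dots> = l1 w / 2 ^ N"
    by (simp add: l1_def lattice_vec_def sum_divide_distrib abs_divide)
  finally show ?thesis .
qed

lemma lattice_vec_add: "lattice_vec N (\<lambda>c. v c + w c) = lattice_vec N v + lattice_vec N w"
  by (simp add: lattice_vec_def vec_eq_iff add_divide_distrib)

lemma lattice_vec_double: "lattice_vec (Suc N) w + lattice_vec (Suc N) w = lattice_vec N w"
  by (simp add: lattice_vec_def vec_eq_iff)

lemma abs_square_diff_le:
  fixes p q :: real
  assumes "\<bar>p\<bar> \<le> M" "\<bar>q\<bar> \<le> M" "\<bar>p - q\<bar> \<le> d"
  shows "\<bar>p\<^sup>2 - q\<^sup>2\<bar> \<le> 2 * M * d"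
proof -
  have "\<bar>p\<^sup>2 - q\<^sup>2\<bar> = \<bar>p + q\<bar> * \<bar>p - q\<bar>"
    by (simp add: power2_eq_square abs_mult[symmetric] algebra_simps)
  also have "\<dots> \<le> (2 * M) * d" using assms by (intro mult_mono) auto
  finally show ?thesis .
qed

locale lipschitz_map =
  fixes g :: "real ^ 'n::{finite,linorder} \<Rightarrow> real" and L :: real
  assumes lip: "\<bar>g x - g y\<bar> \<le> L * norm (x - y)" and L_nonneg: "0 \<le> L"
begin

definition quot :: "('n \<Rightarrow> int) \<Rightarrow> nat \<Rightarrow> (real, 'n) vec \<Rightarrow> real" where
  "quot e N x = 2 ^ N * (g (x + lattice_vec N e) - g x)"

text \<open>The factor is \<open>2 ^ i\<close> although the step is \<open>e / 2 ^ Suc i\<close>: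
  this makes it half the difference of two adjacent quotients of scale \<open>Suc i\<close>, as the
  parallelogram identity requires.\<close>

definition bend :: "('n \<Rightarrow> int) \<Rightarrow> ('n \<Rightarrow> int) \<Rightarrow> nat \<Rightarrow> (real, 'n) vec \<Rightarrow> real" where
  "bend b e i x = 2 ^ i * (g (x + lattice_vec (Suc i) (\<lambda>c. b c + 2 * e c))
     - 2 * g (x + lattice_vec (Suc i) (\<lambda>c. b c + e c)) + g (x + lattice_vec (Suc i) b))"

definition energy :: "('n \<Rightarrow> int) \<Rightarrow> ('n \<Rightarrow> int) \<Rightarrow> nat \<Rightarrow> (real, 'n) vec \<Rightarrow> real" where
  "energy b e N x = (\<Sum>i<N. (bend b e i x)\<^sup>2) - (quot e N x)\<^sup>2"

lemma quot_bound: "\<bar>quot e N x\<bar> \<le> L * l1 e"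
proof -
  have "\<bar>g (x + lattice_vec N e) - g x\<bar> \<le> L * (l1 e / 2 ^ N)"
    using lip[of "x + lattice_vec N e" x] mult_left_mono[OF norm_lattice_vec_le[of N e] L_nonneg]
    by simp
  then have "2 ^ N * \<bar>g (x + lattice_vec N e) - g x\<bar> \<le> L * l1 e"
    by (simp add: pos_le_divide_eq mult.commute)
  then show ?thesis by (simp only: quot_def abs_mult) simp
qed

lemma quot_mean: "quot e N x = (quot e (Suc N) x + quot e (Suc N) (x + lattice_vec (Suc N) e)) / 2"
  by (simp add: quot_def add.assoc lattice_vec_double algebra_simps)

lemma bend_quot:
  "bend b e i x = (quot e (Suc i) (x + lattice_vec (Suc i) b + lattice_vec (Suc i) e) -
     quot e (Suc i) (x + lattice_vec (Suc i) b)) / 2"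
proof -
  have "lattice_vec (Suc i) (\<lambda>c. b c + 2 * e c) = lattice_vec (Suc i) b + (lattice_vec (Suc i) e + lattice_vec (Suc i) e)"
    by (simp add: lattice_vec_def vec_eq_iff add_divide_distrib)
  then show ?thesis
    by (simp add: bend_def quot_def lattice_vec_add add.assoc algebra_simps)
qed

lemma bend_bound: "\<bar>bend b e i x\<bar> \<le> L * l1 e"
  unfolding bend_quot
  using quot_bound[of e "Suc i" "x + lattice_vec (Suc i) b + lattice_vec (Suc i) e"]
    quot_bound[of e "Suc i" "x + lattice_vec (Suc i) b"]
  by (auto simp: abs_le_iff field_simps)

text \<open>By the parallelogram identity the squared \<open>bend\<close> is the mean of two squared
  quotients of scale \<open>Suc N\<close> minus one of scale \<open>N\<close>, all based at
  translates of \<open>x\<close>. Comparing each with the same square at \<open>x\<close> leaves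
  only differences between a function and its translate, whose box averages are boundary
  terms.\<close>

lemma energy_step:
  "energy b e (Suc N) x - energy b e N x =
    ((quot e (Suc N) (x + lattice_vec (Suc N) b))\<^sup>2 - (quot e (Suc N) x)\<^sup>2) / 2 +
    ((quot e (Suc N) (x + lattice_vec (Suc N) (\<lambda>c. b c + e c)))\<^sup>2 - (quot e (Suc N) x)\<^sup>2) / 2 -
    ((quot e N (x + lattice_vec (Suc N) b))\<^sup>2 - (quot e N x)\<^sup>2)"
proof -
  have par: "((q - p) / 2)\<^sup>2 = p\<^sup>2 / 2 + q\<^sup>2 / 2 - ((p + q) / 2)\<^sup>2" for p q :: real
    by (simp add: power2_eq_square field_simps)
  have "(bend b e N x)\<^sup>2 = (quot e (Suc N) (x + lattice_vec (Suc N) b))\<^sup>2 / 2 +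
    (quot e (Suc N) (x + lattice_vec (Suc N) (\<lambda>c. b c + e c)))\<^sup>2 / 2 - (quot e N (x + lattice_vec (Suc N) b))\<^sup>2"
    unfolding bend_quot quot_mean[of e N] lattice_vec_add add.assoc[symmetric] by (rule par)
  then show ?thesis by (simp add: energy_def field_simps)
qed

lemma quot_lipschitz: "\<bar>quot e N x - quot e N y\<bar> \<le> 2 * L * 2 ^ N * norm (x - y)"
proof -
  have "\<bar>quot e N x - quot e N y\<bar> = 2 ^ N * \<bar>(g (x + lattice_vec N e) - g (y + lattice_vec N e)) - (g x - g y)\<bar>"
    by (simp add: quot_def abs_mult flip: right_diff_distrib)
  also have "\<dots> \<le> 2 ^ N * (2 * (L * norm (x - y)))"
    using lip[of "x + lattice_vec N e" "y + lattice_vec N e"] lip[of x y]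
    by (intro mult_left_mono) auto
  finally show ?thesis by (simp add: mult_ac)
qed

lemma bend_lipschitz: "\<bar>bend b e i x - bend b e i y\<bar> \<le> 4 * L * 2 ^ i * norm (x - y)"
proof -
  let ?h = "lattice_vec (Suc i) b" and ?k = "lattice_vec (Suc i) e"
  show ?thesis unfolding bend_quot
    using quot_lipschitz[of e "Suc i" "x + ?h + ?k" "y + ?h + ?k"] quot_lipschitz[of e "Suc i" "x + ?h" "y + ?h"]
    by (simp add: abs_le_iff field_simps)
qed

lemma bend_square_lipschitz: "\<bar>(bend b e i x)\<^sup>2 - (bend b e i y)\<^sup>2\<bar> \<le> 8 * L\<^sup>2 * l1 e * 2 ^ i * norm (x - y)"
  using abs_square_diff_le[OF bend_bound bend_bound bend_lipschitz, of b e i x y]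
  by (simp add: power2_eq_square mult_ac)

lemma energy_lipschitz: "\<bar>energy b e N x - energy b e N y\<bar> \<le> 12 * L\<^sup>2 * l1 e * 2 ^ N * norm (x - y)"
proof -
  have "\<bar>(\<Sum>i<N. (bend b e i x)\<^sup>2 - (bend b e i y)\<^sup>2)\<bar> \<le> (\<Sum>i<N. 8 * L\<^sup>2 * l1 e * 2 ^ i * norm (x - y))"
    by (intro order_trans[OF sum_abs sum_mono] bend_square_lipschitz)
  also have "\<dots> = 8 * L\<^sup>2 * l1 e * norm (x - y) * (\<Sum>i<N. 2 ^ i)"
    by (simp add: sum_distrib_left mult_ac)
  also have "\<dots> \<le> 8 * L\<^sup>2 * l1 e * norm (x - y) * 2 ^ N"
    by (intro mult_left_mono mult_nonneg_nonneg l1_nonneg) (auto simp: mask_eq_sum_exp[symmetric] geometric_sum)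
  finally have 1: "\<bar>(\<Sum>i<N. (bend b e i x)\<^sup>2) - (\<Sum>i<N. (bend b e i y)\<^sup>2)\<bar> \<le> 8 * L\<^sup>2 * l1 e * norm (x - y) * 2 ^ N"
    by (simp add: sum_subtractf)
  have 2: "\<bar>(quot e N x)\<^sup>2 - (quot e N y)\<^sup>2\<bar> \<le> 4 * L\<^sup>2 * l1 e * norm (x - y) * 2 ^ N"
    using abs_square_diff_le[OF quot_bound quot_bound quot_lipschitz, of e N x y]
    by (simp add: power2_eq_square mult_ac)
  show ?thesis using 1 2 unfolding energy_def by (simp add: algebra_simps)
qed

lemma quot_avg_step:
  assumes "Suc N \<le> K" "i \<le> CARD('n) * l" "l \<le> K" "v < 2 ^ i"
  shows "\<bar>grid_avg K i v (quot e (Suc N)) - grid_avg K i v (quot e N)\<bar> \<le> L * (l1 e)\<^sup>2 * 2 ^ l / 2 ^ N"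
proof -
  have "grid_avg K i v (quot e N) = (1 / 2) * (grid_avg K i v (quot e (Suc N)) +
     grid_avg K i v (\<lambda>x. quot e (Suc N) (x + lattice_vec (Suc N) e)))"
    unfolding grid_avg_add[symmetric] grid_avg_cmult[symmetric]
    by (rule arg_cong[where f = "grid_avg K i v"]) (rule ext, subst quot_mean, simp)
  moreover define T where "T = L * (l1 e)\<^sup>2 * 2 ^ l / 2 ^ N"
  have "2 * (L * l1 e) * l1 e * 2 ^ l / 2 ^ Suc N = T"
    by (simp add: T_def power2_eq_square)
  then have "\<bar>grid_avg K i v (\<lambda>x. quot e (Suc N) (x + lattice_vec (Suc N) e)) - grid_avg K i v (quot e (Suc N))\<bar> \<le> T"
    using grid_avg_shift[OF assms quot_bound[of e "Suc N"], where w = e]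
    by (simp only: l1_def lattice_vec_def)
  moreover have "0 \<le> T" using L_nonneg by (simp add: T_def)
  ultimately show ?thesis unfolding T_def[symmetric] by (auto simp: abs_le_iff field_simps)
qed

lemma energy_avg_step:
  assumes "Suc N \<le> K" "i \<le> CARD('n) * l" "l \<le> K" "v < 2 ^ i"
  shows "\<bar>grid_avg K i v (energy b e (Suc N)) - grid_avg K i v (energy b e N)\<bar> \<le>
    (L * l1 e)\<^sup>2 * (2 * l1 b + l1 e) * 2 ^ l / 2 ^ N"
proof -
  let ?C = "(L * l1 e)\<^sup>2"
  define t where "t = (2::real) ^ l / 2 ^ Suc N"
  have t: "0 \<le> t" by (simp add: t_def)
  have sq: "\<bar>(quot e N x)\<^sup>2\<bar> \<le> ?C" for N x
    using abs_le_square_iff[of "quot e N x" "L * l1 e"] quot_bound[of e N x] L_nonneg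
    by (simp add: abs_mult l1_nonneg)
  have shift: "\<bar>grid_avg K i v (\<lambda>x. (quot e N' (x + lattice_vec (Suc N) w))\<^sup>2 - (quot e N' x)\<^sup>2)\<bar> \<le> 2 * ?C * l1 w * t" for N' w
    unfolding grid_avg_diff t_def
    using grid_avg_shift[OF assms, of "\<lambda>x. (quot e N' x)\<^sup>2" "?C" w] sq
    by (simp add: lattice_vec_def l1_def)
  from l1_add[of b e] have "2 * ?C * l1 (\<lambda>c. b c + e c) * t \<le> 2 * ?C * (l1 b + l1 e) * t"
    using t by (intro mult_right_mono mult_left_mono) auto
  with shift[of "Suc N" "\<lambda>c. b c + e c"]
  have 2: "\<bar>grid_avg K i v (\<lambda>x. (quot e (Suc N) (x + lattice_vec (Suc N) (\<lambda>c. b c + e c)))\<^sup>2 - (quot e (Suc N) x)\<^sup>2)\<bar>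
    \<le> 2 * ?C * (l1 b + l1 e) * t" by linarith
  have "grid_avg K i v (energy b e (Suc N)) - grid_avg K i v (energy b e N) =
    (1 / 2) * grid_avg K i v (\<lambda>x. (quot e (Suc N) (x + lattice_vec (Suc N) b))\<^sup>2 - (quot e (Suc N) x)\<^sup>2) +
    (1 / 2) * grid_avg K i v (\<lambda>x. (quot e (Suc N) (x + lattice_vec (Suc N) (\<lambda>c. b c + e c)))\<^sup>2 - (quot e (Suc N) x)\<^sup>2) -
    grid_avg K i v (\<lambda>x. (quot e N (x + lattice_vec (Suc N) b))\<^sup>2 - (quot e N x)\<^sup>2)"
    unfolding grid_avg_diff[of K i v "energy b e (Suc N)" "energy b e N", symmetric] energy_step
      grid_avg_cmult[symmetric] grid_avg_add[symmetric]
    by (simp only: grid_avg_diff[symmetric]) simp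
  \<comment> \<open>The boundary terms sum to \<open>?C * (4 * l1 b + l1 e) * t\<close>; the claimed
    bound has \<open>2 * l1 e\<close> in place of \<open>l1 e\<close>, and the surplus is
    discarded.\<close>
  moreover have "(1 / 2) * (2 * ?C * l1 b * t) + (1 / 2) * (2 * ?C * (l1 b + l1 e) * t) + 2 * ?C * l1 b * t
     = ?C * (2 * l1 b + l1 e) * (2 * t) - ?C * l1 e * t"
    by (simp add: algebra_simps)
  moreover have "0 \<le> ?C * l1 e * t" using t by (intro mult_nonneg_nonneg l1_nonneg) auto
  moreover have "?C * (2 * l1 b + l1 e) * 2 ^ l / 2 ^ N = ?C * (2 * l1 b + l1 e) * (2 * t)" by (simp add: t_def)
  ultimately show ?thesis
    using shift[of "Suc N" b] 2 shift[of N b] by linarith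
qed

end

section \<open>Rational approximations\<close>

text \<open>Passing from length \<open>i\<close> to \<open>i + 1\<close> moves the scale from
  \<open>2 * i\<close> to \<open>2 * i + 2\<close>, two steps costing at most
  \<open>c / 2 ^ i\<close> each with \<open>l = i\<close>. It also refines the grid of level
  \<open>4 * i\<close>, whose mesh outweighs the Lipschitz constant
  \<open>\<Lambda> * 2 ^ (2 * i)\<close>. The term \<open>2 * d\<close> comes from rounding at the
  parent and at the children.\<close>

lemma approx_martingale_grid:
  fixes \<psi> :: "nat \<Rightarrow> real ^ 'n::{finite,linorder} \<Rightarrow> real"
  assumes lip: "\<And>N x y. \<bar>\<psi> N x - \<psi> N y\<bar> \<le> \<Lambda> * 2 ^ N * norm (x - y)" and \<Lambda>: "0 \<le> \<Lambda>"
    and step: "\<And>N K i l v. Suc N \<le> K \<Longrightarrow> i \<le> CARD('n) * l \<Longrightarrow> l \<le> K \<Longrightarrow> v < 2 ^ i \<Longrightarrow>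
      \<bar>grid_avg K i v (\<psi> (Suc N)) - grid_avg K i v (\<psi> N)\<bar> \<le> c * 2 ^ l / 2 ^ N"
    and approx: "\<And>i v. \<bar>real_of_rat (A i v) - grid_avg (4 * i) i v (\<psi> (2 * i))\<bar> \<le> d / 2 ^ i"
  shows "approx_martingale (2 * d + 2 * c + \<Lambda> * CARD('n)) A"
  unfolding approx_martingale_def
proof (intro allI impI)
  fix i v :: nat assume v: "v < 2 ^ i"
  have c: "0 \<le> c" using step[of 0 1 0 0 0] by simp
  have d: "0 \<le> d" using approx[of 0 0] by simp
  have n: "1 \<le> CARD('n)" using zero_less_card_finite[where 'a = 'n] by linarith
  have i: "i \<le> CARD('n) * i" "i \<le> CARD('n) * (4 * i)" "i < CARD('n) * (4 * Suc i)"
  proof -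
    show "i \<le> CARD('n) * i" using mult_le_mono1[OF n, of i] by simp
    show "i \<le> CARD('n) * (4 * i)" using mult_le_mono1[OF n, of "4 * i"] by simp
    have "4 * Suc i \<le> CARD('n) * (4 * Suc i)" using mult_le_mono1[OF n, of "4 * Suc i"] by (simp only: mult_1)
    then show "i < CARD('n) * (4 * Suc i)" by (rule less_le_trans[rotated]) simp
  qed
  let ?\<psi>' = "\<psi> (2 * Suc i)" and ?K' = "4 * Suc i"
  define t where "t = (1::real) / 2 ^ i"
  have t: "0 \<le> t" by (simp add: t_def)
  have e1: "\<bar>real_of_rat (A (Suc i) w) - grid_avg ?K' (Suc i) w ?\<psi>'\<bar> \<le> d * t" for w
  proof -
    have "d / 2 ^ Suc i \<le> d * t" using d by (simp add: t_def field_simps)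
    with approx[of "Suc i" w] show ?thesis by linarith
  qed
  have e2: "(grid_avg ?K' (Suc i) v ?\<psi>' + grid_avg ?K' (Suc i) (v + 2 ^ i) ?\<psi>') / 2 = grid_avg ?K' i v ?\<psi>'"
    by (rule grid_avg_split[OF i(3), symmetric])
  have "\<bar>grid_avg ?K' i v (\<psi> (Suc (2 * i))) - grid_avg ?K' i v (\<psi> (2 * i))\<bar> \<le> c * 2 ^ i / 2 ^ (2 * i)"
    "\<bar>grid_avg ?K' i v (\<psi> (Suc (Suc (2 * i)))) - grid_avg ?K' i v (\<psi> (Suc (2 * i)))\<bar> \<le> c * 2 ^ i / 2 ^ Suc (2 * i)"
    by (rule step[OF _ i(1) _ v]; simp)+
  moreover have pow: "(2::real) ^ (2 * i) = 2 ^ i * 2 ^ i" "(2::real) ^ (4 * i) = 2 ^ (2 * i) * 2 ^ (2 * i)"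
    unfolding power_add[symmetric] by simp_all
  moreover have "c * 2 ^ i / 2 ^ (2 * i) = c * t" unfolding pow t_def by simp
  moreover have "c * 2 ^ i / 2 ^ Suc (2 * i) \<le> c * t"
  proof -
    have "c * 2 ^ i / 2 ^ Suc (2 * i) = c * t / 2" unfolding power_Suc pow t_def by simp
    also have "\<dots> \<le> c * t" using c t by simp
    finally show ?thesis .
  qed
  moreover have "2 * Suc i = Suc (Suc (2 * i))" by simp
  ultimately have e3: "\<bar>grid_avg ?K' i v ?\<psi>' - grid_avg ?K' i v (\<psi> (2 * i))\<bar> \<le> 2 * (c * t)"
    by (simp only:)
  have "\<bar>grid_avg ?K' i v (\<psi> (2 * i)) - grid_avg (4 * i) i v (\<psi> (2 * i))\<bar> \<le> \<Lambda> * 2 ^ (2 * i) * CARD('n) / 2 ^ (4 * i)"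
    by (rule grid_avg_refine[OF _ i(2) lip]) (use \<Lambda> in auto)
  also have "\<dots> = \<Lambda> * CARD('n) * (1 / 2 ^ (2 * i))"
    unfolding pow(2) by simp
  also have "\<dots> \<le> \<Lambda> * CARD('n) * t"
    unfolding t_def using \<Lambda> by (intro mult_left_mono divide_left_mono power_increasing) auto
  finally have e4: "\<bar>grid_avg ?K' i v (\<psi> (2 * i)) - grid_avg (4 * i) i v (\<psi> (2 * i))\<bar> \<le> \<Lambda> * CARD('n) * t" .
  have e5: "\<bar>real_of_rat (A i v) - grid_avg (4 * i) i v (\<psi> (2 * i))\<bar> \<le> d * t"
    using approx[of i v] by (simp add: t_def)
  have eq: "real_of_rat ((A (Suc i) v + A (Suc i) (v + 2 ^ i)) / 2) =
    (real_of_rat (A (Suc i) v) + real_of_rat (A (Suc i) (v + 2 ^ i))) / 2"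
    by (simp add: of_rat_divide of_rat_add)
  have bound: "(2 * d + 2 * c + \<Lambda> * CARD('n)) / 2 ^ i = 2 * (d * t) + 2 * (c * t) + \<Lambda> * CARD('n) * t"
    by (simp add: t_def add_divide_distrib)
  have triangle: "\<bar>(a1 + a2) / 2 - a\<bar> \<le> 2 * p + 2 * q + r"
    if "\<bar>a1 - g1\<bar> \<le> p" "\<bar>a2 - g2\<bar> \<le> p" "(g1 + g2) / 2 = g" "\<bar>g - h\<bar> \<le> 2 * q" "\<bar>h - m\<bar> \<le> r" "\<bar>a - m\<bar> \<le> p"
    for a1 a2 a g1 g2 g h m p q r :: real
  proof -
    have "\<bar>(a1 + a2) / 2 - g\<bar> \<le> p" using that(1-3) by (auto simp: abs_le_iff field_simps)
    with that(4-6) show ?thesis by linarith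
  qed
  show "\<bar>real_of_rat ((A (Suc i) v + A (Suc i) (v + 2 ^ i)) / 2) - real_of_rat (A i v)\<bar>
      \<le> (2 * d + 2 * c + \<Lambda> * CARD('n)) / 2 ^ i"
    unfolding eq bound by (rule triangle[OF e1 e1 e2 e3 e4 e5])
qed

definition rat_avg :: "nat \<Rightarrow> (nat \<Rightarrow> nat \<Rightarrow> rat) \<Rightarrow> nat \<Rightarrow> nat \<Rightarrow> rat" where
  "rat_avg n \<psi> i v = (\<Sum>u<2 ^ (n * (4 * i) - i). \<psi> i (v + 2 ^ i * u)) * inverse (2 ^ (n * (4 * i) - i))"

lemma computable_rat_avg:
  assumes "computable_rat 2 (\<lambda>xs. \<psi> (xs ! 0) (xs ! 1))"
  shows "computable_rat 2 (\<lambda>xs. rat_avg n \<psi> (xs ! 0) (xs ! 1))"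
proof -
  have "computable_rat (Suc 2) (\<lambda>ws. \<psi> (ws ! 1) (ws ! 2 + 2 ^ (ws ! 1) * ws ! 0))"
    by (intro computable_rat_comp2[OF assms] computable_nat_intros) auto
  then have "computable_rat 2 (\<lambda>xs. (\<Sum>u<2 ^ (n * (4 * xs ! 0) - xs ! 0).
     (\<lambda>ws. \<psi> (ws ! 1) (ws ! 2 + 2 ^ (ws ! 1) * ws ! 0)) (u # xs)) * inverse (2 ^ (n * (4 * xs ! 0) - xs ! 0)))"
    by (intro computable_rat_mult computable_rat_two_power computable_rat_sum computable_nat_intros) auto
  then show ?thesis by (simp add: rat_avg_def eval_nat_numeral)
qed

lemma rat_avg_approx:
  fixes \<phi> :: "real ^ 'n::{finite,linorder} \<Rightarrow> real"
  assumes "\<And>w. \<bar>real_of_rat (\<psi> i w) - \<phi> (grid_pt (4 * i) w)\<bar> \<le> \<epsilon>"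
  shows "\<bar>real_of_rat (rat_avg CARD('n) \<psi> i v) - grid_avg (4 * i) i v \<phi>\<bar> \<le> \<epsilon>"
proof -
  let ?m = "CARD('n) * (4 * i) - i"
  have "real_of_rat (rat_avg CARD('n) \<psi> i v) - grid_avg (4 * i) i v \<phi> =
    (\<Sum>u<2 ^ ?m. real_of_rat (\<psi> i (v + 2 ^ i * u)) - \<phi> (grid_pt (4 * i) (v + 2 ^ i * u))) / 2 ^ ?m"
    by (simp add: rat_avg_def grid_avg_def of_rat_mult of_rat_sum of_rat_inverse of_rat_power sum_subtractf
        diff_divide_distrib divide_inverse left_diff_distrib)
  moreover have "\<bar>\<Sum>u<2 ^ ?m. real_of_rat (\<psi> i (v + 2 ^ i * u)) - \<phi> (grid_pt (4 * i) (v + 2 ^ i * u))\<bar> \<le> (\<Sum>u<(2::nat) ^ ?m. \<epsilon>)"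
    by (intro order_trans[OF sum_abs sum_mono] assms)
  ultimately show ?thesis by (simp add: pos_divide_le_eq mult.commute)
qed

lemma computable_rat_comp4:
  assumes "computable_rat 4 (\<lambda>ys. f (ys ! 0) (ys ! 1) (ys ! 2) (ys ! 3))"
    "computable_nat k F" "computable_nat k G" "computable_nat k H" "computable_nat k I"
  shows "computable_rat k (\<lambda>xs. f (F xs) (G xs) (H xs) (I xs))"
  using computable_rat_comp[of "[F, G, H, I]" "\<lambda>ys. f (ys ! 0) (ys ! 1) (ys ! 2) (ys ! 3)" k] assms
  by (auto simp: eval_nat_numeral)

text \<open>The margin 4 covers the largest rounding error that occurs: \<open>bend\<close> combines
  values of \<open>g\<close> with weights 1, 2, 1, and its factor \<open>2 ^ j\<close> is absorbed
  by the precision.\<close>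

lemma square_approx:
  fixes p q :: real
  assumes "\<bar>p - q\<bar> \<le> d" "\<bar>q\<bar> \<le> M" "d \<le> 4"
  shows "\<bar>p\<^sup>2 - q\<^sup>2\<bar> \<le> 2 * (M + 4) * d"
  using assms by (intro abs_square_diff_le) auto

text \<open>For \<open>N \<le> K\<close> the displaced grid point again has denominator
  \<open>2 ^ K\<close>. The displacement \<open>w\<close> is a parameter, not an argument, of the
  computable function: each martingale uses only finitely many displacements, so integer vectors
  need no coding.\<close>

locale approximable_map = lipschitz_map g L
  for g :: "real ^ 'n::{finite,linorder} \<Rightarrow> real" and L :: real +
  fixes val :: "nat \<Rightarrow> nat \<Rightarrow> nat \<Rightarrow> ('n \<Rightarrow> int) \<Rightarrow> nat \<Rightarrow> rat"
  assumes val: "N \<le> K \<Longrightarrow> \<bar>real_of_rat (val p K N w v) - g (grid_pt K v + lattice_vec N w)\<bar> \<le> 1 / 2 ^ p"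
    and computable_val: "computable_rat 4 (\<lambda>xs. val (xs ! 0) (xs ! 1) (xs ! 2) w (xs ! 3))"
begin

text \<open>A string of length \<open>i\<close> is evaluated at scale \<open>2 * i\<close> on the grid of level \<open>4 * i\<close> with precision
  \<open>6 * i\<close>: the gaps make boundary terms, grid errors and rounding errors all \<open>O(2 ^ -i)\<close>.\<close>

definition rat_quot :: "('n \<Rightarrow> int) \<Rightarrow> nat \<Rightarrow> nat \<Rightarrow> rat" where
  "rat_quot e i v = 2 ^ (2 * i) * (val (6 * i) (4 * i) (2 * i) e v - val (6 * i) (4 * i) (2 * i) (\<lambda>_. 0) v)"

definition rat_bend :: "('n \<Rightarrow> int) \<Rightarrow> ('n \<Rightarrow> int) \<Rightarrow> nat \<Rightarrow> nat \<Rightarrow> nat \<Rightarrow> rat" where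
  "rat_bend b e j i v = 2 ^ j * (val (6 * i) (4 * i) (Suc j) (\<lambda>c. b c + 2 * e c) v
     - 2 * val (6 * i) (4 * i) (Suc j) (\<lambda>c. b c + e c) v + val (6 * i) (4 * i) (Suc j) b v)"

definition rat_energy :: "('n \<Rightarrow> int) \<Rightarrow> ('n \<Rightarrow> int) \<Rightarrow> nat \<Rightarrow> nat \<Rightarrow> rat" where
  "rat_energy b e i v = (\<Sum>j<2 * i. (rat_bend b e j i v)\<^sup>2) - (rat_quot e i v)\<^sup>2"

lemma computable_val_comp:
  assumes "computable_nat k F" "computable_nat k G" "computable_nat k H" "computable_nat k I"
  shows "computable_rat k (\<lambda>xs. val (F xs) (G xs) (H xs) w (I xs))"
  by (rule computable_rat_comp4[where f = "\<lambda>a b c. val a b c w", OF computable_val assms])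

lemma computable_rat_quot: "computable_rat 2 (\<lambda>xs. rat_quot e (xs ! 0) (xs ! 1))"
  unfolding rat_quot_def
  by (intro computable_rat_intros computable_val_comp computable_nat_intros) auto

lemma computable_rat_energy: "computable_rat 2 (\<lambda>xs. rat_energy b e (xs ! 0) (xs ! 1))"
proof -
  have "computable_rat (Suc 2) (\<lambda>ws. (rat_bend b e (ws ! 0) (ws ! 1) (ws ! 2))\<^sup>2)"
    unfolding rat_bend_def
    by (intro computable_rat_intros computable_val_comp computable_nat_intros) auto
  from computable_rat_sum[OF this, of "\<lambda>xs. 2 * xs ! 0"]
  have "computable_rat 2 (\<lambda>xs. \<Sum>j<2 * xs ! 0. (rat_bend b e j (xs ! 0) (xs ! 1))\<^sup>2)"
    by (simp add: eval_nat_numeral computable_nat_intros)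
  then show ?thesis
    unfolding rat_energy_def by (intro computable_rat_diff computable_rat_power2 computable_rat_quot)
qed

lemma rat_quot_approx:
  "\<bar>real_of_rat (rat_quot e i v) - quot e (2 * i) (grid_pt (4 * i) v)\<bar> \<le> 2 * (2 ^ (2 * i) / 2 ^ (6 * i))"
proof -
  let ?x = "grid_pt (4 * i) v :: real ^ 'n::{finite,linorder}"
  have 0: "lattice_vec N (\<lambda>_. 0) = (0 :: real ^ 'n::{finite,linorder})" for N
    by (simp add: lattice_vec_def vec_eq_iff)
  have le: "2 * i \<le> 4 * i" by simp
  have "real_of_rat (rat_quot e i v) - quot e (2 * i) ?x =
    2 ^ (2 * i) * ((real_of_rat (val (6 * i) (4 * i) (2 * i) e v) - g (?x + lattice_vec (2 * i) e)) -
      (real_of_rat (val (6 * i) (4 * i) (2 * i) (\<lambda>_. 0) v) - g (?x + lattice_vec (2 * i) (\<lambda>_. 0))))"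
    by (simp add: rat_quot_def quot_def 0 of_rat_mult of_rat_power of_rat_diff right_diff_distrib)
  also have "\<bar>\<dots>\<bar> \<le> 2 ^ (2 * i) * (2 * (1 / 2 ^ (6 * i)))"
    unfolding abs_mult using val[OF le, of "6 * i" e v] val[OF le, of "6 * i" "\<lambda>_. 0" v]
    by (intro mult_mono) auto
  finally show ?thesis by (simp add: mult.commute)
qed

lemma rat_bend_approx:
  assumes "j < 2 * i"
  shows "\<bar>real_of_rat (rat_bend b e j i v) - bend b e j (grid_pt (4 * i) v)\<bar> \<le> 4 * (2 ^ j / 2 ^ (6 * i))"
proof -
  let ?x = "grid_pt (4 * i) v :: real ^ 'n::{finite,linorder}"
  let ?d = "\<lambda>w. real_of_rat (val (6 * i) (4 * i) (Suc j) w v) - g (?x + lattice_vec (Suc j) w)"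
  have le: "Suc j \<le> 4 * i" using assms by simp
  have "real_of_rat (rat_bend b e j i v) - bend b e j ?x =
    2 ^ j * (?d (\<lambda>c. b c + 2 * e c) - 2 * ?d (\<lambda>c. b c + e c) + ?d b)"
    by (simp add: rat_bend_def bend_def of_rat_mult of_rat_power of_rat_diff of_rat_add algebra_simps)
  also have "\<bar>\<dots>\<bar> \<le> 2 ^ j * (4 * (1 / 2 ^ (6 * i)))"
    unfolding abs_mult
    using val[OF le, of "6 * i" "\<lambda>c. b c + 2 * e c" v] val[OF le, of "6 * i" "\<lambda>c. b c + e c" v] val[OF le, of "6 * i" b v]
    by (intro mult_mono) auto
  finally show ?thesis by (simp add: mult.commute)
qed

text \<open>Squaring multiplies errors by at most \<open>2 * (L * l1 e + 4)\<close>. The errors of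
  the \<open>bend\<close> terms grow like \<open>2 ^ j / 2 ^ (6 * i)\<close> and sum geometrically
  to order \<open>2 ^ (2 * i) / 2 ^ (6 * i)\<close>, which is at most \<open>1 / 2 ^ i\<close>. The
  12 is 8 for these terms plus 4 for the quotient.\<close>

lemma rat_energy_approx:
  "\<bar>real_of_rat (rat_energy b e i v) - energy b e (2 * i) (grid_pt (4 * i) v)\<bar> \<le> 12 * (L * l1 e + 4) / 2 ^ i"
proof -
  let ?x = "grid_pt (4 * i) v :: real ^ 'n::{finite,linorder}"
  define M where "M = L * l1 e + 4"
  define s where "s = (1 :: real) / 2 ^ (6 * i)"
  have M: "0 \<le> M" using L_nonneg l1_nonneg[of e] by (simp add: M_def)
  have s: "0 \<le> s" by (simp add: s_def)
  have small: "2 ^ j * s \<le> 1" if "j \<le> 2 * i" for j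
  proof -
    have "(2::real) ^ j \<le> 2 ^ (6 * i)" using that by (intro power_increasing) auto
    then show ?thesis by (simp add: s_def)
  qed
  have s_eq: "2 ^ j / 2 ^ (6 * i) = 2 ^ j * s" for j by (simp add: s_def)
  have 1: "\<bar>(real_of_rat (rat_bend b e j i v))\<^sup>2 - (bend b e j ?x)\<^sup>2\<bar> \<le> 8 * M * s * 2 ^ j" if "j < 2 * i" for j
  proof -
    have "\<bar>(real_of_rat (rat_bend b e j i v))\<^sup>2 - (bend b e j ?x)\<^sup>2\<bar> \<le> 2 * M * (4 * (2 ^ j * s))"
      unfolding M_def
    proof (rule square_approx[OF _ bend_bound])
      show "\<bar>real_of_rat (rat_bend b e j i v) - bend b e j ?x\<bar> \<le> 4 * (2 ^ j * s)"
        using rat_bend_approx[OF that, of b e v] unfolding s_eq .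
      show "4 * (2 ^ j * s) \<le> 4" using small[of j] that by linarith
    qed
    also have "\<dots> = 8 * M * s * 2 ^ j" by simp
    finally show ?thesis .
  qed
  have 2: "\<bar>(real_of_rat (rat_quot e i v))\<^sup>2 - (quot e (2 * i) ?x)\<^sup>2\<bar> \<le> 4 * M * (s * 2 ^ (2 * i))"
  proof -
    have "\<bar>(real_of_rat (rat_quot e i v))\<^sup>2 - (quot e (2 * i) ?x)\<^sup>2\<bar> \<le> 2 * M * (2 * (2 ^ (2 * i) * s))"
      unfolding M_def
    proof (rule square_approx[OF _ quot_bound])
      show "\<bar>real_of_rat (rat_quot e i v) - quot e (2 * i) ?x\<bar> \<le> 2 * (2 ^ (2 * i) * s)"
        using rat_quot_approx[of e i v] unfolding s_eq .
      show "2 * (2 ^ (2 * i) * s) \<le> 4" using small[of "2 * i"] by linarith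
    qed
    also have "\<dots> = 4 * M * (s * 2 ^ (2 * i))" by simp
    finally show ?thesis .
  qed
  have "\<bar>\<Sum>j<2 * i. (real_of_rat (rat_bend b e j i v))\<^sup>2 - (bend b e j ?x)\<^sup>2\<bar> \<le> (\<Sum>j<2 * i. 8 * M * s * 2 ^ j)"
    by (rule order_trans[OF sum_abs sum_mono]) (use 1 in blast)
  also have "\<dots> = 8 * M * s * (\<Sum>j<2 * i. 2 ^ j)" by (rule sum_distrib_left[symmetric])
  also have "\<dots> \<le> 8 * M * s * 2 ^ (2 * i)"
  proof (rule mult_left_mono)
    show "(\<Sum>j<2 * i. (2::real) ^ j) \<le> 2 ^ (2 * i)" by (simp add: geometric_sum)
  qed (use M s in simp)
  finally have 3: "\<bar>(\<Sum>j<2 * i. (real_of_rat (rat_bend b e j i v))\<^sup>2) - (\<Sum>j<2 * i. (bend b e j ?x)\<^sup>2)\<bar> \<le> 8 * M * (s * 2 ^ (2 * i))"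
    by (simp only: sum_subtractf mult.assoc)
  have "real_of_rat (rat_energy b e i v) - energy b e (2 * i) ?x =
      ((\<Sum>j<2 * i. (real_of_rat (rat_bend b e j i v))\<^sup>2) - (\<Sum>j<2 * i. (bend b e j ?x)\<^sup>2)) -
      ((real_of_rat (rat_quot e i v))\<^sup>2 - (quot e (2 * i) ?x)\<^sup>2)"
    by (simp only: rat_energy_def energy_def of_rat_diff of_rat_sum of_rat_power)
  with 2 3 have "\<bar>real_of_rat (rat_energy b e i v) - energy b e (2 * i) ?x\<bar> \<le> 12 * M * (s * 2 ^ (2 * i))"
    by linarith
  also have "\<dots> \<le> 12 * M * (1 / 2 ^ i)"
  proof (rule mult_left_mono)
    have "(2::real) ^ (2 * i) * 2 ^ i \<le> 2 ^ (6 * i)"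
      unfolding power_add[symmetric] by (rule power_increasing) auto
    then show "s * 2 ^ (2 * i) \<le> 1 / 2 ^ i" by (simp add: s_def field_simps)
  qed (use M in simp)
  finally show ?thesis by (simp add: M_def)
qed

end

section \<open>Asymptotically affine functions\<close>

definition unit_vec :: "'n \<Rightarrow> 'n \<Rightarrow> int" where
  "unit_vec c = (\<lambda>c'. of_bool (c' = c))"

lemma l1_unit_vec: "l1 (unit_vec c) = 1"
  by (simp add: l1_def unit_vec_def of_bool_def if_distrib cong: if_cong)

context lipschitz_map
begin

text \<open>The picture of \<open>g\<close> near \<open>z\<close> at scale \<open>2 ^ -i\<close>,
  enlarged to unit size. All blow-ups have Lipschitz constant \<open>L\<close>, and
  differentiability at \<open>z\<close> amounts to their uniform convergence on the unit ball to a
  linear map.\<close>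

definition blow :: "(real, 'n) vec \<Rightarrow> nat \<Rightarrow> (real, 'n) vec \<Rightarrow> real" where
  "blow z i u = 2 ^ i * (g (z + (1 / 2 ^ i) *\<^sub>R u) - g z)"

lemma blow_lipschitz: "\<bar>blow z i u - blow z i u'\<bar> \<le> L * norm (u - u')"
proof -
  have "\<bar>g (z + (1 / 2 ^ i) *\<^sub>R u) - g (z + (1 / 2 ^ i) *\<^sub>R u')\<bar> \<le> L * norm ((1 / 2 ^ i) *\<^sub>R (u - u'))"
    using lip[of "z + (1 / 2 ^ i) *\<^sub>R u" "z + (1 / 2 ^ i) *\<^sub>R u'"]
    unfolding scaleR_diff_right by (simp only: add_diff_cancel_left)
  then have "2 ^ i * \<bar>g (z + (1 / 2 ^ i) *\<^sub>R u) - g (z + (1 / 2 ^ i) *\<^sub>R u')\<bar> \<le> L * norm (u - u')"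
    unfolding norm_scaleR by (simp add: pos_le_divide_eq mult.commute)
  moreover have "blow z i u - blow z i u' = 2 ^ i * (g (z + (1 / 2 ^ i) *\<^sub>R u) - g (z + (1 / 2 ^ i) *\<^sub>R u'))"
    by (simp add: blow_def right_diff_distrib)
  ultimately show ?thesis by (simp only: abs_mult) simp
qed

lemma blow_lattice_vec: "blow z i (lattice_vec q w) = 2 ^ i * (g (z + lattice_vec (i + q) w) - g z)"
proof -
  have "(1 / 2 ^ i) *\<^sub>R lattice_vec q w = (lattice_vec (i + q) w :: (real, 'n) vec)"
    by (simp add: lattice_vec_def vec_eq_iff power_add)
  then show ?thesis by (simp add: blow_def)
qed

lemma quot_translate:
  "quot e (J + q) x = 2 ^ q * (blow z J (2 ^ J *\<^sub>R (x - z) + lattice_vec q e) - blow z J (2 ^ J *\<^sub>R (x - z)))"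
proof -
  have "z + (1 / 2 ^ J) *\<^sub>R (2 ^ J *\<^sub>R (x - z)) = x" by simp
  moreover have "z + (1 / 2 ^ J) *\<^sub>R (2 ^ J *\<^sub>R (x - z) + lattice_vec q e) = x + lattice_vec (J + q) e"
    by (simp add: scaleR_add_right) (simp add: lattice_vec_def vec_eq_iff power_add)
  ultimately show ?thesis by (simp add: blow_def quot_def power_add right_diff_distrib)
qed

section \<open>Blow-ups where all second differences tend to 0\<close>

context
  fixes z :: "(real, 'n) vec"
  assumes flat: "\<And>b e. (\<lambda>i. bend b e i z) \<longlonglongrightarrow> 0"
begin

text \<open>The same number as \<open>quot w i z\<close>, but regarded as a function of
  \<open>w\<close>, in which it will be asymptotically linear.\<close>

definition ray :: "('n \<Rightarrow> int) \<Rightarrow> nat \<Rightarrow> real" where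
  "ray w i = 2 ^ i * (g (z + lattice_vec i w) - g z)"

lemma ray_second_difference:
  "(\<lambda>i. ray (\<lambda>c. b c + 2 * e c) i - 2 * ray (\<lambda>c. b c + e c) i + ray b i) \<longlonglongrightarrow> 0"
proof -
  have "(\<lambda>i. 2 * bend b e i z) \<longlonglongrightarrow> 2 * 0" by (intro tendsto_mult_left flat)
  moreover have "2 * bend b e i z = ray (\<lambda>c. b c + 2 * e c) (Suc i) - 2 * ray (\<lambda>c. b c + e c) (Suc i) + ray b (Suc i)" for i
    by (simp add: bend_def ray_def algebra_simps)
  ultimately show ?thesis
    by (subst filterlim_sequentially_Suc[symmetric]) simp
qed

lemma ray_zero: "ray (\<lambda>_. 0) i = 0"
proof -
  have "lattice_vec i (\<lambda>_. 0) = (0 :: (real, 'n) vec)" by (simp add: lattice_vec_def vec_eq_iff)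
  then show ?thesis by (simp add: ray_def)
qed

lemma ray_double: "(\<lambda>i. ray (\<lambda>c. 2 * e c) i - 2 * ray e i) \<longlonglongrightarrow> 0"
  using ray_second_difference[of "\<lambda>_. 0" e] by (simp add: ray_zero)

text \<open>\<open>v + w\<close> is the midpoint of \<open>2 * v\<close> and \<open>2 * w\<close>,
  so the second difference with base \<open>2 * v\<close> and step \<open>w - v\<close> compares the
  three; \<open>ray_double\<close> removes the factors 2. This is where bases and steps other than
  coordinate vectors are used.\<close>

lemma ray_add: "(\<lambda>i. ray (\<lambda>c. v c + w c) i - ray v i - ray w i) \<longlonglongrightarrow> 0"
proof -
  define X where "X i = ray (\<lambda>c. v c + w c) i - ray v i - ray w i" for i
  have "(\<lambda>i. ray (\<lambda>c. 2 * w c) i - 2 * ray (\<lambda>c. v c + w c) i + ray (\<lambda>c. 2 * v c) i) \<longlonglongrightarrow> 0"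
    using ray_second_difference[of "\<lambda>c. 2 * v c" "\<lambda>c. w c - v c"] by (simp add: algebra_simps)
  from tendsto_diff[OF tendsto_add[OF ray_double[of v] ray_double[of w]] this]
  have "(\<lambda>i. 2 * X i) \<longlonglongrightarrow> 0"
    by (simp add: X_def algebra_simps)
  from tendsto_mult_left[OF this, of "1 / 2"] have "X \<longlonglongrightarrow> 0" by simp
  then show ?thesis by (simp only: X_def[abs_def])
qed

lemma ray_nat_mult: "(\<lambda>i. ray (\<lambda>c. int k * w c) i - real k * ray w i) \<longlonglongrightarrow> 0"
proof (induction k)
  case (Suc k)
  from tendsto_add[OF ray_add[of w "\<lambda>c. int k * w c"] Suc]
  show ?case by (simp add: algebra_simps)
qed (simp add: ray_zero)

lemma ray_uminus: "(\<lambda>i. ray (\<lambda>c. - w c) i + ray w i) \<longlonglongrightarrow> 0"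
  using tendsto_minus[OF ray_add[of w "\<lambda>c. - w c"]] by (simp add: ray_zero add.commute)

lemma ray_int_mult: "(\<lambda>i. ray (\<lambda>c. k * w c) i - of_int k * ray w i) \<longlonglongrightarrow> 0"
proof (cases k rule: int_cases2)
  case (nonneg m)
  then show ?thesis using ray_nat_mult[of m w] by simp
next
  case (nonpos m)
  from tendsto_diff[OF ray_uminus[of "\<lambda>c. int m * w c"] ray_nat_mult[of m w]]
  show ?thesis by (simp add: nonpos algebra_simps)
qed

lemma ray_sum:
  assumes "finite S"
  shows "(\<lambda>i. ray (\<lambda>c'. \<Sum>c\<in>S. w c * unit_vec c c') i - (\<Sum>c\<in>S. of_int (w c) * ray (unit_vec c) i)) \<longlonglongrightarrow> 0"
  using assms
proof (induction S)
  case (insert c S)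
  from tendsto_add[OF tendsto_add[OF ray_add[of "\<lambda>c'. w c * unit_vec c c'" "\<lambda>c'. \<Sum>c\<in>S. w c * unit_vec c c'"]
      ray_int_mult[of "w c" "unit_vec c"]] insert.IH]
  show ?case using insert.hyps by (simp add: algebra_simps)
qed (simp add: ray_zero)

lemma ray_linear: "(\<lambda>i. ray w i - (\<Sum>c\<in>UNIV. of_int (w c) * ray (unit_vec c) i)) \<longlonglongrightarrow> 0"
proof -
  have "(\<Sum>c\<in>UNIV. w c * unit_vec c c') = w c'" for c'
    by (simp add: unit_vec_def of_bool_def if_distrib cong: if_cong)
  with ray_sum[of UNIV w] show ?thesis by simp
qed

definition slope :: "nat \<Rightarrow> (real, 'n) vec \<Rightarrow> real" where
  "slope i u = (\<Sum>c\<in>UNIV. u $ c * quot (unit_vec c) i z)"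

lemma ray_unit: "ray e i = quot e i z"
  by (simp add: ray_def quot_def)

lemma slope_bound: "\<bar>slope i u\<bar> \<le> L * (\<Sum>c\<in>UNIV. \<bar>u $ c\<bar>)"
proof -
  have "\<bar>u $ c * quot (unit_vec c) i z\<bar> \<le> L * \<bar>u $ c\<bar>" for c
    using mult_left_mono[OF quot_bound[of "unit_vec c" i z], of "\<bar>u $ c\<bar>"]
    by (simp add: abs_mult l1_unit_vec mult.commute)
  then show ?thesis unfolding slope_def sum_distrib_left
    by (intro order_trans[OF sum_abs sum_mono])
qed

lemma slope_diff: "slope i u - slope i u' = slope i (u - u')"
  by (simp add: slope_def sum_subtractf left_diff_distrib)

text \<open>Homogeneity with factor \<open>2 ^ q\<close> makes slopes at scales a fixed distance
  \<open>q\<close> apart agree in the limit. A slow drift of the slopes is not excluded by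
  this.\<close>

lemma quot_unit_refine: "(\<lambda>i. quot (unit_vec c) (i + q) z - quot (unit_vec c) i z) \<longlonglongrightarrow> 0"
proof -
  have "(\<lambda>i. ray (\<lambda>c'. 2 ^ q * unit_vec c c') (i + q) - of_int (2 ^ q) * ray (unit_vec c) (i + q)) \<longlonglongrightarrow> 0"
    by (rule LIMSEQ_ignore_initial_segment[OF ray_int_mult])
  moreover have "ray (\<lambda>c'. 2 ^ q * unit_vec c c') (i + q) = 2 ^ q * ray (unit_vec c) i" for i
  proof -
    have "lattice_vec (i + q) (\<lambda>c'. 2 ^ q * unit_vec c c') = (lattice_vec i (unit_vec c) :: (real, 'n) vec)"
      by (simp add: lattice_vec_def vec_eq_iff power_add)
    then show ?thesis by (simp add: ray_def power_add)
  qed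
  ultimately have "(\<lambda>i. 2 ^ q * (ray (unit_vec c) i - ray (unit_vec c) (i + q))) \<longlonglongrightarrow> 0"
    by (simp add: right_diff_distrib)
  from tendsto_mult_left[OF this, of "- 1 / 2 ^ q"] show ?thesis by (simp add: ray_unit)
qed

lemma blow_dyadic: "(\<lambda>i. blow z i (lattice_vec q w) - slope i (lattice_vec q w)) \<longlonglongrightarrow> 0"
proof -
  have "(\<lambda>i. (1 / 2 ^ q) * (ray w (i + q) - (\<Sum>c\<in>UNIV. of_int (w c) * ray (unit_vec c) (i + q)))) \<longlonglongrightarrow> (1 / 2 ^ q) * 0"
    by (intro tendsto_mult_left LIMSEQ_ignore_initial_segment[OF ray_linear])
  moreover have "(\<lambda>i. \<Sum>c\<in>UNIV. of_int (w c) / 2 ^ q * (quot (unit_vec c) (i + q) z - quot (unit_vec c) i z)) \<longlonglongrightarrow>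
      (\<Sum>c\<in>(UNIV :: 'n set). of_int (w c) / 2 ^ q * 0)"
    by (intro tendsto_sum tendsto_mult_left quot_unit_refine)
  ultimately have lim: "(\<lambda>i. (1 / 2 ^ q) * (ray w (i + q) - (\<Sum>c\<in>UNIV. of_int (w c) * ray (unit_vec c) (i + q))) +
      (\<Sum>c\<in>UNIV. of_int (w c) / 2 ^ q * (quot (unit_vec c) (i + q) z - quot (unit_vec c) i z))) \<longlonglongrightarrow> 0"
    using tendsto_add by fastforce
  have "(1 / 2 ^ q) * (ray w (i + q) - (\<Sum>c\<in>UNIV. of_int (w c) * ray (unit_vec c) (i + q))) +
      (\<Sum>c\<in>UNIV. of_int (w c) / 2 ^ q * (quot (unit_vec c) (i + q) z - quot (unit_vec c) i z)) =
      blow z i (lattice_vec q w) - slope i (lattice_vec q w)" for i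
  proof -
    have "(1 / 2 ^ q) * (\<Sum>c\<in>UNIV. of_int (w c) * ray (unit_vec c) (i + q)) =
      (\<Sum>c\<in>UNIV. of_int (w c) / 2 ^ q * quot (unit_vec c) (i + q) z)"
      by (simp add: sum_distrib_left ray_unit)
    moreover have "(1 / 2 ^ q) * ray w (i + q) = blow z i (lattice_vec q w)"
      by (simp add: ray_def blow_lattice_vec power_add)
    moreover have "slope i (lattice_vec q w) = (\<Sum>c\<in>UNIV. of_int (w c) / 2 ^ q * quot (unit_vec c) i z)"
      by (simp add: slope_def lattice_vec_def)
    ultimately show ?thesis by (simp only: right_diff_distrib sum_subtractf)
  qed
  with lim show ?thesis by simp
qed

text \<open>A finite net turns pointwise into uniform convergence: only finitely many points of
  denominator \<open>2 ^ q\<close> lie in the cube of radius \<open>R\<close>, and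
  \<open>blow\<close> and \<open>slope\<close> vary in a Lipschitz way with constants independent of
  \<open>i\<close>.\<close>

lemma blow_uniform:
  assumes "\<epsilon> > 0"
  shows "\<forall>\<^sub>F i in sequentially. \<forall>u. (\<forall>c. \<bar>u $ c\<bar> \<le> real R) \<longrightarrow> \<bar>blow z i u - slope i u\<bar> \<le> \<epsilon>"
proof -
  define n where "n = real CARD('n)"
  \<comment> \<open>Moving from \<open>u\<close> to the net will cost at most
    \<open>\<epsilon> / 4\<close> for \<open>blow\<close> and for \<open>slope\<close> each; the
    \<open>+ 1\<close> keeps the denominator positive when \<open>L = 0\<close>.\<close>
  obtain q :: nat where "(1 / 2) ^ q < \<epsilon> / (4 * (L * n + 1))"
    using real_arch_pow_inv[of "\<epsilon> / (4 * (L * n + 1))" "1 / 2"] assms L_nonneg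
    by (auto simp: n_def add_nonneg_pos)
  then have q: "2 * (L * n) / 2 ^ q \<le> \<epsilon> / 2"
  proof -
    assume *: "(1 / 2) ^ q < \<epsilon> / (4 * (L * n + 1))"
    have Ln: "0 \<le> L * n" using L_nonneg by (simp add: n_def)
    have "2 * (L * n) * (1 / 2) ^ q \<le> 2 * (L * n) * (\<epsilon> / (4 * (L * n + 1)))"
      using * Ln by (intro mult_left_mono) auto
    also have "\<dots> \<le> \<epsilon> / 2" using Ln assms by (simp add: field_simps)
    finally show ?thesis by (simp add: power_one_over)
  qed
  define W where "W = (\<Pi>\<^sub>E c\<in>(UNIV :: 'n set). {- int (R * 2 ^ q) .. int (R * 2 ^ q)})"
  have fin: "finite W" unfolding W_def by (intro finite_PiE) auto
  have "\<forall>\<^sub>F i in sequentially. \<forall>w\<in>W. \<bar>blow z i (lattice_vec q w) - slope i (lattice_vec q w)\<bar> < \<epsilon> / 2"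
    using tendstoD[OF blow_dyadic, of "\<epsilon> / 2" q] assms
    by (intro eventually_ball_finite[OF fin]) (auto simp: dist_real_def)
  then show ?thesis
  proof eventually_elim
    case (elim i)
    show ?case
    proof (intro allI impI)
      fix u :: "(real, 'n) vec" assume u: "\<forall>c. \<bar>u $ c\<bar> \<le> real R"
      define w where "w c = \<lfloor>u $ c * 2 ^ q\<rfloor>" for c
      have "w \<in> W"
      proof -
        have "- int (R * 2 ^ q) \<le> w c \<and> w c \<le> int (R * 2 ^ q)" for c
        proof -
          define X where "X = u $ c * 2 ^ q"
          have "- real R * 2 ^ q \<le> X" "X \<le> real R * 2 ^ q"
            using u[rule_format, of c] unfolding X_def by (intro mult_right_mono; simp add: abs_le_iff)+
          then show ?thesis unfolding w_def X_def[symmetric] by (simp add: le_floor_iff floor_le_iff)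
        qed
        then show ?thesis by (simp add: W_def PiE_UNIV_domain)
      qed
      have close: "\<bar>(u - lattice_vec q w) $ c\<bar> \<le> 1 / 2 ^ q" for c
      proof -
        have "\<bar>u $ c * 2 ^ q - of_int (w c)\<bar> \<le> 1" unfolding w_def by linarith
        then have "\<bar>u $ c * 2 ^ q - of_int (w c)\<bar> / 2 ^ q \<le> 1 / 2 ^ q" by (simp add: divide_right_mono)
        moreover have "\<bar>(u - lattice_vec q w) $ c\<bar> = \<bar>u $ c * 2 ^ q - of_int (w c)\<bar> / 2 ^ q"
        proof -
          have "(u - lattice_vec q w) $ c = (u $ c * 2 ^ q - of_int (w c)) / 2 ^ q"
            by (simp add: lattice_vec_def diff_divide_distrib)
          then show ?thesis by (simp only: abs_divide) simp
        qed
        ultimately show ?thesis by simp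
      qed
      have sum: "(\<Sum>c\<in>UNIV. \<bar>(u - lattice_vec q w) $ c\<bar>) \<le> n / 2 ^ q"
        using sum_mono[of UNIV "\<lambda>c. \<bar>(u - lattice_vec q w) $ c\<bar>" "\<lambda>_. 1 / 2 ^ q"] close by (simp add: n_def)
      have "\<bar>blow z i u - blow z i (lattice_vec q w)\<bar> \<le> L * norm (u - lattice_vec q w)" by (rule blow_lipschitz)
      also have "\<dots> \<le> L * (n / 2 ^ q)"
        by (intro mult_left_mono L_nonneg order_trans[OF norm_le_l1_cart sum])
      finally have 1: "\<bar>blow z i u - blow z i (lattice_vec q w)\<bar> \<le> L * (n / 2 ^ q)" .
      have "\<bar>slope i u - slope i (lattice_vec q w)\<bar> \<le> L * (n / 2 ^ q)"
        unfolding slope_diff by (rule order_trans[OF slope_bound mult_left_mono[OF sum L_nonneg]])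
      moreover have "\<bar>blow z i (lattice_vec q w) - slope i (lattice_vec q w)\<bar> < \<epsilon> / 2"
        using elim \<open>w \<in> W\<close> by blast
      moreover have "L * (n / 2 ^ q) + L * (n / 2 ^ q) \<le> \<epsilon> / 2" using q by simp
      ultimately show "\<bar>blow z i u - slope i u\<bar> \<le> \<epsilon>" using 1 by linarith
    qed
  qed
qed

lemma differentiable_of_slopes:
  assumes T: "\<And>c. (\<lambda>i. quot (unit_vec c) i z) \<longlonglongrightarrow> T c"
  shows "g differentiable (at z)"
proof -
  define F where "F u = (\<Sum>c\<in>UNIV. u $ c * T c)" for u :: "(real, 'n) vec"
  have bl: "bounded_linear F"
    unfolding F_def by (intro bounded_linear_sum bounded_linear_mult_const bounded_linear_vec_nth)
  have conv: "\<forall>\<^sub>F i in sequentially. \<forall>u. norm u \<le> 1 \<longrightarrow> \<bar>blow z i u - F u\<bar> \<le> \<epsilon>" if "\<epsilon> > 0" for \<epsilon>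
  proof -
    have "(\<lambda>i. \<Sum>c\<in>UNIV. \<bar>quot (unit_vec c) i z - T c\<bar>) \<longlonglongrightarrow> (\<Sum>c\<in>(UNIV :: 'n set). \<bar>T c - T c\<bar>)"
      by (intro tendsto_sum tendsto_rabs tendsto_diff T tendsto_const)
    then have "(\<lambda>i. \<Sum>c\<in>UNIV. \<bar>quot (unit_vec c) i z - T c\<bar>) \<longlonglongrightarrow> 0" by simp
    then have "\<forall>\<^sub>F i in sequentially. (\<Sum>c\<in>UNIV. \<bar>quot (unit_vec c) i z - T c\<bar>) < \<epsilon> / 2"
      using that by (intro order_tendstoD(2)) auto
    moreover have "\<forall>\<^sub>F i in sequentially. \<forall>u. (\<forall>c. \<bar>u $ c\<bar> \<le> real 1) \<longrightarrow> \<bar>blow z i u - slope i u\<bar> \<le> \<epsilon> / 2"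
      using that by (intro blow_uniform) auto
    ultimately show ?thesis
    proof eventually_elim
      case (elim i)
      show ?case
      proof (intro allI impI)
        fix u :: "(real, 'n) vec" assume u: "norm u \<le> 1"
        have uc: "\<bar>u $ c\<bar> \<le> 1" for c using component_le_norm_cart[of u c] u by linarith
        have "\<bar>slope i u - F u\<bar> = \<bar>\<Sum>c\<in>UNIV. u $ c * (quot (unit_vec c) i z - T c)\<bar>"
          by (simp add: slope_def F_def sum_subtractf right_diff_distrib)
        also have "\<dots> \<le> (\<Sum>c\<in>UNIV. \<bar>quot (unit_vec c) i z - T c\<bar>)"
        proof (rule order_trans[OF sum_abs sum_mono])
          fix c show "\<bar>u $ c * (quot (unit_vec c) i z - T c)\<bar> \<le> \<bar>quot (unit_vec c) i z - T c\<bar>"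
            using mult_right_mono[OF uc[of c], of "\<bar>quot (unit_vec c) i z - T c\<bar>"] by (simp add: abs_mult)
        qed
        finally have "\<bar>slope i u - F u\<bar> < \<epsilon> / 2" using elim(1) by linarith
        moreover have "\<bar>blow z i u - slope i u\<bar> \<le> \<epsilon> / 2" using elim(2) uc by simp
        ultimately show "\<bar>blow z i u - F u\<bar> \<le> \<epsilon>" by linarith
      qed
    qed
  qed
  have "\<exists>d>0. \<forall>y. norm (y - z) < d \<longrightarrow> norm (g y - g z - F (y - z)) \<le> \<epsilon> * norm (y - z)" if \<epsilon>: "\<epsilon> > 0" for \<epsilon>
  proof -
    obtain i0 where i0: "\<And>i u. i \<ge> i0 \<Longrightarrow> norm u \<le> 1 \<Longrightarrow> \<bar>blow z i u - F u\<bar> \<le> \<epsilon> / 2"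
      using conv[OF half_gt_zero[OF \<epsilon>]] unfolding eventually_sequentially by blast
    show ?thesis
    proof (intro exI[of _ "(1 / 2) ^ i0"] conjI allI impI)
      fix y assume y: "norm (y - z) < (1 / 2) ^ i0"
      show "norm (g y - g z - F (y - z)) \<le> \<epsilon> * norm (y - z)"
      proof (cases "y = z")
        case False
        define h where "h = y - z"
        have h: "norm h > 0" using False by (simp add: h_def)
        \<comment> \<open>The scale of \<open>h\<close>: with \<open>j = Suc i\<close> one has
          \<open>2 ^ -j < norm h \<le> 2 ^ -i\<close>, so \<open>2 ^ i *\<^sub>R h\<close> lies in
          the unit ball. Since \<open>2 ^ -i\<close> may be almost twice \<open>norm h\<close>, the
          blow-up was approximated within \<open>\<epsilon> / 2\<close>.\<close>
        define j where "j = (LEAST j. (1 / 2) ^ j < norm h)"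
        obtain j' :: nat where "(1 / 2) ^ j' < norm h" using real_arch_pow_inv[OF h, of "1 / 2"] by auto
        then have j: "(1 / 2) ^ j < norm h" unfolding j_def by (rule LeastI)
        have "i0 < j"
        proof (rule ccontr)
          assume "\<not> i0 < j"
          then have "(1 / 2 :: real) ^ i0 \<le> (1 / 2) ^ j" by (intro power_decreasing) auto
          with j y show False by (simp add: h_def)
        qed
        then obtain i where i: "j = Suc i" "i0 \<le> i" by (cases j) auto
        have le: "norm h \<le> (1 / 2) ^ i"
          using not_less_Least[of i "\<lambda>j. (1 / 2) ^ j < norm h"] i(1) unfolding j_def[symmetric] by simp
        define u where "u = 2 ^ i *\<^sub>R h"
        have hu: "h = (1 / 2 ^ i) *\<^sub>R u" by (simp add: u_def)
        have "norm u \<le> 1" using le by (simp add: u_def power_one_over field_simps)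
        from i0[OF i(2) this] have "\<bar>blow z i u - F u\<bar> / 2 ^ i \<le> \<epsilon> / 2 / 2 ^ i" by (rule divide_right_mono) simp
        moreover have "g y - g z - F (y - z) = (blow z i u - F u) / 2 ^ i"
        proof -
          have "F h = F u / 2 ^ i" unfolding hu linear_cmul[OF bounded_linear.linear[OF bl]] by simp
          moreover have "g y - g z = blow z i u / 2 ^ i" unfolding blow_def hu[symmetric] by (simp add: h_def)
          ultimately show ?thesis by (simp add: diff_divide_distrib h_def)
        qed
        moreover have "\<epsilon> / 2 / 2 ^ i = \<epsilon> * (1 / 2) ^ j" by (simp add: i(1) power_one_over)
        moreover have "\<epsilon> * (1 / 2) ^ j \<le> \<epsilon> * norm h" using j \<epsilon> by (intro mult_left_mono) auto
        ultimately show ?thesis by (simp add: h_def[symmetric] abs_divide)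
      qed (simp add: linear_0[OF bounded_linear.linear[OF bl]])
    qed simp
  qed
  with bl have "(g has_derivative F) (at z)" unfolding has_derivative_at_alt by blast
  then show ?thesis unfolding differentiable_def by blast
qed

end

end

section \<open>Differentiability at computably random points\<close>

lemma nbit_prefix_val: "q < k \<Longrightarrow> nbit (prefix_val Z k) q = of_bool (Z q)"
proof (induction k)
  case (Suc k)
  show ?case
  proof (cases "q = k")
    case True
    then show ?thesis using nbit_low[OF prefix_val_less[of Z k]] by (simp add: prefix_val_Suc)
  next
    case False
    with Suc have "nbit (prefix_val Z k) q = of_bool (Z q)" "q < k" by auto
    then show ?thesis using nbit_add_high[of q k "prefix_val Z k" "of_bool (Z k)"]
      by (simp add: prefix_val_Suc mult.commute)
  qed
qed simp

lemma grid_num_prefix_val: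
  fixes Z :: "'n::{finite,linorder} \<Rightarrow> nat \<Rightarrow> bool"
  assumes "CARD('n) * K \<le> k"
  shows "real (grid_num K (prefix_val (interleave Z) k) c) / 2 ^ K = (\<Sum>q<K. of_bool (Z c q) / 2 ^ Suc q)"
  using assms
proof (induction K)
  case (Suc K)
  have lt: "K * CARD('n) + coord_index c < k"
    using index_bound[of K "Suc K" c] Suc.prems by linarith
  have "interleave Z (K * CARD('n) + coord_index c) = Z c K"
    using coord_index[of c] by (simp add: interleave_def)
  with nbit_prefix_val[OF lt] have "nbit (prefix_val (interleave Z) k) (K * CARD('n) + coord_index c) = of_bool (Z c K)"
    by simp
  moreover have "CARD('n) * K \<le> k" using Suc.prems by simp
  ultimately show ?case using Suc.IH by (simp add: add_divide_distrib)
qed simp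

lemma binary_real_prefix: "\<bar>binary_real A - (\<Sum>q<K. of_bool (A q) / 2 ^ Suc q)\<bar> \<le> 1 / 2 ^ K"
proof -
  have geo: "(\<lambda>q. (1 / 2) ^ Suc (q + K)) sums (1 / 2 ^ K :: real)"
    using sums_mult[OF power_half_series, of "(1 / 2) ^ K"] by (simp add: power_add power_one_over mult_ac)
  have le: "of_bool (A q) / 2 ^ Suc q \<le> (1 / 2 :: real) ^ Suc q" for q
    by (simp add: power_one_over)
  have sum: "summable (\<lambda>q. of_bool (A q) / 2 ^ Suc q :: real)"
    by (rule summable_comparison_test'[OF sums_summable[OF power_half_series]]) (use le in simp)
  have "binary_real A - (\<Sum>q<K. of_bool (A q) / 2 ^ Suc q) = (\<Sum>q. of_bool (A (q + K)) / 2 ^ Suc (q + K))"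
    unfolding binary_real_def using suminf_split_initial_segment[OF sum, of K] by simp
  moreover have "(\<Sum>q. of_bool (A (q + K)) / 2 ^ Suc (q + K)) \<le> (1 / 2 ^ K :: real)"
    unfolding sums_unique[OF geo]
    by (rule suminf_le[OF le summable_ignore_initial_segment[OF sum] sums_summable[OF geo]])
  moreover have "0 \<le> (\<Sum>q. of_bool (A (q + K)) / 2 ^ Suc (q + K) :: real)"
    by (intro suminf_nonneg summable_ignore_initial_segment[OF sum]) auto
  ultimately show ?thesis by simp
qed

text \<open>Prescribing \<open>CARD('n) * J\<close> interleaved digits fixes \<open>J\<close> digits
  of each coordinate; the tails of \<open>z\<close> and of the grid point contribute at most
  \<open>1 / 2 ^ J\<close> each.\<close>

lemma grid_pt_near:
  fixes z :: "real ^ 'n::{finite,linorder}"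
  assumes "CARD('n) * J \<le> k" "J \<le> K" and z: "\<And>c. z $ c = binary_real (Z c)"
  shows "\<bar>(grid_pt K (prefix_val (interleave Z) k + 2 ^ k * u) - z) $ c\<bar> \<le> 2 / 2 ^ J"
proof -
  let ?v = "prefix_val (interleave Z) k"
  have "grid_pt J (?v + 2 ^ k * u) $ c = (\<Sum>q<J. of_bool (Z c q) / 2 ^ Suc q)"
    using grid_num_prefix_val[OF assms(1), of Z c] by (simp add: grid_pt_def grid_num_add_high[OF assms(1)])
  with binary_real_prefix[of "Z c" J] have "\<bar>z $ c - grid_pt J (?v + 2 ^ k * u) $ c\<bar> \<le> 1 / 2 ^ J"
    by (simp add: z)
  with grid_pt_refine[OF assms(2), of "?v + 2 ^ k * u" c] show ?thesis by simp
qed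

context lipschitz_map
begin

text \<open>The boundary terms form a geometric series; writing \<open>1 / 2 ^ m\<close> as
  \<open>2 / 2 ^ m - 2 / 2 ^ Suc m\<close> makes the induction telescope. Up to the common factor
  the sum stays below \<open>2 / 2 ^ N\<close> however large \<open>M\<close> is.\<close>

lemma quot_avg_telescope:
  assumes "N \<le> M" "M \<le> K" "i \<le> CARD('n) * l" "l \<le> K" "v < 2 ^ i"
  shows "\<bar>grid_avg K i v (quot e M) - grid_avg K i v (quot e N)\<bar> \<le> L * (l1 e)\<^sup>2 * 2 ^ l * (2 / 2 ^ N - 2 / 2 ^ M)"
proof -
  define X where "X = L * (l1 e)\<^sup>2 * 2 ^ l"
  define r where "r m = 2 / (2::real) ^ m" for m :: nat
  have r: "1 / 2 ^ m = r m - r (Suc m)" for m by (simp add: r_def)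
  have "\<bar>grid_avg K i v (quot e M) - grid_avg K i v (quot e N)\<bar> \<le> X * (r N - r M)"
    using assms(1,2)
  proof (induction M rule: dec_induct)
    case (step M)
    have "\<bar>grid_avg K i v (quot e (Suc M)) - grid_avg K i v (quot e M)\<bar> \<le> X * (1 / 2 ^ M)"
      using quot_avg_step[OF step.prems assms(3-5), of e] unfolding X_def by simp
    then have "\<bar>grid_avg K i v (quot e (Suc M)) - grid_avg K i v (quot e M)\<bar> \<le> X * (r M - r (Suc M))"
      unfolding r .
    moreover have "\<bar>grid_avg K i v (quot e M) - grid_avg K i v (quot e N)\<bar> \<le> X * (r N - r M)"
      using step.IH step.prems by simp
    moreover have "X * (r N - r (Suc M)) = X * (r M - r (Suc M)) + X * (r N - r M)"
      by (simp add: right_diff_distrib)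
    ultimately show ?case by linarith
  qed simp
  then show ?thesis by (simp only: X_def r_def)
qed

text \<open>The averaged quotient has a step far smaller than the side \<open>2 ^ -J\<close> of the
  box around \<open>z\<close>, too small for the affinity at \<open>z\<close> to control it
  pointwise. A scale \<open>J + q\<close> with \<open>q\<close> fixed bridges the gap: from there to
  the finer scale the averages change by at most \<open>2 * L / 2 ^ q\<close>, and at scale
  \<open>J + q\<close> the quotient at every point of the box is close to the slope, because
  blow-ups are nearly linear on bounded sets.\<close>

lemma slope_eq_grid_avg:
  fixes z :: "(real, 'n) vec"
  assumes flat: "\<And>b e. (\<lambda>i. bend b e i z) \<longlonglongrightarrow> 0"
    and z: "\<And>c. z $ c = binary_real (Z c)"
  shows "(\<lambda>J. grid_avg (4 * (CARD('n) * J)) (CARD('n) * J) (prefix_val (interleave Z) (CARD('n) * J))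
      (quot (unit_vec c) (2 * (CARD('n) * J))) - quot (unit_vec c) J z) \<longlonglongrightarrow> 0"
    (is "?X \<longlonglongrightarrow> 0")
proof (rule LIMSEQ_I)
  fix \<epsilon> :: real assume \<epsilon>: "0 < \<epsilon>"
  let ?e = "unit_vec c :: 'n \<Rightarrow> int"
  have n: "1 \<le> CARD('n)" using zero_less_card_finite[where 'a = 'n] by linarith
  obtain q :: nat where q0: "(1 / 2) ^ q < \<epsilon> / (4 * (L + 1))"
    using real_arch_pow_inv[of "\<epsilon> / (4 * (L + 1))" "1 / 2"] \<epsilon> L_nonneg by (auto simp: add_nonneg_pos)
  have q: "2 * L * (1 / 2 ^ q) < \<epsilon> / 2"
  proof -
    have "2 * L * (1 / 2) ^ q \<le> 2 * L * (\<epsilon> / (4 * (L + 1)))"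
      using q0 L_nonneg by (intro mult_left_mono) auto
    also have "\<dots> < \<epsilon> / 2" using L_nonneg \<epsilon> by (simp add: field_simps)
    finally show ?thesis by (simp add: power_one_over)
  qed
  \<comment> \<open>The quotient of scale \<open>J + q\<close> takes two values of the blow-up and
    magnifies their errors by \<open>2 ^ q\<close>, for a total of
    \<open>2 ^ q * (2 * \<eta>) = \<epsilon> / 2\<close>.\<close>
  define \<eta> where "\<eta> = \<epsilon> / (4 * 2 ^ q)"
  have \<eta>: "0 < \<eta>" using \<epsilon> by (simp add: \<eta>_def)
  \<comment> \<open>Radius 3: in the blow-up, points of the box have coordinates of size at most 2,
    and the step \<open>e / 2 ^ q\<close> adds at most 1.\<close>
  obtain J0 where J0: "\<And>J u. J \<ge> J0 \<Longrightarrow> (\<And>c. \<bar>u $ c\<bar> \<le> real 3) \<Longrightarrow> \<bar>blow z J u - slope z J u\<bar> \<le> \<eta>"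
    using blow_uniform[OF flat \<eta>, of 3] unfolding eventually_sequentially by blast
  show "\<exists>J0. \<forall>J\<ge>J0. norm (?X J - 0) < \<epsilon>"
  proof (intro exI[of _ "max J0 q"] allI impI)
    fix J assume J: "max J0 q \<le> J"
    define k where "k = CARD('n) * J"
    have kJ: "J \<le> k" using mult_le_mono1[OF n, of J] by (simp add: k_def)
    have Jq: "J + q \<le> 2 * k" "k \<le> CARD('n) * J" "J \<le> 4 * k"
      using J kJ by (linarith | simp add: k_def)+
    let ?v = "prefix_val (interleave Z) k"
    have "\<bar>grid_avg (4 * k) k ?v (quot ?e (2 * k)) - grid_avg (4 * k) k ?v (quot ?e (J + q))\<bar> \<le>
       L * (l1 ?e)\<^sup>2 * 2 ^ J * (2 / 2 ^ (J + q) - 2 / 2 ^ (2 * k))"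
      using Jq by (intro quot_avg_telescope prefix_val_less) auto
    also have "\<dots> \<le> L * (l1 ?e)\<^sup>2 * 2 ^ J * (2 / 2 ^ (J + q))"
      using L_nonneg by (intro mult_left_mono) auto
    also have "\<dots> = 2 * L * (1 / 2 ^ q)" by (simp add: l1_unit_vec power_add)
    finally have 1: "\<bar>grid_avg (4 * k) k ?v (quot ?e (2 * k)) - grid_avg (4 * k) k ?v (quot ?e (J + q))\<bar> < \<epsilon> / 2"
      using q by linarith
    have pt: "\<bar>quot ?e (J + q) x - quot ?e J z\<bar> \<le> \<epsilon> / 2" if x: "\<And>c. \<bar>(x - z) $ c\<bar> \<le> 2 / 2 ^ J" for x
    proof -
      define u where "u = 2 ^ J *\<^sub>R (x - z)"
      have u: "\<bar>u $ c\<bar> \<le> 2" for c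
        using mult_left_mono[OF x[of c], of "2 ^ J"] by (simp add: u_def abs_mult)
      have lv: "\<bar>lattice_vec q ?e $ c\<bar> \<le> 1" for c
        by (simp add: lattice_vec_def unit_vec_def)
      have u': "\<bar>(u + lattice_vec q ?e) $ c\<bar> \<le> 3" for c
        using u[of c] abs_triangle_ineq[of "u $ c" "lattice_vec q ?e $ c"] unfolding vector_add_component
        using lv[of c] by linarith
      have "slope z J (u + lattice_vec q ?e) - slope z J u = quot ?e J z / 2 ^ q"
        unfolding slope_diff[OF flat] by (simp add: slope_def[OF flat] lattice_vec_def unit_vec_def of_bool_def if_distrib if_distribR cong: if_cong)
      moreover have "\<bar>blow z J (u + lattice_vec q ?e) - slope z J (u + lattice_vec q ?e)\<bar> \<le> \<eta>"
        "\<bar>blow z J u - slope z J u\<bar> \<le> \<eta>"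
        using J u u' by (auto intro!: J0 order_trans[OF u])
      ultimately have "\<bar>(blow z J (u + lattice_vec q ?e) - blow z J u) - quot ?e J z / 2 ^ q\<bar> \<le> 2 * \<eta>"
        by linarith
      then have "2 ^ q * \<bar>(blow z J (u + lattice_vec q ?e) - blow z J u) - quot ?e J z / 2 ^ q\<bar> \<le> 2 ^ q * (2 * \<eta>)"
        by (rule mult_left_mono) simp
      moreover have "quot ?e (J + q) x - quot ?e J z =
          2 ^ q * ((blow z J (u + lattice_vec q ?e) - blow z J u) - quot ?e J z / 2 ^ q)"
        unfolding quot_translate[of ?e J q x z] u_def by (simp add: right_diff_distrib)
      moreover have "2 ^ q * (2 * \<eta>) = \<epsilon> / 2" by (simp add: \<eta>_def)
      ultimately show ?thesis by (simp only: abs_mult) simp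
    qed
    have "\<bar>grid_avg (4 * k) k ?v (\<lambda>x. quot ?e (J + q) x - quot ?e J z)\<bar> \<le> \<epsilon> / 2"
    proof (rule grid_avg_abs_le, rule pt)
      fix u c
      show "\<bar>(grid_pt (4 * k) (?v + 2 ^ k * u) - z) $ c\<bar> \<le> 2 / 2 ^ J"
        by (rule grid_pt_near[OF _ _ z]) (use kJ in \<open>auto simp: k_def\<close>)
    qed
    then have "\<bar>grid_avg (4 * k) k ?v (quot ?e (J + q)) - quot ?e J z\<bar> \<le> \<epsilon> / 2"
      by (simp add: grid_avg_diff grid_avg_const)
    with 1 show "norm (?X J - 0) < \<epsilon>" unfolding k_def real_norm_def diff_0_right by linarith
  qed
qed

end

context approximable_map
begin

context
  fixes Z :: "'n \<Rightarrow> nat \<Rightarrow> bool" and z :: "(real, 'n) vec"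
  assumes z: "\<And>c. z $ c = binary_real (Z c)" and random: "computably_random_seq (interleave Z)"
begin

text \<open>The bound on box averages of the energy has to be carried to \<open>z\<close> itself. On
  a box of side \<open>2 ^ -J\<close> the \<open>bend\<close> terms with \<open>j < J\<close> are
  comparable to their values at \<open>z\<close>, and these suffice: the finer ones enter as squares
  and may be dropped in a lower bound for the energy.\<close>

lemma bend_tendsto_zero: "(\<lambda>i. bend b e i z) \<longlonglongrightarrow> 0"
proof -
  define M d A where "M = (L * l1 e)\<^sup>2" and "d = 12 * (L * l1 e + 4)" and "A = rat_avg CARD('n) (rat_energy b e)"
  have d: "0 \<le> d" using L_nonneg l1_nonneg[of e] by (simp add: d_def)
  have sq: "(quot e N x)\<^sup>2 \<le> M" for N x
    unfolding M_def using quot_bound[of e N x] by (intro abs_le_square_iff[THEN iffD1]) auto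
  have approx: "\<bar>real_of_rat (A i v) - grid_avg (4 * i) i v (energy b e (2 * i))\<bar> \<le> d / 2 ^ i" for i v
    unfolding A_def d_def by (rule rat_avg_approx, rule rat_energy_approx)
  have "approx_martingale (2 * d + 2 * (M * (2 * l1 b + l1 e)) + 12 * L\<^sup>2 * l1 e * CARD('n)) A"
    by (rule approx_martingale_grid[where \<psi> = "energy b e", OF energy_lipschitz _ _ approx])
       (auto simp: M_def l1_nonneg intro!: energy_avg_step)
  moreover have "computable_rat 2 (\<lambda>xs. A (xs ! 0) (xs ! 1))"
    unfolding A_def by (rule computable_rat_avg[OF computable_rat_energy])
  moreover have "- (M + d) \<le> real_of_rat (A i v)" for i v
  proof -
    have "- M \<le> energy b e N x" for N x
      using sq[of N x] sum_nonneg[of "{..<N}" "\<lambda>i. (bend b e i x)\<^sup>2"] by (simp add: energy_def)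
    then have "grid_avg (4 * i) i v (\<lambda>_ :: (real, 'n) vec. - M) \<le> grid_avg (4 * i) i v (energy b e (2 * i))"
      by (intro grid_avg_mono) auto
    moreover have "d / 2 ^ i \<le> d" using d by (simp add: divide_le_eq mult_le_cancel_left1)
    ultimately show ?thesis using approx[of i v] unfolding grid_avg_const by linarith
  qed
  ultimately obtain C where C: "\<And>k. real_of_rat (A k (prefix_val (interleave Z) k)) \<le> C"
    using approx_martingale_bounded[OF _ _ _ random] by blast
  have bound: "(\<Sum>j<J. (bend b e j z)\<^sup>2) \<le> C + d + M + 16 * L\<^sup>2 * l1 e * CARD('n)" for J
  proof -
    define k where "k = CARD('n) * J"
    have n: "1 \<le> CARD('n)" using zero_less_card_finite[where 'a = 'n] by linarith
    have kJ: "J \<le> k" using mult_le_mono1[OF n, of J] by (simp add: k_def)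
    let ?v = "prefix_val (interleave Z) k"
    \<comment> \<open>Over \<open>j < J\<close> the Lipschitz constants of the squares sum to at
      most \<open>8 * L\<^sup>2 * l1 e * 2 ^ J\<close>, and the distance to \<open>z\<close> is at
      most \<open>CARD('n) * (2 / 2 ^ J)\<close>: hence the 16. \<open>M\<close> pays for the
      squared quotient.\<close>
    let ?c = "(\<Sum>j<J. (bend b e j z)\<^sup>2) - 16 * L\<^sup>2 * l1 e * CARD('n) - M"
    have pt: "?c \<le> energy b e (2 * k) x" if x: "\<And>c. \<bar>(x - z) $ c\<bar> \<le> 2 / 2 ^ J" for x
    proof -
      have "norm (x - z) \<le> (\<Sum>c\<in>UNIV. \<bar>(x - z) $ c\<bar>)" by (rule norm_le_l1_cart)
      also have "\<dots> \<le> (\<Sum>c\<in>(UNIV :: 'n set). 2 / 2 ^ J)" by (intro sum_mono x)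
      finally have xz: "norm (x - z) \<le> CARD('n) * (2 / 2 ^ J)" by simp
      have "(bend b e j z)\<^sup>2 - (bend b e j x)\<^sup>2 \<le> 8 * L\<^sup>2 * l1 e * (CARD('n) * (2 / 2 ^ J)) * 2 ^ j" for j
      proof -
        have "(bend b e j z)\<^sup>2 - (bend b e j x)\<^sup>2 \<le> 8 * L\<^sup>2 * l1 e * 2 ^ j * norm (x - z)"
          using bend_square_lipschitz[of b e j x z] by (simp add: abs_le_iff)
        also have "\<dots> \<le> 8 * L\<^sup>2 * l1 e * 2 ^ j * (CARD('n) * (2 / 2 ^ J))"
          by (intro mult_left_mono xz) (simp add: l1_nonneg)
        finally show ?thesis by (simp add: mult_ac)
      qed
      then have "(\<Sum>j<J. (bend b e j z)\<^sup>2 - (bend b e j x)\<^sup>2) \<le> (\<Sum>j<J. 8 * L\<^sup>2 * l1 e * (CARD('n) * (2 / 2 ^ J)) * 2 ^ j)"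
        by (rule sum_mono)
      also have "\<dots> = 8 * L\<^sup>2 * l1 e * (CARD('n) * (2 / 2 ^ J)) * (\<Sum>j<J. 2 ^ j)"
        by (rule sum_distrib_left[symmetric])
      also have "\<dots> \<le> 8 * L\<^sup>2 * l1 e * (CARD('n) * (2 / 2 ^ J)) * 2 ^ J"
      proof (rule mult_left_mono)
        show "(\<Sum>j<J. (2::real) ^ j) \<le> 2 ^ J" by (simp add: geometric_sum)
      qed (simp add: l1_nonneg)
      also have "\<dots> = 16 * L\<^sup>2 * l1 e * CARD('n)" by simp
      finally have "(\<Sum>j<J. (bend b e j z)\<^sup>2) - (\<Sum>j<J. (bend b e j x)\<^sup>2) \<le> 16 * L\<^sup>2 * l1 e * CARD('n)"
        by (simp add: sum_subtractf)
      moreover have "(\<Sum>j<J. (bend b e j x)\<^sup>2) \<le> (\<Sum>j<2 * k. (bend b e j x)\<^sup>2)"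
        using kJ by (intro sum_mono2) auto
      ultimately show ?thesis using sq[of "2 * k" x] unfolding energy_def by linarith
    qed
    have "grid_avg (4 * k) k ?v (\<lambda>_ :: (real, 'n) vec. ?c) \<le> grid_avg (4 * k) k ?v (energy b e (2 * k))"
    proof (rule grid_avg_mono, rule pt)
      fix u c
      show "\<bar>(grid_pt (4 * k) (?v + 2 ^ k * u) - z) $ c\<bar> \<le> 2 / 2 ^ J"
        by (rule grid_pt_near[OF _ _ z]) (use kJ in \<open>auto simp: k_def\<close>)
    qed
    moreover have "d / 2 ^ k \<le> d" using d by (simp add: divide_le_eq mult_le_cancel_left1)
    ultimately show ?thesis using approx[of k ?v] C[of k] unfolding grid_avg_const by linarith
  qed
  have "summable (\<lambda>j. (bend b e j z)\<^sup>2)"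
    by (rule bounded_imp_summable[of _ "C + d + M + 16 * L\<^sup>2 * l1 e * CARD('n)"])
       (use bound[of "Suc _"] in \<open>auto simp: lessThan_Suc_atMost\<close>)
  then have "(\<lambda>j. (bend b e j z)\<^sup>2) \<longlonglongrightarrow> 0" by (rule summable_LIMSEQ_zero)
  from tendsto_real_sqrt[OF this] have "(\<lambda>j. \<bar>bend b e j z\<bar>) \<longlonglongrightarrow> 0" by simp
  then show ?thesis by (rule tendsto_rabs_zero_cancel)
qed

lemma quot_avg_convergent:
  "convergent (\<lambda>k. grid_avg (4 * k) k (prefix_val (interleave Z) k) (quot e (2 * k)))"
proof -
  define A where "A = rat_avg CARD('n) (rat_quot e)"
  have approx: "\<bar>real_of_rat (A i v) - grid_avg (4 * i) i v (quot e (2 * i))\<bar> \<le> 2 / 2 ^ i" for i v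
    unfolding A_def
  proof (rule rat_avg_approx)
    have "(2::real) ^ (2 * i) * 2 ^ i \<le> 2 ^ (6 * i)"
      unfolding power_add[symmetric] by (rule power_increasing) auto
    then have "2 * (2 ^ (2 * i) / 2 ^ (6 * i)) \<le> (2 / 2 ^ i :: real)" by (simp add: field_simps)
    then show "\<bar>real_of_rat (rat_quot e i w) - quot e (2 * i) (grid_pt (4 * i) w)\<bar> \<le> 2 / 2 ^ i" for w
      using rat_quot_approx[of e i w] by linarith
  qed
  have "approx_martingale (2 * 2 + 2 * (L * (l1 e)\<^sup>2) + 2 * L * CARD('n)) A"
    by (rule approx_martingale_grid[where \<psi> = "quot e", OF quot_lipschitz _ _ approx])
       (auto simp: L_nonneg intro!: quot_avg_step)
  moreover have "computable_rat 2 (\<lambda>xs. A (xs ! 0) (xs ! 1))"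
    unfolding A_def by (rule computable_rat_avg[OF computable_rat_quot])
  moreover have "\<bar>real_of_rat (A i v)\<bar> \<le> L * l1 e + 2" for i v
  proof -
    have "\<bar>grid_avg (4 * i) i v (quot e (2 * i))\<bar> \<le> L * l1 e" by (rule grid_avg_abs_le[OF quot_bound])
    moreover have "2 / 2 ^ i \<le> (2::real)" by (simp add: divide_le_eq)
    ultimately show ?thesis using approx[of i v] by linarith
  qed
  ultimately have "convergent (\<lambda>k. real_of_rat (A k (prefix_val (interleave Z) k)))"
    using approx_martingale_convergent[OF _ _ _ random] by blast
  then obtain l where l: "(\<lambda>k. real_of_rat (A k (prefix_val (interleave Z) k))) \<longlonglongrightarrow> l"
    by (auto simp: convergent_def)
  have half: "(\<lambda>k. 2 / 2 ^ k :: real) \<longlonglongrightarrow> 0"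
    using tendsto_mult_left[OF LIMSEQ_power_zero[of "1 / 2 :: real"], of 2] by (simp add: power_one_over)
  have "(\<lambda>k. grid_avg (4 * k) k (prefix_val (interleave Z) k) (quot e (2 * k)) -
      real_of_rat (A k (prefix_val (interleave Z) k))) \<longlonglongrightarrow> 0"
    by (rule Lim_null_comparison[OF always_eventually half])
       (use approx in \<open>auto simp: abs_minus_commute\<close>)
  from tendsto_add[OF this l] show ?thesis by (auto simp: convergent_def)
qed

lemma differentiable_at_random: "g differentiable (at z)"
proof (rule differentiable_of_slopes[OF bend_tendsto_zero])
  fix c :: 'n
  let ?m = "\<lambda>k. grid_avg (4 * k) k (prefix_val (interleave Z) k) (quot (unit_vec c) (2 * k))"
  \<comment> \<open>At length \<open>CARD('n) * J\<close> every coordinate has exactly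
    \<open>J\<close> digits, so the box is a cube of side \<open>2 ^ -J\<close>; the comparison with
    the slopes is made along these lengths.\<close>
  have sub: "strict_mono (\<lambda>J. CARD('n) * J)" by (simp add: strict_mono_def)
  have "?m \<longlonglongrightarrow> lim ?m" using quot_avg_convergent by (simp add: convergent_LIMSEQ_iff)
  from LIMSEQ_subseq_LIMSEQ[OF this sub] have "(\<lambda>J. ?m (CARD('n) * J)) \<longlonglongrightarrow> lim ?m"
    by (simp add: comp_def)
  from tendsto_diff[OF this slope_eq_grid_avg[OF bend_tendsto_zero z, of c]]
  show "(\<lambda>i. quot (unit_vec c) i z) \<longlonglongrightarrow> lim ?m" by simp
qed

end

end

section \<open>Extension from the cube by clamping\<close>

text \<open>Clamping does not increase distances and sends dyadic points to dyadic points of the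
  same denominator, so the extension of \<open>f\<close> stays Lipschitz and computable.\<close>

definition clamp_unit :: "real ^ 'n \<Rightarrow> real ^ 'n" where
  "clamp_unit x = (\<chi> c. max 0 (min 1 (x $ c)))"

lemma clamp_unit_in_cbox: "clamp_unit x \<in> cbox 0 1"
  by (simp add: clamp_unit_def mem_box_cart)

lemma clamp_unit_eq: "x \<in> cbox 0 1 \<Longrightarrow> clamp_unit x = x"
  by (simp add: clamp_unit_def mem_box_cart vec_eq_iff)

lemma norm_clamp_unit_diff_le: "norm (clamp_unit x - clamp_unit y) \<le> norm (x - y)"
  by (rule norm_le_componentwise_cart) (auto simp: clamp_unit_def)

text \<open>The truncated subtraction implements the clamping at \<open>0\<close>.\<close>

definition shift_num :: "nat \<Rightarrow> nat \<Rightarrow> ('n::{finite,linorder} \<Rightarrow> int) \<Rightarrow> nat \<Rightarrow> 'n \<Rightarrow> nat" where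
  "shift_num K N w v c = min (2 ^ K) (grid_num K v c + 2 ^ (K - N) * nat (w c) - 2 ^ (K - N) * nat (- w c))"

lemma shift_num:
  assumes "N \<le> K"
  shows "real (shift_num K N w v c) / 2 ^ K = clamp_unit (grid_pt K v + lattice_vec N w) $ c"
proof -
  define a m where "a = grid_num K v c" and "m = int (2 ^ (K - N)) * w c"
  have int: "int (shift_num K N w v c) = max 0 (min (2 ^ K) (int a + m))"
  proof (cases "0 \<le> w c")
    case True
    define P where "P = 2 ^ (K - N) * nat (w c)"
    have P: "int P = m" using True by (simp add: P_def m_def)
    then have "0 \<le> m" by linarith
    moreover have "shift_num K N w v c = min (2 ^ K) (a + P)"
      using True by (simp add: shift_num_def a_def P_def)
    ultimately show ?thesis by (simp add: of_nat_min P)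
  next
    case False
    define P where "P = 2 ^ (K - N) * nat (- w c)"
    have P: "int P = - m" using False by (simp add: P_def m_def)
    have "shift_num K N w v c = min (2 ^ K) (a - P)"
      using False by (simp add: shift_num_def a_def P_def)
    moreover have "int (a - P) = max 0 (int a + m)" using P by linarith
    moreover have "min (2 ^ K) (max 0 x) = max 0 (min (2 ^ K) x)" for x :: int
      using order_trans[of 0 "2 ^ K" x] by (auto simp: min_def max_def)
    ultimately show ?thesis by (simp add: of_nat_min)
  qed
  have K: "(2::real) ^ K = 2 ^ (K - N) * 2 ^ N" using assms by (simp flip: power_add)
  have "(real_of_int m) / 2 ^ K = of_int (w c) / 2 ^ N" by (simp add: m_def K)
  then have pt: "(real a + of_int m) / 2 ^ K = (grid_pt K v + lattice_vec N w) $ c"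
    by (simp add: grid_pt_def lattice_vec_def a_def add_divide_distrib)
  have of_int: "real_of_int (max 0 (min (2 ^ K) y)) = max 0 (min (2 ^ K) (real_of_int y))" for y :: int
    by (simp add: of_int_max of_int_min)
  have "real (shift_num K N w v c) = real_of_int (int (shift_num K N w v c))" by simp
  also have "\<dots> = max 0 (min (2 ^ K) (real a + of_int m))" unfolding int of_int by simp
  finally have "real (shift_num K N w v c) / 2 ^ K = max 0 (min (2 ^ K) (real a + of_int m)) / 2 ^ K" by simp
  also have "\<dots> = max 0 (min 1 ((real a + of_int m) / 2 ^ K))"
    by (simp add: max_def min_def field_simps)
  finally show ?thesis by (simp only: pt clamp_unit_def vec_lambda_beta)
qed

lemma shift_num_le: "shift_num K N w v c \<le> 2 ^ K"
  by (simp add: shift_num_def)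

lemma computable_nat_grid_num:
  assumes "computable_nat k F" "computable_nat k G"
  shows "computable_nat k (\<lambda>xs. grid_num (F xs) (G xs) (c :: 'n::{finite,linorder}))"
proof -
  define s where "s ws = 2 * ws ! 1 + nbit (ws ! 3) (ws ! 0 * CARD('n) + coord_index c)" for ws :: "nat list"
  have "computable_nat (Suc (Suc 2)) s"
    unfolding s_def nbit_def by (intro computable_nat_intros) auto
  then have "computable_nat 2 (\<lambda>xs. rec_nat 0 (\<lambda>m y. s (m # y # xs)) (xs ! 0))"
    by (intro computable_nat_rec computable_nat_intros) auto
  moreover have "rec_nat 0 (\<lambda>m y. s (m # y # xs)) K = grid_num K (xs ! 1) c" for xs K
    by (induction K) (auto simp: s_def)
  ultimately have "computable_nat 2 (\<lambda>xs. grid_num (xs ! 0) (xs ! 1) c)" by simp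
  from computable_nat_comp2[OF this assms] show ?thesis .
qed

lemma computable_nat_shift_num:
  "computable_nat 4 (\<lambda>xs. shift_num (xs ! 1) (xs ! 2) w (xs ! 3) c)"
  unfolding shift_num_def by (intro computable_nat_intros computable_nat_grid_num) auto

lemma differentiable_clamped:
  fixes f :: "real ^ 'n::{finite,linorder} \<Rightarrow> real"
  assumes comp: "computable_on_cube f" and lip: "L-lipschitz_on (cbox 0 1) f"
    and random: "computably_random z"
  shows "(\<lambda>x. f (clamp_unit x)) differentiable (at z)"
proof -
  obtain F where F: "computable_rat (CARD('n) + 2) F"
    and F_approx: "\<And>p m a. (\<forall>i. a i \<le> 2 ^ m) \<Longrightarrow>
      \<bar>of_rat (F (p # m # map a coords)) - f (\<chi> i. real (a i) / 2 ^ m)\<bar> \<le> 1 / 2 ^ p"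
    using comp unfolding computable_on_cube_def by blast
  obtain Z where Z: "\<And>i. z $ i = binary_real (Z i)" "computably_random_seq (interleave Z)"
    using random unfolding computably_random_def by blast
  define val where "val p K N w v = F (p # K # map (shift_num K N w v) coords)" for p K N v and w :: "'n \<Rightarrow> int"
  interpret approximable_map "\<lambda>x. f (clamp_unit x)" L val
  proof
    show "0 \<le> L" using lip by (rule lipschitz_on_nonneg)
    show "\<bar>f (clamp_unit x) - f (clamp_unit y)\<bar> \<le> L * norm (x - y)" for x y
    proof -
      have "\<bar>f (clamp_unit x) - f (clamp_unit y)\<bar> \<le> L * norm (clamp_unit x - clamp_unit y)"
        using lipschitz_onD[OF lip clamp_unit_in_cbox clamp_unit_in_cbox, of x y] by (simp add: dist_norm)
      also have "\<dots> \<le> L * norm (x - y)"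
        by (intro mult_left_mono norm_clamp_unit_diff_le \<open>0 \<le> L\<close>)
      finally show ?thesis .
    qed
    show "\<bar>real_of_rat (val p K N w v) - f (clamp_unit (grid_pt K v + lattice_vec N w))\<bar> \<le> 1 / 2 ^ p"
      if "N \<le> K" for p K N w v
    proof -
      have "(\<chi> i. real (shift_num K N w v i) / 2 ^ K) = clamp_unit (grid_pt K v + lattice_vec N w)"
        by (simp add: vec_eq_iff shift_num[OF that])
      with F_approx[of "shift_num K N w v" K p] show ?thesis by (simp add: val_def shift_num_le)
    qed
    show "computable_rat 4 (\<lambda>xs. val (xs ! 0) (xs ! 1) (xs ! 2) w (xs ! 3))" for w
    proof -
      define Gs where "Gs = (\<lambda>xs. xs ! 0) # (\<lambda>xs. xs ! 1) #
        map (\<lambda>c xs. shift_num (xs ! 1) (xs ! 2) w (xs ! 3) c) (coords :: 'n list)"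
      have "length Gs = CARD('n) + 2" by (simp add: Gs_def length_coords)
      with F have "computable_rat (length Gs) F" by simp
      moreover have "computable_nat 4 G" if "G \<in> set Gs" for G
        using that by (auto simp: Gs_def intro!: computable_nat_proj computable_nat_shift_num[unfolded One_nat_def])
      ultimately have "computable_rat 4 (\<lambda>xs. F (map (\<lambda>G. G xs) Gs))" by (rule computable_rat_comp)
      then show ?thesis by (simp add: Gs_def val_def comp_def)
    qed
  qed
  show ?thesis by (rule differentiable_at_random[OF Z])
qed

section \<open>Random points avoid the boundary of the cube\<close>

lemma computable_on_cube_coordinate:
  "computable_on_cube (\<lambda>x :: real ^ 'n::{finite,linorder}. x $ c)"
  unfolding computable_on_cube_def
proof (intro conjI exI allI impI ballI)
  let ?F = "\<lambda>xs. of_nat (xs ! (2 + coord_index c)) * inverse (2 ^ (xs ! 1)) :: rat"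
  show "computable_rat (CARD('n) + 2) ?F"
    using coord_index(1)[of c] by (intro computable_rat_intros computable_nat_intros) auto
  show "\<bar>real_of_rat (?F (p # m # map a coords)) - (\<chi> i. real (a i) / 2 ^ m) $ c\<bar> \<le> 1 / 2 ^ p" for p m and a :: "'n \<Rightarrow> nat"
    using coord_index[of c] by (simp add: length_coords of_rat_mult of_rat_inverse of_rat_power divide_inverse)
  have "computable_nat 1 (\<lambda>xs. hd xs) \<longleftrightarrow> computable_nat 1 (\<lambda>xs. xs ! 0)"
    by (rule computable_nat_cong) (metis hd_conv_nth length_0_conv zero_neq_one)
  then show "computable_nat 1 (\<lambda>xs. hd xs)" by (simp add: computable_nat_proj)
  show "\<bar>x $ c - y $ c\<bar> \<le> 1 / 2 ^ i" if "norm (x - y) \<le> 1 / 2 ^ i" for i and x y :: "real ^ 'n::{finite,linorder}"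
    using component_le_norm_cart[of "x - y" c] that by simp
qed

lemma lipschitz_coordinate: "1-lipschitz_on X (\<lambda>x :: real ^ 'n::finite. x $ c)"
  using component_le_norm_cart[of "_ - _" c] by (intro lipschitz_onI) (auto simp: dist_norm dist_real_def)

text \<open>On a face the clamped coordinate function has a kink, with slope 1 into the cube and 0
  out of it. It arises from a computable Lipschitz function, so
  \<open>differentiable_clamped\<close> rules out a random point there without any look at binary
  expansions.\<close>

lemma random_not_on_boundary:
  fixes z :: "real ^ 'n::{finite,linorder}"
  assumes z: "z \<in> cbox 0 1" and random: "computably_random z"
  shows "0 < z $ c \<and> z $ c < 1"
proof (rule ccontr)
  assume contra: "\<not> ?thesis"
  have "0 \<le> z $ c" "z $ c \<le> 1" using z by (auto simp: mem_box_cart)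
  with contra have z01: "z $ c = 0 \<or> z $ c = 1" by linarith
  define G where "G x = clamp_unit x $ c" for x :: "real ^ 'n::{finite,linorder}"
  have "G differentiable (at z)"
    unfolding G_def by (rule differentiable_clamped[OF computable_on_cube_coordinate lipschitz_coordinate random])
  then obtain F where "(G has_derivative F) (at z)" unfolding differentiable_def by blast
  then have lin: "linear F" and F: "\<And>\<epsilon>. \<epsilon> > 0 \<Longrightarrow> \<exists>d>0. \<forall>y. norm (y - z) < d \<longrightarrow> norm (G y - G z - F (y - z)) \<le> \<epsilon> * norm (y - z)"
    unfolding has_derivative_at_alt by (auto simp: bounded_linear.linear)
  obtain d where d: "d > 0" "\<And>y. norm (y - z) < d \<Longrightarrow> norm (G y - G z - F (y - z)) \<le> 1 / 4 * norm (y - z)"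
    using F[of "1 / 4"] by auto
  \<comment> \<open>\<open>s \<le> 1 / 2\<close> keeps the inward step within the unit interval, so
    the two one-sided increments add up to \<open>s\<close> in absolute value, while
    differentiability with tolerance \<open>1 / 4\<close> allows at most
    \<open>s / 2\<close>.\<close>
  define s where "s = min (d / 2) (1 / 2)"
  have s: "0 < s" "s < d" "s \<le> 1 / 2" using d(1) by (auto simp: s_def)
  define h :: "real ^ 'n::{finite,linorder}" where "h = s *\<^sub>R axis c 1"
  have nh: "norm h = s" "h $ c = s" using s by (simp_all add: h_def)
  have 1: "\<bar>G (z + h) - G z - F h\<bar> \<le> s / 4" using d(2)[of "z + h"] nh s by simp
  have 2: "\<bar>G (z - h) - G z + F h\<bar> \<le> s / 4" using d(2)[of "z - h"] nh s linear_neg[OF lin, of h] by simp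
  have "\<bar>(G (z + h) - G z) + (G (z - h) - G z)\<bar> = s"
    using z01 s nh(2) by (auto simp: G_def clamp_unit_def)
  with 1 2 s show False by linarith
qed

theorem theorem2p1:
  fixes f :: "real ^ 'n::{finite,linorder} \<Rightarrow> real"
    and z :: "real ^ 'n::{finite,linorder}"
  assumes "computable_on_cube f"
    and "\<exists>L. L-lipschitz_on (cbox 0 1) f"
    and "z \<in> cbox 0 1"
    and "computably_random z"
  shows "f differentiable (at z)"
proof -
  obtain L where "L-lipschitz_on (cbox 0 1) f" using assms(2) by blast
  from differentiable_clamped[OF assms(1) this assms(4)]
  obtain F where F: "((\<lambda>x. f (clamp_unit x)) has_derivative F) (at z)" unfolding differentiable_def by blast
  \<comment> \<open>Outside the cube \<open>f\<close> is arbitrary, so the derivative of the clamped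
    function passes to \<open>f\<close> only through an open set around \<open>z\<close> on which
    both agree.\<close>
  have "z \<in> box 0 1" using random_not_on_boundary[OF assms(3,4)] by (simp add: mem_box_cart)
  moreover have "f (clamp_unit x) = f x" if "x \<in> box 0 1" for x
    using that box_subset_cbox by (metis clamp_unit_eq subsetD)
  ultimately have "(f has_derivative F) (at z)"
    using has_derivative_transform_within_open[OF F open_box] by blast
  then show ?thesis unfolding differentiable_def by blast
qed

end
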